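(* Assume B1, B2 and B3 (stated in the context). Let $\widetilde\sigma=\sqrt{\sum_{i=1}^2\sum_{j=1}^D\sigma_{ij}^2}$ and $p_1(x)=\mathbb E\big[\int_0^\infty e^{-\rho t}h(x+\widetilde\sigma W_t)dt\big]$, where $W$ is a standard one-dimensional Brownian motion. (i) Suppose $K_1=K_2=K$. Then the following control yields one Pareto-optimal policy of the two-player game: $$\xi_t^{1*}=(\xi_t^{1*,+},\xi_t^{1*,-})=\Big(0,\ \max\big\{0,\max_{0\le u\le t}\{(x^1-x^2)+(\sigma^1-\sigma^2)\cdot B_u+\xi_u^{2*,-}-c_1\}\big\}\Big),$$ $$\xi_t^{2*}=(\xi_t^{2*,+},\xi_t^{2*,-})=\Big(0,\ \max\big\{0,\max_{0\le u\le t}\{-(x^1-x^2)+(\sigma^2-\sigma^1)\cdot B_u+\xi_u^{1*,-}-c_1\}\big\}\Big),$$ where $c_1$ is the unique solution of $$\frac{\widetilde\sigma}{\sqrt{2\rho}}\tanh\Big(\frac{\sqrt{2\rho}}{\widetilde\sigma}x\Big)=\frac{p_1'(x)-\frac K2}{p_1''(x)} .$$ The associated Pareto-optimal value (the regulator's value function with equal weights) is $$v(x^1,x^2)=\begin{cases}-\dfrac{\widetilde\sigma^2p_1''(c_1)\cosh\big((x^1-x^2)\frac{\sqrt{2\rho}}{\widetilde\sigma}\big)}{2\rho\cosh\big(c_1\frac{\sqrt{2\rho}}{\widetilde\sigma}\big)}+p_1(x^1-x^2),&0\le x^1-x^2\le c_1,\\ v(x^2+c_1,x^2)+\frac K2(x^1-x^2-c_1),&x^1-x^2\ge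 c_1,\\ v(-x^1,-x^2),&x^1-x^2<0.\end{cases}$$ (ii) Suppose $K_1>K_2$. Then the following control yields a Pareto-optimal policy of the two-player game: $\xi_t^{1*}=(0,0)$ and $\xi_t^{2*}=(\xi_t^{2*,+},\xi_t^{2*,-})$ with $$\xi_t^{2*,-}=\max\big\{0,\max_{0\le u\le t}\{-(x^1-x^2)+(\sigma^2-\sigma^1)\cdot B_u+\xi_u^{2*,+}-\widetilde c_1\}\big\},$$ $$\xi_t^{2*,+}=\max\big\{0,\max_{0\le u\le t}\{(x^1-x^2)+(\sigma^1-\sigma^2)\cdot B_u+\xi_u^{2*,-}-\widetilde c_1\}\big\},$$ where $\widetilde c_1$ is the unique solution of $$\frac{\widetilde\sigma}{\sqrt{2\rho}}\tanh\Big(\frac{\sqrt{2\rho}}{\widetilde\sigma}x\Big)=\frac{p_1'(x)-\frac{K_2}2}{p_1''(x)},$$ and the associated Pareto-optimal value is $$v(x^1,x^2)=\begin{cases}-\dfrac{\widetilde\sigma^2p_1''(\widetilde c_1)\cosh\big((x^1-x^2)\frac{\sqrt{2\rho}}{\widetilde\sigma}\big)}{2\rho\cosh\big(\widetilde c_1\frac{\sqrt{2\rho}}{\widetilde\sigma}\big)}+p_1(x^1-x^2),&0\le x^1-x^2\le\widetilde c_1,\\ v(x^2+\widetilde c_1,x^2)+\frac{K_2}2\big((x^1-x^2)-\widetilde c_1\big),&x^1-x^2\ge\widetilde c_1,\\ v(-x^1,-x^2),&x^1-x^2<0.\end{cases}$$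
   Context: Two-player game. Let $B$ be a $D$-dimensional Brownian motion on a filtered probability space $(\Omega,\mathcal F,\{\mathcal F_t\}_{t\ge0},\mathbb P)$, $\sigma=(\sigma_{ij})\in\mathbb R^{2\times D}$ constant with rows $\sigma^1,\sigma^2$ and $\sigma\sigma^T\succeq\lambda I$ for some $\lambda>0$, and $\rho>0$. Admissible controls: for $i=1,2$, $\xi^i=(\xi^{i,+},\xi^{i,-})$ is a pair of $\mathcal F_t$-progressively measurable, càdlàg, non-decreasing processes with $\xi^{i,\pm}_{0-}=0$ and $\mathbb E[\int_0^\infty e^{-\rho t}d\xi_t^{i,\pm}]<\infty$ (integrals include a possible jump at $t=0$); $\mathcal U_2$ is the set of pairs $(\xi^1,\xi^2)$ of such controls. Assumptions: B1: the regulator's weights are equal, $L_1=L_2=\frac12$ (and the two players' weights in the average rate are equal, $a_1=a_2$; these do not enter the costs below). B2: both running costs equal $h(x^1-x^2)$, where $h\in\mathcal C^3(\mathbb R)$ takes values in $[0,\infty)$, is symmetric ($h(-y)=h(y)$), there exist $0<c<C$ with $c<h''<C$, and $h''$ is non-decreasing and bounded away from $0$. B3: there is no drift ($\mu^1=\mu^2=0$), $K_1^+=K_1^-=K_1>0$ and $K_2^+=K_2^-=K_2>0$, where $K_i^{+}$ and $K_i^-$ are player $i$'s proportional costs of upward and downward control. Dynamics: $dX_t^i=\sigma^i\cdot dB_t+d\xi_t^{i,+}-d\xi_t^{i,-}$, $X_{0-}^i=x^i$, $i=1,2$. Costs: $J^i(x^1,x^2,\xi^1,\xi^2)=\mathbb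 E_{(x^1,x^2)}\int_0^\infty e^{-\rho t}[h(X_t^1-X_t^2)dt+K_i\,d\xi_t^{i,+}+K_i\,d\xi_t^{i,-}]$; player $i$ minimizes $J^i$. Regulator's value function with equal weights: $v(x^1,x^2)=\inf_{(\xi^1,\xi^2)\in\mathcal U_2}\frac12\big[J^1(x^1,x^2,\xi^1,\xi^2)+J^2(x^1,x^2,\xi^1,\xi^2)\big]$. Pareto optimality: $\xi^*=(\xi^{1*},\xi^{2*})\in\mathcal U_2$ is Pareto-optimal iff there does not exist $\xi\in\mathcal U_2$ such that, for all $x\in\mathbb R^2$, $J^i(x;\xi)\le J^i(x;\xi^* )$ for $i=1,2$ and $J^j(x;\xi)<J^j(x;\xi^* )$ for some $j\in\{1,2\}$.
   Formalization: The constant σ̃ is taken as |σ¹−σ²| = √(Σ_j(σ_1j−σ_2j)²), the volatility of X¹−X², instead of the printed √(Σσ_ij²); the two agree exactly when σ¹·σ²=0, and with the printed constant the value formula fails otherwise (e.g. h(y)=y²). *)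

theory Defs
  imports "HOL-Probability.Probability"
begin

text \<open>The time set is \<^typ>\<open>real\<close>; filtrations and Brownian motions are only constrained on
  \<open>[0, \<infinity>)\<close>.\<close>

definition filtration_on :: "'a measure \<Rightarrow> (real \<Rightarrow> 'a measure) \<Rightarrow> bool" where
  "filtration_on M F \<longleftrightarrow>
     (\<forall>t\<ge>0. subalgebra M (F t)) \<and> (\<forall>s t. 0 \<le> s \<and> s \<le> t \<longrightarrow> subalgebra (F t) (F s))"

text \<open>Standard Brownian motion relative to a filtration, started at 0, with values in a Euclidean
  space: increments over \<open>[s, t]\<close> are independent of the past and have law \<open>N(0, (t - s) I)\<close>, whose
  density is the product of one-dimensional Gaussian densities over an orthonormal basis.\<close>

definition brownian_motion ::
  "'a measure \<Rightarrow> (real \<Rightarrow> 'a measure) \<Rightarrow> (real \<Rightarrow> 'a \<Rightarrow> 'b::euclidean_space) \<Rightarrow> bool" where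
  "brownian_motion M F B \<longleftrightarrow>
     prob_space M \<and> filtration_on M F \<and>
     (\<forall>t\<ge>0. B t \<in> borel_measurable (F t)) \<and>
     (\<forall>\<omega>\<in>space M. B 0 \<omega> = 0 \<and> continuous_on {0..} (\<lambda>t. B t \<omega>)) \<and>
     (\<forall>s t. 0 \<le> s \<and> s < t \<longrightarrow>
        distributed M lborel (\<lambda>\<omega>. B t \<omega> - B s \<omega>)
          (\<lambda>y. ennreal (\<Prod>b\<in>Basis. normal_density 0 (sqrt (t - s)) (y \<bullet> b))) \<and>
        prob_space.indep_set M (sets (F s))
          {(\<lambda>\<omega>. B t \<omega> - B s \<omega>) -` A \<inter> space M | A. A \<in> sets borel})"

definition natural_filtration ::
  "'a measure \<Rightarrow> (real \<Rightarrow> 'a \<Rightarrow> 'b::topological_space) \<Rightarrow> real \<Rightarrow> 'a measure" where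
  "natural_filtration M X t =
     sigma (space M) (\<Union>s\<in>{0..t}. {X s -` A \<inter> space M | A. A \<in> sets borel})"

type_synonym 'a process = "real \<Rightarrow> 'a \<Rightarrow> real"

text \<open>A control is the pair (upward, downward); players are indexed by the two-element type
  \<^typ>\<open>2\<close>. A policy assigns a pair of controls to every initial position \<open>x = (x\<^sup>1, x\<^sup>2)\<close>.\<close>

type_synonym 'a control = "'a process \<times> 'a process"
type_synonym 'a profile = "2 \<Rightarrow> 'a control"
type_synonym 'a policy = "real ^ 2 \<Rightarrow> 'a profile"

text \<open>Control processes vanish at negative times, which encodes \<open>\<xi>\<^bsub>0-\<^esub> = 0\<close>: the Stieltjes measure
  \<open>d\<xi>\<close> then lives on \<open>[0, \<infinity>)\<close> and has an atom at 0 of mass \<open>\<xi>\<^sub>0\<close>.\<close>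

definition discounted_effort :: "real \<Rightarrow> 'a process \<Rightarrow> 'a \<Rightarrow> ennreal" where
  "discounted_effort \<rho> \<xi> \<omega> =
     (\<integral>\<^sup>+ t\<in>{0..}. ennreal (exp (- \<rho> * t)) \<partial>interval_measure (\<lambda>t. \<xi> t \<omega>))"

definition progressively_measurable ::
  "(real \<Rightarrow> 'a measure) \<Rightarrow> 'a process \<Rightarrow> bool" where
  "progressively_measurable F \<xi> \<longleftrightarrow>
     (\<forall>t\<ge>0. (\<lambda>(s, \<omega>). \<xi> s \<omega>) \<in> borel_measurable (restrict_space borel {0..t} \<Otimes>\<^sub>M F t))"

definition cadlag :: "(real \<Rightarrow> real) \<Rightarrow> bool" where
  "cadlag f \<longleftrightarrow> (\<forall>t. continuous (at_right t) f \<and> (\<exists>l. (f \<longlongrightarrow> l) (at_left t)))"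

definition admissible_process ::
  "'a measure \<Rightarrow> (real \<Rightarrow> 'a measure) \<Rightarrow> real \<Rightarrow> 'a process \<Rightarrow> bool" where
  "admissible_process M F \<rho> \<xi> \<longleftrightarrow>
     progressively_measurable F \<xi> \<and>
     (\<forall>\<omega>\<in>space M. cadlag (\<lambda>t. \<xi> t \<omega>) \<and> mono (\<lambda>t. \<xi> t \<omega>) \<and> (\<forall>t<0. \<xi> t \<omega> = 0)) \<and>
     (\<integral>\<^sup>+ \<omega>. discounted_effort \<rho> \<xi> \<omega> \<partial>M) < \<infinity>"

definition admissible ::
  "'a measure \<Rightarrow> (real \<Rightarrow> 'a measure) \<Rightarrow> real \<Rightarrow> 'a profile set" where
  "admissible M F \<rho> =
     {\<xi>. \<forall>i. admissible_process M F \<rho> (fst (\<xi> i)) \<and> admissible_process M F \<rho> (snd (\<xi> i))}"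

definition state ::
  "(real \<Rightarrow> 'a \<Rightarrow> real ^ 'd) \<Rightarrow> real ^ 'd ^ 2 \<Rightarrow> real ^ 2 \<Rightarrow> 'a profile \<Rightarrow> 2 \<Rightarrow> 'a process" where
  "state B \<sigma> x \<xi> i t \<omega> = x $ i + \<sigma> $ i \<bullet> B t \<omega> + fst (\<xi> i) t \<omega> - snd (\<xi> i) t \<omega>"

text \<open>All integrands are nonnegative when \<open>h \<ge> 0\<close> and \<open>K \<ge> 0\<close>, so the cost is an extended
  nonnegative number. It is viewed in \<^typ>\<open>ereal\<close>, so that equating it with a real expression does
  not truncate negative reals to 0.\<close>

definition cost ::
  "'a measure \<Rightarrow> (real \<Rightarrow> 'a \<Rightarrow> real ^ 'd) \<Rightarrow> real ^ 'd ^ 2 \<Rightarrow> real \<Rightarrow> (real \<Rightarrow> real) \<Rightarrow>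
     (2 \<Rightarrow> real) \<Rightarrow> 2 \<Rightarrow> real ^ 2 \<Rightarrow> 'a profile \<Rightarrow> ereal" where
  "cost M B \<sigma> \<rho> h K i x \<xi> = enn2ereal (\<integral>\<^sup>+ \<omega>.
      (\<integral>\<^sup>+ t\<in>{0..}. ennreal (exp (- \<rho> * t) * h (state B \<sigma> x \<xi> 1 t \<omega> - state B \<sigma> x \<xi> 2 t \<omega>)) \<partial>lborel)
      + ennreal (K i) * discounted_effort \<rho> (fst (\<xi> i)) \<omega>
      + ennreal (K i) * discounted_effort \<rho> (snd (\<xi> i)) \<omega> \<partial>M)"

definition regulator_cost ::
  "'a measure \<Rightarrow> (real \<Rightarrow> 'a \<Rightarrow> real ^ 'd) \<Rightarrow> real ^ 'd ^ 2 \<Rightarrow> real \<Rightarrow> (real \<Rightarrow> real) \<Rightarrow>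
     (2 \<Rightarrow> real) \<Rightarrow> real ^ 2 \<Rightarrow> 'a profile \<Rightarrow> ereal" where
  "regulator_cost M B \<sigma> \<rho> h K x \<xi> =
     ereal (1/2) * (cost M B \<sigma> \<rho> h K 1 x \<xi> + cost M B \<sigma> \<rho> h K 2 x \<xi>)"

definition regulator_value ::
  "'a measure \<Rightarrow> (real \<Rightarrow> 'a measure) \<Rightarrow> (real \<Rightarrow> 'a \<Rightarrow> real ^ 'd) \<Rightarrow> real ^ 'd ^ 2 \<Rightarrow> real \<Rightarrow>
     (real \<Rightarrow> real) \<Rightarrow> (2 \<Rightarrow> real) \<Rightarrow> real ^ 2 \<Rightarrow> ereal" where
  "regulator_value M F B \<sigma> \<rho> h K x = (INF \<xi>\<in>admissible M F \<rho>. regulator_cost M B \<sigma> \<rho> h K x \<xi>)"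

definition pareto_optimal ::
  "'a measure \<Rightarrow> (real \<Rightarrow> 'a measure) \<Rightarrow> (real \<Rightarrow> 'a \<Rightarrow> real ^ 'd) \<Rightarrow> real ^ 'd ^ 2 \<Rightarrow> real \<Rightarrow>
     (real \<Rightarrow> real) \<Rightarrow> (2 \<Rightarrow> real) \<Rightarrow> 'a policy \<Rightarrow> bool" where
  "pareto_optimal M F B \<sigma> \<rho> h K \<xi>' \<longleftrightarrow>
     (\<forall>x. \<xi>' x \<in> admissible M F \<rho>) \<and>
     (\<nexists>\<xi>. (\<forall>x. \<xi> x \<in> admissible M F \<rho>) \<and>
        (\<forall>x. (\<forall>i. cost M B \<sigma> \<rho> h K i x (\<xi> x) \<le> cost M B \<sigma> \<rho> h K i x (\<xi>' x)) \<and>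
             (\<exists>j. cost M B \<sigma> \<rho> h K j x (\<xi> x) < cost M B \<sigma> \<rho> h K j x (\<xi>' x))))"

text \<open>Volatility of the uncontrolled difference \<open>X\<^sup>1 - X\<^sup>2\<close>. The paper prints
  \<open>\<surd>(\<Sum>i j. \<sigma>\<^sub>i\<^sub>j\<^sup>2)\<close>, which omits the cross term \<open>-2 \<sigma>\<^sup>1 \<bullet> \<sigma>\<^sup>2\<close>; the two agree exactly when
  \<open>\<sigma>\<^sup>1 \<bullet> \<sigma>\<^sup>2 = 0\<close>, and the printed value formula fails otherwise.\<close>

definition sigma_tilde :: "real ^ 'd ^ 2 \<Rightarrow> real" where
  "sigma_tilde \<sigma> = sqrt (\<Sum>j\<in>UNIV. (\<sigma> $ 1 $ j - \<sigma> $ 2 $ j)\<^sup>2)"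

lemma sigma_tilde_eq_printed_iff:
  "sigma_tilde \<sigma> = sqrt (\<Sum>i\<in>UNIV. \<Sum>j\<in>UNIV. (\<sigma> $ i $ j)\<^sup>2) \<longleftrightarrow> \<sigma> $ 1 \<bullet> \<sigma> $ 2 = 0"
proof -
  have "(\<Sum>j\<in>UNIV. (\<sigma> $ 1 $ j - \<sigma> $ 2 $ j)\<^sup>2) =
      (\<Sum>i\<in>UNIV. \<Sum>j\<in>UNIV. (\<sigma> $ i $ j)\<^sup>2) - 2 * (\<sigma> $ 1 \<bullet> \<sigma> $ 2)"
    by (simp add: UNIV_2 inner_vec_def power2_diff sum.distrib sum_subtractf sum_distrib_left
        mult.assoc)
  then show ?thesis
    by (auto simp: sigma_tilde_def)
qed

definition discounted_running_cost ::
  "'w measure \<Rightarrow> 'w process \<Rightarrow> real \<Rightarrow> (real \<Rightarrow> real) \<Rightarrow> real \<Rightarrow> real \<Rightarrow> real" where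
  "discounted_running_cost N W \<rho> h s x =
     (\<integral>\<omega>. (LINT t:{0..}|lborel. exp (- \<rho> * t) * h (x + s * W t \<omega>)) \<partial>N)"

definition boundary_equation :: "real \<Rightarrow> real \<Rightarrow> (real \<Rightarrow> real) \<Rightarrow> real \<Rightarrow> real \<Rightarrow> bool" where
  "boundary_equation s \<rho> p k x \<longleftrightarrow>
     s / sqrt (2 * \<rho>) * tanh (sqrt (2 * \<rho>) / s * x) = (deriv p x - k / 2) / deriv (deriv p) x"

definition value_formula ::
  "real \<Rightarrow> real \<Rightarrow> (real \<Rightarrow> real) \<Rightarrow> real \<Rightarrow> real \<Rightarrow> (real ^ 2 \<Rightarrow> ereal) \<Rightarrow> bool" where
  "value_formula s \<rho> p k c v \<longleftrightarrow> (\<forall>x1 x2.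
     (0 \<le> x1 - x2 \<and> x1 - x2 \<le> c \<longrightarrow>
        v (vector [x1, x2]) =
          ereal (- (s\<^sup>2 * deriv (deriv p) c * cosh ((x1 - x2) * (sqrt (2 * \<rho>) / s)))
                   / (2 * \<rho> * cosh (c * (sqrt (2 * \<rho>) / s))) + p (x1 - x2))) \<and>
     (x1 - x2 \<ge> c \<longrightarrow>
        v (vector [x1, x2]) = v (vector [x2 + c, x2]) + ereal (k / 2 * (x1 - x2 - c))) \<and>
     (x1 - x2 < 0 \<longrightarrow> v (vector [x1, x2]) = v (vector [- x1, - x2])))"

definition running_max0 :: "(real \<Rightarrow> real) \<Rightarrow> real \<Rightarrow> real" where
  "running_max0 f t = max 0 (SUP u\<in>{0..t}. f u)"

text \<open>The two one-sided reflections are mutually coupled, so each description is a system of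
  equations for the control, required almost surely for all \<open>t \<ge> 0\<close>.\<close>

definition both_reflect ::
  "'a measure \<Rightarrow> (real \<Rightarrow> 'a \<Rightarrow> real ^ 'd) \<Rightarrow> real ^ 'd ^ 2 \<Rightarrow> real \<Rightarrow> 'a policy \<Rightarrow> bool" where
  "both_reflect M B \<sigma> c \<xi> \<longleftrightarrow> (\<forall>x. AE \<omega> in M. \<forall>t\<ge>0.
     fst (\<xi> x 1) t \<omega> = 0 \<and>
     snd (\<xi> x 1) t \<omega> =
       running_max0 (\<lambda>u. (x $ 1 - x $ 2) + (\<sigma> $ 1 - \<sigma> $ 2) \<bullet> B u \<omega> + snd (\<xi> x 2) u \<omega> - c) t \<and>
     fst (\<xi> x 2) t \<omega> = 0 \<and>
     snd (\<xi> x 2) t \<omega> =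
       running_max0 (\<lambda>u. - (x $ 1 - x $ 2) + (\<sigma> $ 2 - \<sigma> $ 1) \<bullet> B u \<omega> + snd (\<xi> x 1) u \<omega> - c) t)"

definition second_reflects ::
  "'a measure \<Rightarrow> (real \<Rightarrow> 'a \<Rightarrow> real ^ 'd) \<Rightarrow> real ^ 'd ^ 2 \<Rightarrow> real \<Rightarrow> 'a policy \<Rightarrow> bool" where
  "second_reflects M B \<sigma> c \<xi> \<longleftrightarrow> (\<forall>x. AE \<omega> in M. \<forall>t\<ge>0.
     fst (\<xi> x 1) t \<omega> = 0 \<and> snd (\<xi> x 1) t \<omega> = 0 \<and>
     snd (\<xi> x 2) t \<omega> =
       running_max0 (\<lambda>u. - (x $ 1 - x $ 2) + (\<sigma> $ 2 - \<sigma> $ 1) \<bullet> B u \<omega> + fst (\<xi> x 2) u \<omega> - c) t \<and>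
     fst (\<xi> x 2) t \<omega> =
       running_max0 (\<lambda>u. (x $ 1 - x $ 2) + (\<sigma> $ 1 - \<sigma> $ 2) \<bullet> B u \<omega> + snd (\<xi> x 2) u \<omega> - c) t)"

end

theory Submission
  imports Defs
begin

text \<open>
  Only the gap \<open>Z = X\<^sup>1 - X\<^sup>2\<close> enters the running cost, and moving the gap by one unit costs the
  regulator at least \<open>k/2\<close>, where \<open>k = K 2\<close> is the smaller unit price; when the prices are equal
  it does not matter who pays. The regulator therefore solves a one-dimensional problem: keep a
  Brownian motion with volatility \<open>s\<close> close to 0 at proportional cost \<open>k/2\<close>. Its value \<open>V\<close> should
  satisfy \<open>\<rho> V - s\<^sup>2/2 V'' \<le> h\<close> and \<open>\<bar>V'\<bar> \<le> k/2\<close>, with equality in the first relation on \<open>[-c, c]\<close> and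
  in the second outside. Even solutions of \<open>\<rho> V - s\<^sup>2/2 V'' = h\<close> are \<open>p\<^sub>1 - A cosh (\<beta> z)\<close> with
  \<open>\<beta> = sqrt (2 \<rho>) / s\<close>; the conditions \<open>V'' c = 0\<close> and \<open>V' c = k/2\<close> determine \<open>A\<close> and are
  equivalent to the boundary equation for \<open>c\<close> (\<open>boundary_equation_unique_solution\<close>,
  \<open>barrier_value_exists\<close>).

  The verification uses no stochastic integral. Discounting at rate \<open>\<rho>\<close> is observation at an
  independent exponential time, so that discounted effort becomes the expected accumulated effort
  at that time (\<open>discounted_Stieltjes_integral\<close>). Let \<open>S\<close> be the total effort of a control and
  \<open>G t = E[V (Z t) + k/2 S t]\<close>. A Taylor expansion over a step of length \<open>d\<close> gives
  \<open>G (t + d) = G t + d s\<^sup>2/2 E[V'' (Z t)] + E[slack] + O(d powr (3/2))\<close>, where the slack is the amount by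
  which the effort spent during the step exceeds the reduction of \<open>V\<close> that it buys. It is
  nonnegative because \<open>\<bar>V'\<bar> \<le> k/2\<close>. Averaging this relation over the exponential time and letting \<open>d\<close> tend to
  0 bounds the cost of every control from below by \<open>V\<close> (\<open>value_lower_bound\<close>). A reflecting control
  acts only where \<open>\<bar>V'\<bar>\<close> is nearly \<open>k/2\<close>, hence its slack is negligible and its cost is exactly \<open>V\<close>
  (\<open>reflection_attains_value\<close>). The same averaged expansion, applied to an uncontrolled Brownian
  motion, identifies \<open>p\<^sub>1\<close> with the solution of the differential equation that has bounded second
  derivative (\<open>discounted_running_cost_eq\<close>).

  The coupled equations of the reflecting policies say that two nondecreasing processes push the
  gap down from \<open>c\<close> and up from \<open>-c\<close>. Every solution in nondecreasing processes pushes at one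
  barrier at a time and only close to it (\<open>not_both_increase\<close>, \<open>increase_near_barrier\<close>), which is all that
  the cost computation needs. A solution is the supremum of the monotone iteration that starts
  from 0 (\<open>push_reflects\<close>); its expected effort is finite because it is minimal among all pairs of
  nondecreasing processes that keep the gap in \<open>[-c, c]\<close>, and a discretely reflected walk provides
  such a pair with effort growing linearly in time (\<open>push_effort_expectation\<close>).

  Finally, a policy that minimizes the sum of two finite costs cannot be dominated
  (\<open>pareto_optimal_of_regulator_optimal\<close>).
\<close>

section \<open>The resolvent equation and the free boundary\<close>

lemma antiderivative_exists:
  fixes f :: "real \<Rightarrow> real"
  assumes "continuous_on UNIV f"
  obtains F where "\<And>x. (F has_real_derivative f x) (at x)"
proof -
  have "\<exists>F. \<forall>x::real. -\<infinity> < ereal x \<longrightarrow> ereal x < \<infinity> \<longrightarrow> (F has_vector_derivative f x) (at x)"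
    using assms by (intro einterval_antiderivative) (auto simp: continuous_on_eq_continuous_at)
  then obtain F where "\<And>x::real. (F has_vector_derivative f x) (at x)" by auto
  then show ?thesis
    by (intro that[of F]) (simp add: has_real_derivative_iff_has_vector_derivative)
qed

lemma DERIV_even_imp_odd:
  fixes f :: "real \<Rightarrow> real"
  assumes f: "\<And>x. (f has_real_derivative f' x) (at x)" and even: "\<And>x. f (- x) = f x"
  shows "f' (- x) = - f' x"
proof -
  have "((\<lambda>y. f (- y)) has_real_derivative - f' (- x)) (at x)"
    using f[of "- x"] by (simp add: DERIV_mirror)
  then have "- f' (- x) = f' x" using f[of x] even DERIV_unique by auto
  then show ?thesis by simp
qed

lemma DERIV_odd_imp_even:
  fixes f :: "real \<Rightarrow> real"
  assumes f: "\<And>x. (f has_real_derivative f' x) (at x)" and odd: "\<And>x. f (- x) = - f x"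
  shows "f' (- x) = f' x"
proof -
  have "((\<lambda>y. f (- y)) has_real_derivative - f' (- x)) (at x)"
    using f[of "- x"] by (simp add: DERIV_mirror)
  moreover have "((\<lambda>y. - f y) has_real_derivative - f' x) (at x)"
    by (rule DERIV_minus[OF f])
  ultimately show ?thesis using odd DERIV_unique by fastforce
qed

lemma DERIV_bounded_imp_lipschitz:
  fixes f :: "real \<Rightarrow> real"
  assumes f: "\<And>x. (f has_real_derivative f' x) (at x)" and b: "\<And>x. \<bar>f' x\<bar> \<le> L"
  shows "\<bar>f x - f y\<bar> \<le> L * \<bar>x - y\<bar>"
  using field_differentiable_bound[of UNIV f f' L x y] f b by (simp add: has_field_derivative_at_within)

text \<open>The solution is \<open>\<integral> exp (- \<beta> u) g (x + u) du\<close> over \<open>u \<ge> 0\<close>. With \<open>I\<close> an antiderivative of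
  \<open>exp (- \<beta> y) g y\<close>, it equals \<open>exp (\<beta> x) (C - I x)\<close> for the limit \<open>C\<close> of \<open>I\<close> at infinity, and the
  monotone functions \<open>I\<close> and \<open>I + b/\<beta> exp (- \<beta> y)\<close> enclose this limit.\<close>

lemma bounded_decay_solution:
  fixes g :: "real \<Rightarrow> real"
  assumes \<beta>: "0 < \<beta>" and g: "continuous_on UNIV g" "\<And>x. 0 < g x" "\<And>x. g x \<le> b"
  obtains \<psi> where "\<And>x. (\<psi> has_real_derivative \<beta> * \<psi> x - g x) (at x)"
    "\<And>x. 0 < \<psi> x" "\<And>x. \<psi> x \<le> b / \<beta>"
proof -
  obtain I where I: "\<And>x. (I has_real_derivative exp (- \<beta> * x) * g x) (at x)"
    by (rule antiderivative_exists[of "\<lambda>x. exp (- \<beta> * x) * g x"])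
      (auto intro!: continuous_intros g)
  have I_mono: "I x < I y" if "x < y" for x y
    by (rule DERIV_pos_imp_increasing[OF that]) (use I g in \<open>auto intro!: exI mult_pos_pos\<close>)
  have J: "((\<lambda>y. I y + b / \<beta> * exp (- \<beta> * y)) has_real_derivative exp (- \<beta> * y) * (g y - b)) (at y)" for y
    by (rule derivative_eq_intros I | use \<beta> in \<open>simp add: field_simps\<close>)+
  have J_anti: "I y + b / \<beta> * exp (- \<beta> * y) \<le> I x + b / \<beta> * exp (- \<beta> * x)" if "x \<le> y" for x y
    by (rule DERIV_nonpos_imp_nonincreasing[OF that])
      (use J g in \<open>auto intro!: exI mult_nonneg_nonpos\<close>)
  have b0: "0 < b" using g(2)[of 0] g(3)[of 0] by linarith
  have bound: "I y \<le> I x + b / \<beta> * exp (- \<beta> * x)" for x y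
  proof (cases "x \<le> y")
    case True
    then show ?thesis using J_anti[OF True] b0 \<beta>
      by (smt (verit) divide_pos_pos exp_gt_zero mult_pos_pos)
  next
    case False
    then show ?thesis using I_mono[of y x] b0 \<beta>
      by (smt (verit) divide_pos_pos exp_gt_zero mult_pos_pos)
  qed
  define C where "C = (SUP y. I y)"
  have bdd: "bdd_above (range I)" using bound[of _ 0] by (auto intro!: bdd_aboveI)
  have C_upper: "C \<le> I x + b / \<beta> * exp (- \<beta> * x)" for x
    unfolding C_def by (rule cSUP_least) (use bound in auto)
  have C_lower: "I x < C" for x
    using I_mono[of x "x + 1"] cSUP_upper[OF UNIV_I bdd, of "x + 1"] unfolding C_def by simp
  show ?thesis
  proof (rule that[of "\<lambda>x. exp (\<beta> * x) * (C - I x)"])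
    fix x
    have ee: "exp (\<beta> * x) * exp (- \<beta> * x) = 1" by (simp flip: exp_add)
    show "((\<lambda>x. exp (\<beta> * x) * (C - I x)) has_real_derivative \<beta> * (exp (\<beta> * x) * (C - I x)) - g x) (at x)"
      by (rule derivative_eq_intros I refl)+ (use ee in \<open>simp add: algebra_simps\<close>)
    show "0 < exp (\<beta> * x) * (C - I x)" using C_lower[of x] by simp
    have "exp (\<beta> * x) * (C - I x) \<le> exp (\<beta> * x) * (b / \<beta> * exp (- \<beta> * x))"
      using C_upper[of x] by (intro mult_left_mono) auto
    also have "\<dots> = b / \<beta>" using ee by (simp add: algebra_simps)
    finally show "exp (\<beta> * x) * (C - I x) \<le> b / \<beta>" .
  qed
qed

locale convex_cost =
  fixes \<rho> s a b :: real and h h1 h2 :: "real \<Rightarrow> real"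
  assumes \<rho>_pos: "0 < \<rho>" and s_pos: "0 < s"
    and h_deriv: "\<And>x. (h has_real_derivative h1 x) (at x)"
    and h1_deriv: "\<And>x. (h1 has_real_derivative h2 x) (at x)"
    and h2_cont: "continuous_on UNIV h2"
    and a_pos: "0 < a" and h2_lower: "\<And>x. a \<le> h2 x" and h2_upper: "\<And>x. h2 x \<le> b"
    and h_nonneg: "\<And>x. 0 \<le> h x" and h_even: "\<And>x. h (- x) = h x"
begin

definition \<beta> :: real where "\<beta> = sqrt (2 * \<rho>) / s"

lemma \<beta>_pos: "0 < \<beta>" using \<rho>_pos s_pos by (simp add: \<beta>_def)

lemma s2_\<beta>2: "s\<^sup>2 * \<beta>\<^sup>2 = 2 * \<rho>"
  using \<rho>_pos s_pos by (simp add: \<beta>_def power_divide)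

lemma h2_pos: "0 < h2 x" using a_pos h2_lower[of x] by linarith

lemma h1_odd: "h1 (- x) = - h1 x" by (rule DERIV_even_imp_odd[OF h_deriv h_even])
lemma h2_even: "h2 (- x) = h2 x" by (rule DERIV_odd_imp_even[OF h1_deriv h1_odd])

lemma h1_strict_mono: "x < y \<Longrightarrow> h1 x < h1 y"
  by (rule DERIV_pos_imp_increasing) (use h1_deriv h2_pos in auto)

lemma h1_0: "h1 0 = 0" using h1_odd[of 0] by simp

end

text \<open>The solution \<open>P\<close> of \<open>\<rho> P - s\<^sup>2/2 P'' = h\<close> with bounded second and third derivatives \<open>P2\<close>, \<open>P3\<close>.\<close>

locale resolvent_cost = convex_cost +
  fixes B :: real and P P1 P2 P3 :: "real \<Rightarrow> real"
  assumes P_deriv: "\<And>x. (P has_real_derivative P1 x) (at x)"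
    and P1_deriv: "\<And>x. (P1 has_real_derivative P2 x) (at x)"
    and P2_deriv: "\<And>x. (P2 has_real_derivative P3 x) (at x)"
    and P3_deriv: "\<And>x. (P3 has_real_derivative \<beta>\<^sup>2 * P2 x - 2 / s\<^sup>2 * h2 x) (at x)"
    and P_ODE: "\<And>x. \<rho> * P x - s\<^sup>2 / 2 * P2 x = h x"
    and P2_pos: "\<And>x. 0 < P2 x" and P2_upper: "\<And>x. P2 x \<le> B" and P3_bound: "\<And>x. \<bar>P3 x\<bar> \<le> B"
    and P_even: "\<And>x. P (- x) = P x"
    and P1_eq: "\<And>x. P1 x = h1 x / \<rho> + P3 x / \<beta>\<^sup>2"

text \<open>Only the second derivative of \<open>h\<close> is bounded, so the construction starts there: \<open>P2\<close> is the
  average of \<open>h2\<close> against the symmetric exponential kernel, divided by \<open>\<rho>\<close>; it is the weighted sum of a one-sided solution \<open>\<psi>\<close> and its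
  reflection. Then \<open>P\<close> is read off from the differential equation, and \<open>P2\<close> is its second derivative
  because both one-sided parts solve first-order equations.\<close>

lemma (in convex_cost) resolvent_exists:
  obtains P P1 P2 P3 B where "resolvent_cost \<rho> s a b h h1 h2 B P P1 P2 P3"
proof -
  obtain \<psi> where \<psi>: "\<And>x. (\<psi> has_real_derivative \<beta> * \<psi> x - h2 x) (at x)"
    "\<And>x. 0 < \<psi> x" "\<And>x. \<psi> x \<le> b / \<beta>"
    using bounded_decay_solution[OF \<beta>_pos h2_cont h2_pos h2_upper] by metis
  have \<psi>_refl: "((\<lambda>x. \<psi> (- x)) has_real_derivative - (\<beta> * \<psi> (- x)) + h2 x) (at x)" for x
    using \<psi>(1)[of "- x"] by (simp add: DERIV_mirror h2_even)
  define P2 where "P2 x = \<beta> / (2 * \<rho>) * (\<psi> x + \<psi> (- x))" for x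
  define P3 where "P3 x = \<beta>\<^sup>2 / (2 * \<rho>) * (\<psi> x - \<psi> (- x))" for x
  define P where "P x = (h x + s\<^sup>2 / 2 * P2 x) / \<rho>" for x
  define P1 where "P1 x = h1 x / \<rho> + P3 x / \<beta>\<^sup>2" for x
  define B where "B = max (\<beta> / (2 * \<rho>) * (2 * b / \<beta>)) (\<beta>\<^sup>2 / (2 * \<rho>) * (b / \<beta>))"
  have nz: "\<rho> \<noteq> 0" "\<beta> \<noteq> 0" "s \<noteq> 0" using \<rho>_pos \<beta>_pos s_pos by auto
  have s2: "s\<^sup>2 = 2 * \<rho> / \<beta>\<^sup>2" using s2_\<beta>2 nz by (simp add: field_simps)
  have d23: "(P2 has_real_derivative P3 x) (at x)" for x
    unfolding P2_def P3_def
    by (rule derivative_eq_intros \<psi>(1) \<psi>_refl refl)+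
      (simp add: algebra_simps power2_eq_square add_divide_distrib diff_divide_distrib)
  have d34: "(P3 has_real_derivative \<beta>\<^sup>2 * P2 x - 2 / s\<^sup>2 * h2 x) (at x)" for x
    unfolding P2_def P3_def s2
    by (rule derivative_eq_intros \<psi>(1) \<psi>_refl refl)+ (use nz in \<open>simp add: field_simps power2_eq_square\<close>)
  show ?thesis
  proof (rule that[of B P P1 P2 P3], unfold_locales)
    fix x
    have "(P has_real_derivative (h1 x + s\<^sup>2 / 2 * P3 x) / \<rho>) (at x)"
      unfolding P_def by (rule derivative_eq_intros h_deriv d23 refl)+ (use nz in \<open>auto simp: field_simps\<close>)
    also have "(h1 x + s\<^sup>2 / 2 * P3 x) / \<rho> = P1 x"
      unfolding P1_def s2 using nz by (simp add: field_simps)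
    finally show "(P has_real_derivative P1 x) (at x)" .
    have "(P1 has_real_derivative h2 x / \<rho> + (\<beta>\<^sup>2 * P2 x - 2 / s\<^sup>2 * h2 x) / \<beta>\<^sup>2) (at x)"
      unfolding P1_def by (intro DERIV_add DERIV_cdivide h1_deriv d34)
    also have "h2 x / \<rho> + (\<beta>\<^sup>2 * P2 x - 2 / s\<^sup>2 * h2 x) / \<beta>\<^sup>2 = P2 x"
      unfolding s2 using nz by (simp add: field_simps)
    finally show "(P1 has_real_derivative P2 x) (at x)" .
    show "\<rho> * P x - s\<^sup>2 / 2 * P2 x = h x" unfolding P_def using nz by (simp add: field_simps)
    show "0 < P2 x" unfolding P2_def using \<psi>(2)[of x] \<psi>(2)[of "-x"] \<rho>_pos \<beta>_pos by simp
    have "P2 x \<le> \<beta> / (2 * \<rho>) * (2 * b / \<beta>)" unfolding P2_def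
      using \<psi>(3)[of x] \<psi>(3)[of "-x"] \<rho>_pos \<beta>_pos by (intro mult_left_mono) auto
    then show "P2 x \<le> B" unfolding B_def by simp
    have "\<bar>\<psi> x - \<psi> (- x)\<bar> \<le> b / \<beta>"
      using \<psi>(2,3)[of x] \<psi>(2,3)[of "-x"] by (simp add: abs_le_iff)
    then have "\<bar>P3 x\<bar> \<le> \<beta>\<^sup>2 / (2 * \<rho>) * (b / \<beta>)" unfolding P3_def abs_mult
      using \<rho>_pos \<beta>_pos by (intro mult_mono) auto
    then show "\<bar>P3 x\<bar> \<le> B" unfolding B_def by simp
    show "P (- x) = P x" unfolding P_def P2_def by (simp add: h_even algebra_simps)
  qed (use d23 d34 P1_def in auto)
qed

context resolvent_cost
begin

lemma P1_odd: "P1 (- x) = - P1 x" by (rule DERIV_even_imp_odd[OF P_deriv P_even])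
lemma P2_even: "P2 (- x) = P2 x" by (rule DERIV_odd_imp_even[OF P1_deriv P1_odd])
lemma P3_odd: "P3 (- x) = - P3 x" by (rule DERIV_even_imp_odd[OF P2_deriv P2_even])

text \<open>The boundary equation multiplied by \<open>\<beta> P2 cosh (\<beta> x)\<close>. The product is chosen because its
  derivative no longer involves \<open>P\<close>.\<close>

definition boundary_gap :: "real \<Rightarrow> real \<Rightarrow> real" where
  "boundary_gap k x = P2 x * sinh (\<beta> * x) - \<beta> * (P1 x - k / 2) * cosh (\<beta> * x)"

lemma boundary_equation_iff_gap: "boundary_equation s \<rho> P k c \<longleftrightarrow> boundary_gap k c = 0"
proof -
  have dP: "deriv P = P1" using P_deriv by (intro ext DERIV_imp_deriv) auto
  have dP1: "deriv P1 = P2" using P1_deriv by (intro ext DERIV_imp_deriv) auto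
  have nz: "P2 c \<noteq> 0" "\<beta> \<noteq> 0" "cosh (\<beta> * c) \<noteq> 0"
    using P2_pos[of c] \<beta>_pos by auto
  have "boundary_equation s \<rho> P k c \<longleftrightarrow> 1 / \<beta> * (sinh (\<beta> * c) / cosh (\<beta> * c)) = (P1 c - k / 2) / P2 c"
    unfolding boundary_equation_def dP dP1 \<beta>_def tanh_def by (simp add: field_simps)
  also have "\<dots> \<longleftrightarrow> boundary_gap k c = 0"
    unfolding boundary_gap_def using nz by (auto simp: field_simps)
  finally show ?thesis .
qed

text \<open>The terms with \<open>P2\<close> cancel, and \<open>P3 - \<beta>\<^sup>2 P1\<close> is a multiple of \<open>h1\<close> by the differential equation.
  So the sign of the derivative at \<open>x > 0\<close> only depends on whether \<open>h1 x\<close> exceeds \<open>\<rho> k / 2\<close>.\<close>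

lemma boundary_gap_deriv:
  "(boundary_gap k has_real_derivative sinh (\<beta> * x) * (\<beta>\<^sup>2 / \<rho>) * (\<rho> * k / 2 - h1 x)) (at x)"
proof -
  have "(boundary_gap k has_real_derivative
      P3 x * sinh (\<beta> * x) + \<beta>\<^sup>2 * (k / 2 - P1 x) * sinh (\<beta> * x)) (at x)"
    unfolding boundary_gap_def
    by (rule derivative_eq_intros P1_deriv P2_deriv refl)+ (simp add: algebra_simps power2_eq_square)
  also have "P3 x * sinh (\<beta> * x) + \<beta>\<^sup>2 * (k / 2 - P1 x) * sinh (\<beta> * x)
      = sinh (\<beta> * x) * (\<beta>\<^sup>2 / \<rho>) * (\<rho> * k / 2 - h1 x)"
    unfolding P1_eq using \<rho>_pos \<beta>_pos by (simp add: field_simps)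
  finally show ?thesis .
qed

lemma boundary_gap_0: "boundary_gap k 0 = \<beta> * k / 2"
  using P1_odd[of 0] by (simp add: boundary_gap_def)

text \<open>The gap is positive at 0 and grows away from 0 as long as \<open>h1 \<le> \<rho> k / 2\<close>.\<close>

lemma boundary_gap_pos_below:
  assumes k: "0 < k" and x: "x \<le> 0 \<or> h1 x \<le> \<rho> * k / 2"
  shows "0 < boundary_gap k x"
proof (cases "x \<le> 0")
  case True
  have "boundary_gap k 0 \<le> boundary_gap k x"
  proof (rule DERIV_nonpos_imp_nonincreasing[OF True], intro exI conjI, rule boundary_gap_deriv)
    fix y :: real assume y: "x \<le> y" "y \<le> 0"
    have "h1 y \<le> 0" using h1_strict_mono[of y 0] h1_0 y by (cases "y = 0") auto
    moreover have "sinh (\<beta> * y) \<le> 0" using y \<beta>_pos by (simp add: mult_le_0_iff)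
    ultimately show "sinh (\<beta> * y) * (\<beta>\<^sup>2 / \<rho>) * (\<rho> * k / 2 - h1 y) \<le> 0"
      using \<rho>_pos k by (intro mult_nonpos_nonneg) (auto simp: field_simps mult_nonpos_nonneg intro: add_nonneg_nonneg order_trans[of _ 0])
  qed
  then show ?thesis using boundary_gap_0 k \<beta>_pos
    by (smt (verit) divide_pos_pos mult_pos_pos)
next
  case False
  then have x0: "0 \<le> x" and hx: "h1 x \<le> \<rho> * k / 2" using x by auto
  have "boundary_gap k 0 \<le> boundary_gap k x"
  proof (rule DERIV_nonneg_imp_nondecreasing[OF x0], intro exI conjI, rule boundary_gap_deriv)
    fix y assume y: "0 \<le> y" "y \<le> x"
    have "h1 y \<le> h1 x" using h1_strict_mono[of y x] y by (cases "y = x") auto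
    moreover have "sinh (\<beta> * y) \<ge> 0" using y \<beta>_pos by simp
    ultimately show "0 \<le> sinh (\<beta> * y) * (\<beta>\<^sup>2 / \<rho>) * (\<rho> * k / 2 - h1 y)"
      using \<rho>_pos hx by (intro mult_nonneg_nonneg) auto
  qed
  then show ?thesis using boundary_gap_0 k \<beta>_pos
    by (smt (verit) divide_pos_pos mult_pos_pos)
qed

text \<open>The second part is what makes \<open>V\<close> satisfy the variational inequality beyond the barrier.\<close>

lemma boundary_gap_zero_position:
  assumes "0 < k" "boundary_gap k c = 0"
  shows "0 < c" "\<rho> * k / 2 < h1 c"
  using boundary_gap_pos_below[OF assms(1), of c] assms(2) by (auto simp: not_le[symmetric])

lemma h1_linear_growth: "0 \<le> x \<Longrightarrow> a * x \<le> h1 x"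
proof -
  assume "0 \<le> x"
  have "h1 0 - a * 0 \<le> h1 x - a * x"
  proof (rule DERIV_nonneg_imp_nondecreasing[OF \<open>0 \<le> x\<close>], intro exI conjI)
    fix y show "((\<lambda>x. h1 x - a * x) has_real_derivative h2 y - a) (at y)"
      by (rule derivative_eq_intros h1_deriv refl)+ simp
    show "0 \<le> h2 y - a" using h2_lower[of y] by simp
  qed
  then show ?thesis using h1_0 by simp
qed

lemma boundary_gap_negative_somewhere: "\<exists>x>0. boundary_gap k x < 0"
proof -
  (* P1 is h1 / \<rho> up to a term bounded by B / \<beta>\<^sup>2, and h1 x is at least a x. *)
  define x where "x = (\<rho> / a) * (B / \<beta>\<^sup>2 + B / \<beta> + \<bar>k\<bar> + 1)"
  have B: "0 < B" using P2_pos[of 0] P2_upper[of 0] by linarith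
  have x: "0 < x" unfolding x_def using \<rho>_pos a_pos B \<beta>_pos
    by (intro mult_pos_pos add_nonneg_pos add_nonneg_nonneg divide_pos_pos divide_nonneg_nonneg) auto
  have "a * x / \<rho> \<le> h1 x / \<rho>" using h1_linear_growth[of x] x \<rho>_pos by (simp add: divide_right_mono)
  moreover have "a * x / \<rho> = B / \<beta>\<^sup>2 + B / \<beta> + \<bar>k\<bar> + 1" unfolding x_def using a_pos \<rho>_pos by simp
  moreover have "- (B / \<beta>\<^sup>2) \<le> P3 x / \<beta>\<^sup>2"
    using P3_bound[of x] \<beta>_pos by (simp add: field_simps abs_le_iff)
  ultimately have P1: "B / \<beta> + \<bar>k\<bar> + 1 \<le> P1 x" unfolding P1_eq by linarith
  have "P2 x * sinh (\<beta> * x) < \<beta> * (P1 x - k / 2) * cosh (\<beta> * x)"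
  proof -
    have "P2 x * sinh (\<beta> * x) \<le> B * cosh (\<beta> * x)"
      using P2_upper[of x] P2_pos[of x] B sinh_le_cosh_real[of "\<beta> * x"]
      using x \<beta>_pos by (intro mult_mono) auto
    also have "\<dots> < \<beta> * (P1 x - k / 2) * cosh (\<beta> * x)"
    proof (rule mult_strict_right_mono)
      have "B / \<beta> < P1 x - k / 2" using P1 by linarith
      then show "B < \<beta> * (P1 x - k / 2)" using \<beta>_pos by (simp add: field_simps)
    qed simp
    finally show ?thesis .
  qed
  then show ?thesis using x unfolding boundary_gap_def by auto
qed

text \<open>Existence is the intermediate value theorem; two zeros are impossible because beyond the first
  one \<open>h1 > \<rho> k / 2\<close> and the gap decreases strictly.\<close>

lemma boundary_equation_unique_solution:
  assumes k: "0 < k"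
  shows "\<exists>!c. boundary_equation s \<rho> P k c"
proof -
  obtain x where x: "0 < x" "boundary_gap k x < 0" using boundary_gap_negative_somewhere by blast
  have "\<exists>c\<ge>0. c \<le> x \<and> boundary_gap k c = 0"
  proof (rule IVT2)
    show "boundary_gap k x \<le> 0" "0 \<le> x" using x by simp_all
    show "0 \<le> boundary_gap k 0" unfolding boundary_gap_0 using k \<beta>_pos by simp
    show "\<forall>y. 0 \<le> y \<and> y \<le> x \<longrightarrow> isCont (boundary_gap k) y"
      using boundary_gap_deriv DERIV_isCont by blast
  qed
  then obtain c where c: "boundary_gap k c = 0" by blast
  have no_later: "c2 \<le> c1" if "boundary_gap k c1 = 0" "boundary_gap k c2 = 0" for c1 c2
  proof (rule ccontr)
    assume "\<not> c2 \<le> c1"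
    then have lt: "c1 < c2" by simp
    note pos = boundary_gap_zero_position[OF k that(1)]
    have "boundary_gap k c2 < boundary_gap k c1"
    proof (rule DERIV_neg_imp_decreasing[OF lt], intro exI conjI, rule boundary_gap_deriv)
      fix y assume y: "c1 \<le> y" "y \<le> c2"
      have "h1 c1 \<le> h1 y" using h1_strict_mono[of c1 y] y by (cases "y = c1") auto
      moreover have "0 < sinh (\<beta> * y)" using y pos \<beta>_pos by simp
      ultimately show "sinh (\<beta> * y) * (\<beta>\<^sup>2 / \<rho>) * (\<rho> * k / 2 - h1 y) < 0"
        using pos \<rho>_pos \<beta>_pos by (intro mult_pos_neg mult_pos_pos) auto
    qed
    then show False using that by simp
  qed
  show ?thesis
    unfolding boundary_equation_iff_gap using c no_later by (intro ex1I[of _ c]) (auto intro: antisym)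
qed

end


definition clip :: "real \<Rightarrow> real \<Rightarrow> real" where "clip c x = max (- c) (min c x)"

lemma clip_range: "0 \<le> c \<Longrightarrow> \<bar>clip c x\<bar> \<le> c" by (auto simp: clip_def)
lemma clip_eq: "\<bar>x\<bar> \<le> c \<Longrightarrow> clip c x = x" by (auto simp: clip_def)
lemma clip_lipschitz: "\<bar>clip c x - clip c y\<bar> \<le> \<bar>x - y\<bar>" by (auto simp: clip_def)

text \<open>What the verification needs to know about the value: a \<open>C\<^sup>2\<close> function with Lipschitz second
  derivative that solves the variational inequality, with free boundary at distance \<open>c\<close> from 0.\<close>

locale barrier_value =
  fixes \<rho> s k c L B :: real and h V V1 V2 :: "real \<Rightarrow> real"
  assumes \<rho>_pos: "0 < \<rho>" and s_pos: "0 < s" and k_pos: "0 < k" and c_pos: "0 < c"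
    and h_meas: "h \<in> borel_measurable borel" and h_nonneg: "\<And>x. 0 \<le> h x"
    and V_deriv: "\<And>z. (V has_real_derivative V1 z) (at z)"
    and V1_deriv: "\<And>z. (V1 has_real_derivative V2 z) (at z)"
    and V2_lip: "\<And>x y. \<bar>V2 x - V2 y\<bar> \<le> L * \<bar>x - y\<bar>"
    and V2_nonneg: "\<And>z. 0 \<le> V2 z" and V2_upper: "\<And>z. V2 z \<le> B"
    and V1_right: "\<And>z. c \<le> z \<Longrightarrow> V1 z = k / 2" and V1_left: "\<And>z. z \<le> - c \<Longrightarrow> V1 z = - (k / 2)"
    and V_nonneg: "\<And>z. 0 \<le> V z" and V_even: "\<And>z. V (- z) = V z"
    and V_right: "\<And>z. c \<le> z \<Longrightarrow> V z = V c + k / 2 * (z - c)"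
    and HJB: "\<And>z. \<rho> * V z - s\<^sup>2 / 2 * V2 z \<le> h z"
    and ODE: "\<And>z. \<bar>z\<bar> \<le> c \<Longrightarrow> \<rho> * V z - s\<^sup>2 / 2 * V2 z = h z"

locale barrier_problem = resolvent_cost +
  fixes k c :: real
  assumes k_pos: "0 < k" and c_solves: "boundary_equation s \<rho> P k c"
begin

lemma c_pos: "0 < c" and h1_c: "\<rho> * k / 2 < h1 c"
  using boundary_gap_zero_position[OF k_pos] c_solves boundary_equation_iff_gap by auto

text \<open>Chosen such that the second derivative of \<open>P - amplitude cosh (\<beta> z)\<close> vanishes at \<open>c\<close>.\<close>

definition amplitude :: real where "amplitude = P2 c / (\<beta>\<^sup>2 * cosh (\<beta> * c))"

text \<open>The second derivative of the value inside the barriers.\<close>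

definition curvature :: "real \<Rightarrow> real" where
  "curvature z = P2 z - amplitude * \<beta>\<^sup>2 * cosh (\<beta> * z)"

lemma amplitude_pos: "0 < amplitude" unfolding amplitude_def using P2_pos \<beta>_pos by simp

lemma curvature_at_barrier: "curvature c = 0"
  unfolding curvature_def amplitude_def using \<beta>_pos by simp

lemma curvature_even: "curvature (- z) = curvature z"
  unfolding curvature_def by (simp add: P2_even)

text \<open>The numerator \<open>w\<close> of the derivative vanishes at 0 and has derivative \<open>- 2/s\<^sup>2 h2 cosh < 0\<close>. This is
  a maximum principle: it gives \<open>curvature \<ge> 0\<close> on \<open>[-c, c]\<close> from \<open>curvature c = 0\<close>.\<close>

lemma P2_over_cosh_decreasing:
  assumes "0 \<le> x" "x \<le> y"
  shows "P2 y / cosh (\<beta> * y) \<le> P2 x / cosh (\<beta> * x)"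
proof -
  define w where "w z = P3 z * cosh (\<beta> * z) - \<beta> * P2 z * sinh (\<beta> * z)" for z
  have w': "(w has_real_derivative - (2 / s\<^sup>2) * h2 z * cosh (\<beta> * z)) (at z)" for z
    unfolding w_def
    by (rule derivative_eq_intros P2_deriv P3_deriv refl)+ (simp add: algebra_simps power2_eq_square)
  have w_neg: "w z \<le> 0" if "0 \<le> z" for z
  proof -
    have "w z \<le> w 0"
    proof (rule DERIV_nonpos_imp_nonincreasing[OF that], intro exI conjI, rule w')
      fix y show "- (2 / s\<^sup>2) * h2 y * cosh (\<beta> * y) \<le> 0"
        using h2_pos[of y] by (simp add: zero_le_mult_iff)
    qed
    then show ?thesis using P3_odd[of 0] by (simp add: w_def)
  qed
  show ?thesis
  proof (rule DERIV_nonpos_imp_nonincreasing[OF assms(2)], intro exI conjI)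
    fix z assume z: "x \<le> z" "z \<le> y"
    show "((\<lambda>z. P2 z / cosh (\<beta> * z)) has_real_derivative w z / (cosh (\<beta> * z) * cosh (\<beta> * z))) (at z)"
      unfolding w_def
      by (rule derivative_eq_intros P2_deriv refl)+ (auto simp: algebra_simps)
    show "w z / (cosh (\<beta> * z) * cosh (\<beta> * z)) \<le> 0"
      using w_neg[of z] z assms by (simp add: divide_nonpos_nonneg)
  qed
qed

lemma curvature_nonneg:
  assumes "\<bar>z\<bar> \<le> c"
  shows "0 \<le> curvature z"
proof -
  have "curvature z = curvature \<bar>z\<bar>" using curvature_even[of z] by (cases "0 \<le> z") auto
  moreover have "P2 c / cosh (\<beta> * c) * cosh (\<beta> * \<bar>z\<bar>) \<le> P2 \<bar>z\<bar>"
    using P2_over_cosh_decreasing[of "\<bar>z\<bar>" c] assms by (simp add: pos_le_divide_eq)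
  ultimately show ?thesis
    unfolding curvature_def amplitude_def using \<beta>_pos by (simp add: field_simps)
qed

lemma curvature_le: "curvature z \<le> B"
proof -
  have "0 \<le> amplitude * \<beta>\<^sup>2 * cosh (\<beta> * z)" using amplitude_pos by simp
  then show ?thesis using P2_upper[of z] by (simp add: curvature_def)
qed

definition curvature_slope :: real where
  "curvature_slope = B + amplitude * \<beta> ^ 3 * sinh (\<beta> * c)"

lemma curvature_slope_nonneg: "0 \<le> curvature_slope"
  unfolding curvature_slope_def using P3_bound[of 0] amplitude_pos \<beta>_pos c_pos
  by (intro add_nonneg_nonneg mult_nonneg_nonneg) auto

lemma curvature_lipschitz:
  assumes "\<bar>x\<bar> \<le> c" "\<bar>y\<bar> \<le> c"
  shows "\<bar>curvature x - curvature y\<bar> \<le> curvature_slope * \<bar>x - y\<bar>"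
proof -
  have "norm (curvature x - curvature y) \<le> curvature_slope * norm (x - y)"
  proof (rule field_differentiable_bound)
    show "convex {-c..c}" by simp
    fix z assume z: "z \<in> {-c..c}"
    show "(curvature has_field_derivative P3 z - amplitude * \<beta> ^ 3 * sinh (\<beta> * z)) (at z within {-c..c})"
      unfolding curvature_def
      by (rule derivative_eq_intros P2_deriv[THEN has_field_derivative_at_within] refl)+
        (simp add: power3_eq_cube power2_eq_square)
    have "\<bar>sinh (\<beta> * z)\<bar> = sinh (\<beta> * \<bar>z\<bar>)" using \<beta>_pos by (cases "0 \<le> z") (auto simp: mult_le_0_iff)
    also have "\<dots> \<le> sinh (\<beta> * c)" using z \<beta>_pos by auto
    finally have "\<bar>amplitude * \<beta> ^ 3 * sinh (\<beta> * z)\<bar> \<le> amplitude * \<beta> ^ 3 * sinh (\<beta> * c)"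
      using amplitude_pos \<beta>_pos by (simp add: abs_mult)
    then show "norm (P3 z - amplitude * \<beta> ^ 3 * sinh (\<beta> * z)) \<le> curvature_slope"
      unfolding curvature_slope_def using P3_bound[of z] by auto
  qed (use assms in auto)
  then show ?thesis by simp
qed

text \<open>Extending the curvature by 0 outside \<open>[-c, c]\<close> keeps it Lipschitz because it vanishes at \<open>\<plusminus>c\<close>.
  Integrating it twice gives a \<open>C\<^sup>2\<close> function without any gluing at the barriers: inside it coincides
  with \<open>P - amplitude cosh (\<beta> z)\<close>, and outside it is affine with slope \<open>\<plusminus>k/2\<close>, which is the value of
  the derivative at the barriers by the choice of \<open>c\<close>.\<close>

lemma barrier_value_exists:
  obtains V V1 V2 L where "barrier_value \<rho> s k c L B h V V1 V2"
    "\<And>z. \<bar>z\<bar> \<le> c \<Longrightarrow> V z = P z - amplitude * cosh (\<beta> * z)"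
proof -
  define V2 where "V2 z = curvature (clip c z)" for z
  have V2_lip: "\<bar>V2 x - V2 y\<bar> \<le> curvature_slope * \<bar>x - y\<bar>" for x y
  proof -
    have "\<bar>V2 x - V2 y\<bar> \<le> curvature_slope * \<bar>clip c x - clip c y\<bar>"
      unfolding V2_def using clip_range c_pos by (intro curvature_lipschitz) auto
    also have "\<dots> \<le> curvature_slope * \<bar>x - y\<bar>"
      using clip_lipschitz curvature_slope_nonneg by (intro mult_left_mono) auto
    finally show ?thesis .
  qed
  have "curvature_slope-lipschitz_on UNIV V2"
    by (rule lipschitz_onI) (use V2_lip curvature_slope_nonneg in \<open>auto simp: dist_real_def\<close>)
  then have V2_cont: "continuous_on UNIV V2" by (rule lipschitz_on_continuous_on)
  have V2_0: "V2 z = 0" if "c \<le> \<bar>z\<bar>" for z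
  proof -
    have "clip c z = c \<or> clip c z = - c" using that c_pos by (auto simp: clip_def)
    then show ?thesis unfolding V2_def using curvature_at_barrier curvature_even[of c] by auto
  qed
  obtain W1 where W1: "\<And>z. (W1 has_real_derivative V2 z) (at z)"
    using antiderivative_exists[OF V2_cont] by blast
  define V1 where "V1 z = W1 z - W1 0" for z
  have V1': "(V1 has_real_derivative V2 z) (at z)" for z
    unfolding V1_def by (rule derivative_eq_intros W1 refl)+ simp
  have V1_cont: "continuous_on UNIV V1" using V1' DERIV_continuous_on[of UNIV V1 V2] by auto
  obtain W where W: "\<And>z. (W has_real_derivative V1 z) (at z)"
    using antiderivative_exists[OF V1_cont] by blast
  define V0 where "V0 z = P z - amplitude * cosh (\<beta> * z)" for z
  define V01 where "V01 z = P1 z - amplitude * \<beta> * sinh (\<beta> * z)" for z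
  have V0': "(V0 has_real_derivative V01 z) (at z within S)" for z S
    unfolding V0_def V01_def
    by (rule derivative_eq_intros P_deriv[THEN has_field_derivative_at_within] refl)+ simp
  have V01': "(V01 has_real_derivative curvature z) (at z within S)" for z S
    unfolding V01_def curvature_def
    by (rule derivative_eq_intros P1_deriv[THEN has_field_derivative_at_within] refl)+
      (simp add: power2_eq_square)
  define V where "V z = W z - W 0 + V0 0" for z
  have V': "(V has_real_derivative V1 z) (at z)" for z
    unfolding V_def by (rule derivative_eq_intros W refl)+ simp
  have V1_in: "V1 z = V01 z" if "\<bar>z\<bar> \<le> c" for z
  proof -
    have "((\<lambda>z. V1 z - V01 z) has_real_derivative 0) (at z within {-c..c})" if "z \<in> {-c..c}" for z
      using DERIV_diff[OF V1'[THEN has_field_derivative_at_within] V01', of z "{-c..c}"] that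
      by (auto simp: V2_def clip_eq)
    then obtain d where d: "\<And>z. z \<in> {-c..c} \<Longrightarrow> V1 z - V01 z = d"
      using has_field_derivative_zero_constant[of "{-c..c}" "\<lambda>z. V1 z - V01 z"] by auto
    (* Both derivatives vanish at 0 by symmetry, which fixes the constant of integration. *)
    have "d = 0" using d[of 0] c_pos P1_odd[of 0] by (simp add: V1_def V01_def)
    then show ?thesis using d[of z] that by (simp add: abs_le_iff)
  qed
  have V_in: "V z = V0 z" if "\<bar>z\<bar> \<le> c" for z
  proof -
    have "((\<lambda>z. V z - V0 z) has_real_derivative 0) (at z within {-c..c})" if "z \<in> {-c..c}" for z
      using DERIV_diff[OF V'[THEN has_field_derivative_at_within] V0', of z "{-c..c}"] that V1_in
      by auto
    then obtain d where d: "\<And>z. z \<in> {-c..c} \<Longrightarrow> V z - V0 z = d"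
      using has_field_derivative_zero_constant[of "{-c..c}" "\<lambda>z. V z - V0 z"] by auto
    have "d = 0" using d[of 0] c_pos by (simp add: V_def)
    then show ?thesis using d[of z] that by (simp add: abs_le_iff)
  qed
  have V01_c: "V01 c = k / 2"
  proof -
    have "P2 c * sinh (\<beta> * c) = \<beta> * (P1 c - k / 2) * cosh (\<beta> * c)"
      using c_solves unfolding boundary_equation_iff_gap boundary_gap_def by simp
    then show ?thesis unfolding V01_def amplitude_def using \<beta>_pos cosh_real_pos[of "\<beta> * c"]
      by (simp add: field_simps power2_eq_square)
  qed
  have V1_up: "V1 z = k / 2" if "c \<le> z" for z
  proof -
    have "(V1 has_real_derivative 0) (at z within {c..})" if "z \<in> {c..}" for z
      using V1'[THEN has_field_derivative_at_within, of z "{c..}"] V2_0[of z] that c_pos by auto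
    then obtain d where d: "\<And>z. z \<in> {c..} \<Longrightarrow> V1 z = d"
      using has_field_derivative_zero_constant[of "{c..}" V1] by auto
    show ?thesis using d[of c] d[of z] V1_in[of c] V01_c c_pos that by auto
  qed
  have V1_down: "V1 z = - (k / 2)" if "z \<le> - c" for z
  proof -
    have "(V1 has_real_derivative 0) (at z within {..-c})" if "z \<in> {..-c}" for z
      using V1'[THEN has_field_derivative_at_within, of z "{..-c}"] V2_0[of z] that c_pos by auto
    then obtain d where d: "\<And>z. z \<in> {..-c} \<Longrightarrow> V1 z = d"
      using has_field_derivative_zero_constant[of "{..-c}" V1] by auto
    have "V01 (- c) = - (k / 2)" using V01_c P1_odd[of c] by (simp add: V01_def)
    then show ?thesis using d[of "-c"] d[of z] V1_in[of "-c"] c_pos that by auto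
  qed
  have V_up: "V z = V c + k / 2 * (z - c)" if "c \<le> z" for z
  proof -
    have "((\<lambda>z. V z - k / 2 * z) has_real_derivative 0) (at z within {c..})" if "z \<in> {c..}" for z
      by (rule derivative_eq_intros V'[THEN has_field_derivative_at_within] refl)+
        (use V1_up[of z] that in simp)
    then obtain d where d: "\<And>z. z \<in> {c..} \<Longrightarrow> V z - k / 2 * z = d"
      using has_field_derivative_zero_constant[of "{c..}" "\<lambda>z. V z - k / 2 * z"] by auto
    show ?thesis using d[of c] d[of z] that by (simp add: field_simps)
  qed
  have V_down: "V z = V (- c) - k / 2 * (z + c)" if "z \<le> - c" for z
  proof -
    have "((\<lambda>z. V z + k / 2 * z) has_real_derivative 0) (at z within {..-c})" if "z \<in> {..-c}" for z
      by (rule derivative_eq_intros V'[THEN has_field_derivative_at_within] refl)+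
        (use V1_down[of z] that in simp)
    then obtain d where d: "\<And>z. z \<in> {..-c} \<Longrightarrow> V z + k / 2 * z = d"
      using has_field_derivative_zero_constant[of "{..-c}" "\<lambda>z. V z + k / 2 * z"] by auto
    show ?thesis using d[of "-c"] d[of z] that by (simp add: field_simps)
  qed
  have V0_even: "V0 (- z) = V0 z" for z by (simp add: V0_def P_even)
  have V_even: "V (- z) = V z" for z
  proof -
    consider "\<bar>z\<bar> \<le> c" | "c \<le> z" | "z \<le> - c" by linarith
    then show ?thesis
    proof cases
      case 1 then show ?thesis using V_in[of z] V_in[of "-z"] V0_even by simp
    next
      case 2 then show ?thesis using V_up[of z] V_down[of "-z"] V_in[of c] V_in[of "-c"] V0_even[of c] c_pos
        by (simp add: field_simps)
    next
      case 3 then show ?thesis using V_up[of "-z"] V_down[of z] V_in[of c] V_in[of "-c"] V0_even[of c] c_pos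
        by (simp add: field_simps)
    qed
  qed
  have ODE: "\<rho> * V z - s\<^sup>2 / 2 * V2 z = h z" if "\<bar>z\<bar> \<le> c" for z
  proof -
    have "s\<^sup>2 / 2 * (amplitude * \<beta>\<^sup>2 * cosh (\<beta> * z)) = \<rho> * (amplitude * cosh (\<beta> * z))"
      using s2_\<beta>2 by (simp add: algebra_simps)
    then show ?thesis using P_ODE[of z] that
      by (simp add: V_in V0_def V2_def clip_eq curvature_def algebra_simps)
  qed
  have h_growth: "\<rho> * (k / 2) * (z - c) \<le> h z - h c" if "c \<le> z" for z
  proof -
    have "h c - \<rho> * (k / 2) * c \<le> h z - \<rho> * (k / 2) * z"
    proof (rule DERIV_nonneg_imp_nondecreasing[OF that], intro exI conjI)
      fix y assume y: "c \<le> y"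
      show "((\<lambda>z. h z - \<rho> * (k / 2) * z) has_real_derivative h1 y - \<rho> * (k / 2)) (at y)"
        by (rule derivative_eq_intros h_deriv refl)+ simp
      show "0 \<le> h1 y - \<rho> * (k / 2)"
        using h1_c h1_strict_mono[of c y] y by (cases "y = c") auto
    qed
    then show ?thesis by (simp add: field_simps)
  qed
  have HJB_up: "\<rho> * V z \<le> h z" if "c \<le> z" for z
  proof -
    have "\<rho> * V c = h c" using ODE[of c] V2_0[of c] c_pos by simp
    then show ?thesis using h_growth[OF that] V_up[OF that] by (simp add: algebra_simps)
  qed
  have HJB: "\<rho> * V z - s\<^sup>2 / 2 * V2 z \<le> h z" for z
  proof -
    consider "\<bar>z\<bar> \<le> c" | "c \<le> z" | "z \<le> - c" by linarith
    then show ?thesis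
    proof cases
      case 1 then show ?thesis using ODE by simp
    next
      case 2 then show ?thesis using HJB_up[of z] V2_0[of z] c_pos by simp
    next
      case 3 then show ?thesis using HJB_up[of "-z"] V2_0[of z] V_even[of z] h_even[of z] c_pos by simp
    qed
  qed
  have V2_nonneg: "0 \<le> V2 z" for z
    unfolding V2_def using curvature_nonneg clip_range c_pos by simp
  have V1_mono: "V1 x \<le> V1 y" if "x \<le> y" for x y
    by (rule DERIV_nonneg_imp_nondecreasing[OF that]) (use V1' V2_nonneg in blast)
  have V_pos: "0 \<le> V z" if "0 \<le> z" for z
  proof -
    have "V 0 \<le> V z"
      by (rule DERIV_nonneg_imp_nondecreasing[OF that])
        (use V' V1_mono[of 0] in \<open>force simp: V1_def\<close>)
    moreover have "0 \<le> \<rho> * V 0" using ODE[of 0] V2_nonneg[of 0] h_nonneg[of 0] c_pos s_pos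
      by (smt (verit) abs_zero mult_nonneg_nonneg divide_nonneg_nonneg zero_le_power2)
    then have "0 \<le> V 0" using \<rho>_pos by (simp add: zero_le_mult_iff)
    ultimately show ?thesis by linarith
  qed
  have V_nonneg: "0 \<le> V z" for z using V_pos[of z] V_pos[of "-z"] V_even[of z] by (cases "0 \<le> z") auto
  have V_in': "V z = P z - amplitude * cosh (\<beta> * z)" if "\<bar>z\<bar> \<le> c" for z
    using V_in[OF that] by (simp add: V0_def)
  have V2_le: "V2 z \<le> B" for z unfolding V2_def by (rule curvature_le)
  have h_meas: "h \<in> borel_measurable borel"
    using DERIV_continuous_on[of UNIV h h1] h_deriv by (simp add: borel_measurable_continuous_onI)
  have "barrier_value \<rho> s k c curvature_slope B h V V1 V2"
    by (rule barrier_value.intro[OF \<rho>_pos s_pos k_pos c_pos h_meas h_nonneg V' V1' V2_lip V2_nonneg V2_le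
          V1_up V1_down V_nonneg V_even V_up HJB ODE])
  then show ?thesis using V_in' by (rule that)
qed

end

section \<open>Brownian increments\<close>

lemma indep_set_mono:
  assumes "prob_space M" "prob_space.indep_set M A B" "A' \<subseteq> A" "B' \<subseteq> B"
  shows "prob_space.indep_set M A' B'"
proof -
  interpret prob_space M by fact
  show ?thesis
    unfolding indep_set_def
  proof (rule indep_sets_mono_sets)
    show "indep_sets (case_bool A B) UNIV" using assms(2) unfolding indep_set_def .
    show "case_bool A' B' i \<subseteq> case_bool A B i" for i using assms(3,4) by (cases i) auto
  qed
qed

lemma brownian_motionD:
  assumes "brownian_motion M F B"
  shows "prob_space M"
    and "0 \<le> t \<Longrightarrow> subalgebra M (F t)"
    and "0 \<le> r \<Longrightarrow> r \<le> t \<Longrightarrow> subalgebra (F t) (F r)"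
    and "0 \<le> t \<Longrightarrow> B t \<in> borel_measurable (F t)"
    and "0 \<le> t \<Longrightarrow> B t \<in> borel_measurable M"
    and "\<omega> \<in> space M \<Longrightarrow> B 0 \<omega> = 0"
    and "\<omega> \<in> space M \<Longrightarrow> continuous_on {0..} (\<lambda>t. B t \<omega>)"
    and "0 \<le> t \<Longrightarrow> f \<in> borel_measurable (F t) \<Longrightarrow> f \<in> borel_measurable M"
    and "0 \<le> r \<Longrightarrow> r \<le> t \<Longrightarrow> f \<in> borel_measurable (F r) \<Longrightarrow> f \<in> borel_measurable (F t)"
  using assms unfolding brownian_motion_def filtration_on_def
  by (auto intro: measurable_from_subalg)

text \<open>Independence is given for the past and the increment as set systems; the generated systems of
  \<open>X\<close> and of the increment are contained in them.\<close>

lemma brownian_increment_indep: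
  fixes B :: "real \<Rightarrow> 'a \<Rightarrow> 'b::euclidean_space" and X :: "'a \<Rightarrow> 'b"
  assumes bm: "brownian_motion M F B" and t: "0 \<le> t" "t < u" and X: "X \<in> borel_measurable (F t)"
  shows "prob_space.indep_var M borel X borel (\<lambda>\<omega>. B u \<omega> - B t \<omega>)"
proof -
  interpret prob_space M by (rule brownian_motionD[OF bm])
  let ?Y = "\<lambda>\<omega>. B u \<omega> - B t \<omega>"
  have u: "0 \<le> u" using t by simp
  have Y: "?Y \<in> borel_measurable M"
    using brownian_motionD(5)[OF bm t(1)] brownian_motionD(5)[OF bm u] by simp
  have sub: "space (F t) = space M" "sets (F t) \<subseteq> events"
    using brownian_motionD(2)[OF bm t(1)] by (auto simp: subalgebra_def)
  have ind: "indep_set (sets (F t)) {?Y -` A \<inter> space M | A. A \<in> sets borel}"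
    using bm t unfolding brownian_motion_def by blast
  have "sigma_sets (space M) {X -` A \<inter> space M | A. A \<in> sets borel} \<subseteq> sets (F t)"
    using sets.sigma_sets_subset[of "{X -` A \<inter> space M | A. A \<in> sets borel}" "F t"]
      measurable_sets[OF X] sub(1) by auto
  moreover have "sigma_sets (space M) {?Y -` A \<inter> space M | A. A \<in> sets borel}
      = {?Y -` A \<inter> space M | A. A \<in> sets borel}"
    using sets_vimage_algebra2[of ?Y "space M" "borel :: 'b measure"]
    unfolding sets_vimage_algebra by simp
  moreover have "X \<in> borel_measurable M" by (rule brownian_motionD(8)[OF bm t(1) X])
  ultimately show ?thesis
    unfolding indep_var_eq using Y indep_set_mono[OF prob_space_axioms ind] by auto
qed

lemma brownian_increment_normal:
  fixes w :: "real \<Rightarrow> 'a \<Rightarrow> real"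
  assumes "brownian_motion M F w" "0 \<le> t" "t < u"
  shows "distributed M lborel (\<lambda>\<omega>. w u \<omega> - w t \<omega>) (normal_density 0 (sqrt (u - t)))"
  using assms unfolding brownian_motion_def by simp

text \<open>The first two moments drive the expansion below, the third absolute moment bounds its error.\<close>

lemma brownian_increment_moments:
  fixes w :: "real \<Rightarrow> 'a \<Rightarrow> real"
  assumes bm: "brownian_motion M F w" and t: "0 \<le> t" "0 < d"
  defines "Y \<equiv> \<lambda>\<omega>. w (t + d) \<omega> - w t \<omega>"
  shows "integrable M Y" "(\<integral>\<omega>. Y \<omega> \<partial>M) = 0"
    "integrable M (\<lambda>\<omega>. (Y \<omega>)\<^sup>2)" "(\<integral>\<omega>. (Y \<omega>)\<^sup>2 \<partial>M) = d"
    "integrable M (\<lambda>\<omega>. \<bar>Y \<omega>\<bar> ^ 3)" "(\<integral>\<omega>. \<bar>Y \<omega>\<bar> ^ 3 \<partial>M) \<le> 2 * (d * sqrt d)"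
proof -
  have D: "distributed M lborel Y (normal_density 0 (sqrt d))"
    using brownian_increment_normal[OF bm t(1), of "t + d"] t unfolding Y_def by simp
  have p: "0 < sqrt d" using t by simp
  have mom: "integrable M (\<lambda>\<omega>. g (Y \<omega>))" "(\<integral>\<omega>. g (Y \<omega>) \<partial>M) = m"
    if "has_bochner_integral lborel (\<lambda>x. normal_density 0 (sqrt d) x * g x) m"
      "g \<in> borel_measurable borel" for g :: "real \<Rightarrow> real" and m
    using distributed_integrable[OF D, of g] distributed_integral[OF D, of g] that
    by (auto simp: has_bochner_integral_iff)
  note m1 = normal_moment_odd[OF p, of 0 0, simplified]
  note m2 = normal_moment_even[OF p, of 0 1, simplified]
  note m3 = normal_moment_abs_odd[OF p, of 0 1, simplified]
  show "integrable M Y" "(\<integral>\<omega>. Y \<omega> \<partial>M) = 0"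
    using mom[OF m1] by simp_all
  show "integrable M (\<lambda>\<omega>. (Y \<omega>)\<^sup>2)" "(\<integral>\<omega>. (Y \<omega>)\<^sup>2 \<partial>M) = d"
    using mom[OF m2] t by simp_all
  have "integrable M (\<lambda>\<omega>. \<bar>Y \<omega>\<bar> ^ 3)" "(\<integral>\<omega>. \<bar>Y \<omega>\<bar> ^ 3 \<partial>M) = 2 * sqrt d ^ 3 * sqrt (2 / pi)"
    using mom[OF m3] by (simp_all add: numeral_3_eq_3)
  moreover have "sqrt (2 / pi) \<le> 1" using pi_ge_two by simp
  then have "2 * sqrt d ^ 3 * sqrt (2 / pi) \<le> 2 * sqrt d ^ 3"
    using t by (intro mult_left_le) auto
  moreover have "sqrt d ^ 3 = d * sqrt d" using t by (simp add: power3_eq_cube)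
  ultimately show "integrable M (\<lambda>\<omega>. \<bar>Y \<omega>\<bar> ^ 3)" "(\<integral>\<omega>. \<bar>Y \<omega>\<bar> ^ 3 \<partial>M) \<le> 2 * (d * sqrt d)"
    by auto
qed

lemma taylor_lipschitz_second_derivative:
  fixes f :: "real \<Rightarrow> real"
  assumes f: "\<And>x. (f has_real_derivative f1 x) (at x)" and f1: "\<And>x. (f1 has_real_derivative f2 x) (at x)"
    and lip: "\<And>x y. \<bar>f2 x - f2 y\<bar> \<le> L * \<bar>x - y\<bar>"
  shows "\<bar>f (y + m) - (f y + f1 y * m + f2 y / 2 * m\<^sup>2)\<bar> \<le> L / 2 * \<bar>m\<bar> ^ 3"
proof (cases "m = 0")
  case False
  define diff where "diff n = (if n = 0 then f else if n = 1 then f1 else f2)" for n :: nat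
  have "\<exists>t. (if y + m < y then y + m < t \<and> t < y else y < t \<and> t < y + m) \<and>
    f (y + m) = (\<Sum>n<2. (diff n y / fact n) * (y + m - y) ^ n) + (diff 2 t / fact 2) * (y + m - y)\<^sup>2"
    by (rule Taylor[of 2 diff f "min y (y + m)" "max y (y + m)"])
      (use False f f1 in \<open>auto simp: diff_def less_2_cases_iff\<close>)
  then obtain t where t_mid: "if y + m < y then y + m < t \<and> t < y else y < t \<and> t < y + m" and
    eq': "f (y + m) = (\<Sum>n<2. (diff n y / fact n) * (y + m - y) ^ n) + (diff 2 t / fact 2) * (y + m - y)\<^sup>2"
    by blast
  have t: "\<bar>t - y\<bar> \<le> \<bar>m\<bar>" using t_mid by (auto split: if_splits)
  have eq: "f (y + m) = (\<Sum>n<2. (diff n y / fact n) * m ^ n) + f2 t / 2 * m\<^sup>2"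
    using eq' by (simp add: diff_def)
  have "(\<Sum>n<2. (diff n y / fact n) * m ^ n) = f y + f1 y * m"
    by (simp add: numeral_2_eq_2 diff_def)
  then have "f (y + m) - (f y + f1 y * m + f2 y / 2 * m\<^sup>2) = (f2 t - f2 y) / 2 * m\<^sup>2"
    using eq by (simp add: field_simps)
  also have "\<bar>\<dots>\<bar> = \<bar>f2 t - f2 y\<bar> / 2 * \<bar>m\<bar>\<^sup>2" by (simp add: abs_mult)
  also have "\<dots> \<le> (L * \<bar>t - y\<bar>) / 2 * \<bar>m\<bar>\<^sup>2"
    using lip[of t y] by (intro mult_right_mono divide_right_mono) auto
  also have "\<dots> \<le> (L * \<bar>m\<bar>) / 2 * \<bar>m\<bar>\<^sup>2"
  proof -
    have "0 \<le> L" using lip[of 1 0] by simp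
    then show ?thesis using t by (intro mult_right_mono divide_right_mono mult_left_mono) auto
  qed
  also have "\<dots> = L / 2 * \<bar>m\<bar> ^ 3" by (simp add: power3_eq_cube power2_eq_square)
  finally show ?thesis .
qed simp

text \<open>The substitute for Ito's formula: Taylor expansion around \<open>X\<close>, where the first-order term has mean
  0 and the second-order term factorizes, since the increment is independent of \<open>X\<close>. The error is of
  order \<open>d powr (3/2)\<close>, hence negligible when summed over \<open>1/d\<close> steps.\<close>

lemma brownian_step_expansion:
  fixes w :: "real \<Rightarrow> 'a \<Rightarrow> real" and f :: "real \<Rightarrow> real"
  assumes bm: "brownian_motion M F w" and t: "0 \<le> t" "0 < d" and s: "0 \<le> s"
    and X: "X \<in> borel_measurable (F t)"
    and f: "\<And>x. (f has_real_derivative f1 x) (at x)" and f1: "\<And>x. (f1 has_real_derivative f2 x) (at x)"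
    and lip: "\<And>x y. \<bar>f2 x - f2 y\<bar> \<le> L * \<bar>x - y\<bar>"
    and int: "integrable M (\<lambda>\<omega>. f (X \<omega>))" "integrable M (\<lambda>\<omega>. f1 (X \<omega>))" "integrable M (\<lambda>\<omega>. f2 (X \<omega>))"
  shows "integrable M (\<lambda>\<omega>. f (X \<omega> + s * (w (t + d) \<omega> - w t \<omega>)))"
    and "\<bar>(\<integral>\<omega>. f (X \<omega> + s * (w (t + d) \<omega> - w t \<omega>)) \<partial>M)
      - ((\<integral>\<omega>. f (X \<omega>) \<partial>M) + d * (s\<^sup>2 / 2 * (\<integral>\<omega>. f2 (X \<omega>) \<partial>M)))\<bar> \<le> L * s ^ 3 * (d * sqrt d)"
proof -
  interpret prob_space M by (rule brownian_motionD[OF bm])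
  define Y where "Y \<omega> = w (t + d) \<omega> - w t \<omega>" for \<omega>
  note mom = brownian_increment_moments[OF bm t, folded Y_def]
  have L0: "0 \<le> L" using lip[of 1 0] by simp
  have f2_cont: "continuous_on UNIV f2"
  proof -
    have "L-lipschitz_on UNIV f2" by (rule lipschitz_onI) (use lip L0 in \<open>auto simp: dist_real_def\<close>)
    then show ?thesis by (rule lipschitz_on_continuous_on)
  qed
  have [measurable]: "f \<in> borel_measurable borel" "f1 \<in> borel_measurable borel" "f2 \<in> borel_measurable borel"
    using DERIV_continuous_on[of UNIV f f1] DERIV_continuous_on[of UNIV f1 f2] f f1 f2_cont
    by (simp_all add: borel_measurable_continuous_onI)
  have [measurable]: "X \<in> borel_measurable M" by (rule brownian_motionD(8)[OF bm t(1) X])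
  have [measurable]: "Y \<in> borel_measurable M" using mom(1) by simp
  have indXY: "indep_var borel X borel Y"
    using brownian_increment_indep[OF bm t(1) _ X, of "t + d"] t unfolding Y_def by simp
  have ind1: "indep_var borel (\<lambda>\<omega>. f1 (X \<omega>)) borel Y"
    using indep_var_compose[OF indXY, where ?Y1.0 = f1 and ?N1.0 = borel and ?Y2.0 = "\<lambda>y. y" and ?N2.0 = borel]
    unfolding comp_def by measurable
  have ind2: "indep_var borel (\<lambda>\<omega>. f2 (X \<omega>)) borel (\<lambda>\<omega>. (Y \<omega>)\<^sup>2)"
    using indep_var_compose[OF indXY, where ?Y1.0 = f2 and ?N1.0 = borel and ?Y2.0 = "\<lambda>y. y\<^sup>2" and ?N2.0 = borel]
    unfolding comp_def by measurable
  note i1 = indep_var_integrable[OF ind1 int(2) mom(1)]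
  note i2 = indep_var_integrable[OF ind2 int(3) mom(3)]
  define T where "T \<omega> = f (X \<omega>) + f1 (X \<omega>) * (s * Y \<omega>) + f2 (X \<omega>) / 2 * (s * Y \<omega>)\<^sup>2" for \<omega>
  have T_eq: "T = (\<lambda>\<omega>. f (X \<omega>) + s * (f1 (X \<omega>) * Y \<omega>) + s\<^sup>2 / 2 * (f2 (X \<omega>) * (Y \<omega>)\<^sup>2))"
    unfolding T_def by (auto simp: field_simps power_mult_distrib)
  have T_int: "integrable M T"
    unfolding T_eq using int(1) i1 i2 by (intro Bochner_Integration.integrable_add integrable_mult_right) auto
  have T_val: "(\<integral>\<omega>. T \<omega> \<partial>M) = (\<integral>\<omega>. f (X \<omega>) \<partial>M) + d * (s\<^sup>2 / 2 * (\<integral>\<omega>. f2 (X \<omega>) \<partial>M))"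
    unfolding T_eq using int(1) i1 i2 mom
      indep_var_lebesgue_integral[OF ind1 int(2) mom(1)] indep_var_lebesgue_integral[OF ind2 int(3) mom(3)]
    by simp
  define R where "R \<omega> = f (X \<omega> + s * Y \<omega>) - T \<omega>" for \<omega>
  have [measurable]: "R \<in> borel_measurable M" unfolding R_def T_def by measurable
  have R_bound: "\<bar>R \<omega>\<bar> \<le> L / 2 * s ^ 3 * \<bar>Y \<omega>\<bar> ^ 3" for \<omega>
    using taylor_lipschitz_second_derivative[OF f f1 lip, of "X \<omega>" "s * Y \<omega>"] s
    unfolding R_def T_def by (simp add: abs_mult power_mult_distrib mult.assoc)
  have R_int: "integrable M R"
    by (rule Bochner_Integration.integrable_bound[OF integrable_mult_right[OF mom(5), of "L / 2 * s ^ 3"]])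
      (use R_bound L0 s in \<open>auto intro: order_trans[OF _ abs_ge_self]\<close>)
  have f_eq: "(\<lambda>\<omega>. f (X \<omega> + s * Y \<omega>)) = (\<lambda>\<omega>. T \<omega> + R \<omega>)" unfolding R_def by auto
  show "integrable M (\<lambda>\<omega>. f (X \<omega> + s * (w (t + d) \<omega> - w t \<omega>)))"
    using T_int R_int f_eq unfolding Y_def by simp
  have "\<bar>\<integral>\<omega>. R \<omega> \<partial>M\<bar> \<le> (\<integral>\<omega>. \<bar>R \<omega>\<bar> \<partial>M)" by simp
  also have "\<dots> \<le> (\<integral>\<omega>. L / 2 * s ^ 3 * \<bar>Y \<omega>\<bar> ^ 3 \<partial>M)"
    by (rule integral_mono[OF integrable_abs[OF R_int] integrable_mult_right[OF mom(5)] R_bound])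
  also have "\<dots> \<le> L / 2 * s ^ 3 * (2 * (d * sqrt d))"
    unfolding integral_mult_right_zero using mom(6) L0 s by (intro mult_left_mono) auto
  finally have "\<bar>\<integral>\<omega>. R \<omega> \<partial>M\<bar> \<le> L * s ^ 3 * (d * sqrt d)" by simp
  moreover have "(\<integral>\<omega>. f (X \<omega> + s * Y \<omega>) \<partial>M) = (\<integral>\<omega>. T \<omega> \<partial>M) + (\<integral>\<omega>. R \<omega> \<partial>M)"
    unfolding f_eq using T_int R_int by simp
  ultimately show "\<bar>(\<integral>\<omega>. f (X \<omega> + s * (w (t + d) \<omega> - w t \<omega>)) \<partial>M)
      - ((\<integral>\<omega>. f (X \<omega>) \<partial>M) + d * (s\<^sup>2 / 2 * (\<integral>\<omega>. f2 (X \<omega>) \<partial>M)))\<bar> \<le> L * s ^ 3 * (d * sqrt d)"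
    unfolding T_val Y_def by simp
qed

lemma brownian_abs_moment_bounds:
  fixes w :: "real \<Rightarrow> 'a \<Rightarrow> real"
  assumes bm: "brownian_motion M F w" and t: "0 \<le> t"
  shows "integrable M (\<lambda>\<omega>. (w t \<omega>)\<^sup>2)" "(\<integral>\<omega>. (w t \<omega>)\<^sup>2 \<partial>M) = t"
    "integrable M (w t)" "(\<integral>\<omega>. \<bar>w t \<omega>\<bar> \<partial>M) \<le> sqrt t"
proof -
  interpret prob_space M by (rule brownian_motionD[OF bm])
  have w0: "w 0 \<omega> = 0" if "\<omega> \<in> space M" for \<omega> by (rule brownian_motionD(6)[OF bm that])
  have [measurable]: "w t \<in> borel_measurable M" by (rule brownian_motionD(5)[OF bm t])
  have "integrable M (\<lambda>\<omega>. (w t \<omega>)\<^sup>2) \<and> (\<integral>\<omega>. (w t \<omega>)\<^sup>2 \<partial>M) = t \<and> integrable M (w t)"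
  proof (cases "t = 0")
    case True
    have "integrable M (\<lambda>\<omega>. (w t \<omega>)\<^sup>2) \<longleftrightarrow> integrable M (\<lambda>_. 0::real)"
      "(\<integral>\<omega>. (w t \<omega>)\<^sup>2 \<partial>M) = (\<integral>\<omega>. (0::real) \<partial>M)"
      "integrable M (w t) \<longleftrightarrow> integrable M (\<lambda>_. 0::real)"
      unfolding True using w0
      by (intro Bochner_Integration.integrable_cong Bochner_Integration.integral_cong; simp)+
    then show ?thesis using True by simp
  next
    case False
    then have p: "0 < t" using t by simp
    note m = brownian_increment_moments[OF bm order_refl p]
    have "integrable M (\<lambda>\<omega>. (w (0 + t) \<omega> - w 0 \<omega>)\<^sup>2) \<longleftrightarrow> integrable M (\<lambda>\<omega>. (w t \<omega>)\<^sup>2)"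
      "(\<integral>\<omega>. (w (0 + t) \<omega> - w 0 \<omega>)\<^sup>2 \<partial>M) = (\<integral>\<omega>. (w t \<omega>)\<^sup>2 \<partial>M)"
      "integrable M (\<lambda>\<omega>. w (0 + t) \<omega> - w 0 \<omega>) \<longleftrightarrow> integrable M (w t)"
      using w0 by (intro Bochner_Integration.integrable_cong Bochner_Integration.integral_cong; simp)+
    then show ?thesis using m(1,3,4) by simp
  qed
  then show sq: "integrable M (\<lambda>\<omega>. (w t \<omega>)\<^sup>2)" "(\<integral>\<omega>. (w t \<omega>)\<^sup>2 \<partial>M) = t" and i: "integrable M (w t)"
    by auto
  have "(\<integral>\<omega>. \<bar>w t \<omega>\<bar> \<partial>M)\<^sup>2 \<le> (\<integral>\<omega>. \<bar>w t \<omega>\<bar>\<^sup>2 \<partial>M)"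
    using variance_positive[of "\<lambda>\<omega>. \<bar>w t \<omega>\<bar>"] variance_eq[of "\<lambda>\<omega>. \<bar>w t \<omega>\<bar>"] sq i by simp
  then have "(\<integral>\<omega>. \<bar>w t \<omega>\<bar> \<partial>M)\<^sup>2 \<le> t" using sq by simp
  then show "(\<integral>\<omega>. \<bar>w t \<omega>\<bar> \<partial>M) \<le> sqrt t" by (rule real_le_rsqrt)
qed

text \<open>The coordinates of an increment are independent centred normal variables with the same variance,
  because its density is a product; a combination of them with coefficients of square sum 1 has the
  same law. Coordinates with coefficient 0 are dropped, as normal laws here have positive variance.\<close>

lemma brownian_projection:
  fixes B :: "real \<Rightarrow> 'a \<Rightarrow> 'b::euclidean_space"
  assumes bm: "brownian_motion M F B" and u: "norm u = 1"
  shows "brownian_motion M F (\<lambda>t \<omega>. u \<bullet> B t \<omega>)"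
proof -
  interpret prob_space M by (rule brownian_motionD[OF bm])
  have law: "distributed M lborel (\<lambda>\<omega>. u \<bullet> B t \<omega> - u \<bullet> B r \<omega>) (normal_density 0 (sqrt (t - r)))"
    if rt: "0 \<le> r" "r < t" for r t
  proof -
    define \<tau> where "\<tau> = sqrt (t - r)"
    have \<tau>: "0 < \<tau>" using rt by (simp add: \<tau>_def)
    define Y where "Y \<omega> = B t \<omega> - B r \<omega>" for \<omega>
    have D: "distributed M lborel Y (\<lambda>y. ennreal (\<Prod>b\<in>Basis. normal_density 0 \<tau> (y \<bullet> b)))"
      using bm rt unfolding brownian_motion_def Y_def \<tau>_def by blast
    have [measurable]: "Y \<in> borel_measurable M" using distributed_measurable[OF D] by simp
    have nn: "0 \<le> normal_density 0 \<tau> x" for x by (rule normal_density_nonneg)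
    have total: "(\<integral>\<^sup>+x. ennreal (normal_density 0 \<tau> x) \<partial>lborel) = 1"
      using \<tau> by (subst nn_integral_eq_integral) auto
    have joint: "emeasure M (\<Inter>b\<in>Basis. (\<lambda>\<omega>. Y \<omega> \<bullet> b) -` A b \<inter> space M)
        = (\<Prod>b\<in>Basis. (\<integral>\<^sup>+x. ennreal (normal_density 0 \<tau> x * indicator (A b) x) \<partial>lborel))"
      if A[measurable]: "\<And>b. b \<in> Basis \<Longrightarrow> A b \<in> sets borel" for A :: "'b \<Rightarrow> real set"
    proof -
      define S where "S = {y::'b. \<forall>b\<in>Basis. y \<bullet> b \<in> A b}"
      have [measurable]: "S \<in> sets borel" unfolding S_def by measurable
      have "(\<Inter>b\<in>Basis. (\<lambda>\<omega>. Y \<omega> \<bullet> b) -` A b \<inter> space M) = Y -` S \<inter> space M"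
        unfolding S_def by auto
      also have "emeasure M \<dots> = (\<integral>\<^sup>+y. ennreal (\<Prod>b\<in>Basis. normal_density 0 \<tau> (y \<bullet> b)) * indicator S y \<partial>lborel)"
        by (rule distributed_emeasure[OF D]) simp
      also have "\<dots> = (\<integral>\<^sup>+y. (\<Prod>b\<in>Basis. ennreal (normal_density 0 \<tau> (y \<bullet> b) * indicator (A b) (y \<bullet> b))) \<partial>lborel)"
      proof (rule nn_integral_cong)
        fix y :: 'b
        have ind: "indicator S y = (\<Prod>b\<in>Basis. indicator (A b) (y \<bullet> b) :: real)"
          unfolding S_def indicator_def by (auto simp: prod.neutral intro: prod_zero[symmetric])
        have "ennreal (\<Prod>b\<in>Basis. normal_density 0 \<tau> (y \<bullet> b)) * indicator S y
            = ennreal ((\<Prod>b\<in>Basis. normal_density 0 \<tau> (y \<bullet> b)) * indicator S y)"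
          by (auto simp: indicator_def)
        also have "(\<Prod>b\<in>Basis. normal_density 0 \<tau> (y \<bullet> b)) * indicator S y
            = (\<Prod>b\<in>Basis. normal_density 0 \<tau> (y \<bullet> b) * indicator (A b) (y \<bullet> b))"
          unfolding ind by (simp add: prod.distrib)
        finally show "ennreal (\<Prod>b\<in>Basis. normal_density 0 \<tau> (y \<bullet> b)) * indicator S y
            = (\<Prod>b\<in>Basis. ennreal (normal_density 0 \<tau> (y \<bullet> b) * indicator (A b) (y \<bullet> b)))"
          using nn by (simp add: prod_ennreal)
      qed
      also have "\<dots> = (\<Prod>b\<in>Basis. (\<integral>\<^sup>+x. ennreal (normal_density 0 \<tau> x * indicator (A b) x) \<partial>lborel))"
        by (rule nn_integral_lborel_prod) auto
      finally show ?thesis .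
    qed
    have marginal: "emeasure M ((\<lambda>\<omega>. Y \<omega> \<bullet> b) -` A \<inter> space M)
        = (\<integral>\<^sup>+x. ennreal (normal_density 0 \<tau> x * indicator A x) \<partial>lborel)"
      if b: "b \<in> Basis" and A: "A \<in> sets borel" for b A
    proof -
      let ?A = "\<lambda>b'. if b' = b then A else UNIV"
      have "(\<lambda>\<omega>. Y \<omega> \<bullet> b) -` A \<inter> space M = (\<Inter>b'\<in>Basis. (\<lambda>\<omega>. Y \<omega> \<bullet> b') -` ?A b' \<inter> space M)"
        using b by (auto split: if_splits)
      also have "emeasure M \<dots> = (\<Prod>b'\<in>Basis. (\<integral>\<^sup>+x. ennreal (normal_density 0 \<tau> x * indicator (?A b') x) \<partial>lborel))"
        by (rule joint) (use A in auto)
      also have "\<dots> = (\<Prod>b'\<in>Basis. if b' = b then (\<integral>\<^sup>+x. ennreal (normal_density 0 \<tau> x * indicator A x) \<partial>lborel) else 1)"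
        using total by (intro prod.cong) auto
      also have "\<dots> = (\<integral>\<^sup>+x. ennreal (normal_density 0 \<tau> x * indicator A x) \<partial>lborel)"
        using b by simp
      finally show ?thesis .
    qed
    have coord: "distributed M lborel (\<lambda>\<omega>. Y \<omega> \<bullet> b) (normal_density 0 \<tau>)" if b: "b \<in> Basis" for b
      unfolding distributed_def
    proof safe
      show "distr M lborel (\<lambda>\<omega>. Y \<omega> \<bullet> b) = density lborel (normal_density 0 \<tau>)"
        by (rule measure_eqI)
          (auto simp: emeasure_distr emeasure_density marginal[OF b] ennreal_mult nn ennreal_indicator
            intro!: nn_integral_cong)
    qed auto
    have indep: "indep_vars (\<lambda>_. borel) (\<lambda>b \<omega>. Y \<omega> \<bullet> b) Basis"
    proof (subst indep_vars_finite[where E = "\<lambda>_. sets borel"])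
      show "\<forall>A\<in>Basis \<rightarrow> sets borel. prob (\<Inter>j\<in>Basis. (\<lambda>\<omega>. Y \<omega> \<bullet> j) -` A j \<inter> space M)
          = (\<Prod>j\<in>Basis. prob ((\<lambda>\<omega>. Y \<omega> \<bullet> j) -` A j \<inter> space M))"
      proof
        fix A :: "'b \<Rightarrow> real set" assume A: "A \<in> Basis \<rightarrow> sets borel"
        have "emeasure M (\<Inter>j\<in>Basis. (\<lambda>\<omega>. Y \<omega> \<bullet> j) -` A j \<inter> space M)
            = (\<Prod>j\<in>Basis. emeasure M ((\<lambda>\<omega>. Y \<omega> \<bullet> j) -` A j \<inter> space M))"
          using A by (subst joint) (auto simp: marginal Pi_iff)
        then have "ennreal (prob (\<Inter>j\<in>Basis. (\<lambda>\<omega>. Y \<omega> \<bullet> j) -` A j \<inter> space M))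
            = ennreal (\<Prod>j\<in>Basis. prob ((\<lambda>\<omega>. Y \<omega> \<bullet> j) -` A j \<inter> space M))"
          by (simp add: emeasure_eq_measure prod_ennreal)
        then show "prob (\<Inter>j\<in>Basis. (\<lambda>\<omega>. Y \<omega> \<bullet> j) -` A j \<inter> space M)
          = (\<Prod>j\<in>Basis. prob ((\<lambda>\<omega>. Y \<omega> \<bullet> j) -` A j \<inter> space M))"
          by (simp add: prod_nonneg)
      qed
    qed (auto simp: sets.sigma_sets_eq[of borel, simplified] Int_stable_def)
    define I where "I = {b\<in>Basis. u \<bullet> b \<noteq> 0}"
    have fin: "finite I" "I \<subseteq> Basis" by (auto simp: I_def)
    have sum_sq: "(\<Sum>b\<in>I. (u \<bullet> b)\<^sup>2) = 1"
    proof -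
      have "(\<Sum>b\<in>I. (u \<bullet> b)\<^sup>2) = (\<Sum>b\<in>Basis. (u \<bullet> b)\<^sup>2)"
        by (rule sum.mono_neutral_left) (auto simp: I_def)
      also have "\<dots> = u \<bullet> u" by (simp add: euclidean_inner[of u u] power2_eq_square)
      finally show ?thesis using u by (simp add: dot_square_norm)
    qed
    then have ne: "I \<noteq> {}" by auto
    have "distributed M lborel (\<lambda>\<omega>. \<Sum>b\<in>I. (u \<bullet> b) * (Y \<omega> \<bullet> b))
        (normal_density (\<Sum>b\<in>I. 0) (sqrt (\<Sum>b\<in>I. (\<bar>u \<bullet> b\<bar> * \<tau>)\<^sup>2)))"
    proof (rule sum_indep_normal[OF fin(1) ne])
      show "indep_vars (\<lambda>i. borel) (\<lambda>b \<omega>. (u \<bullet> b) * (Y \<omega> \<bullet> b)) I"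
        by (rule indep_vars_compose2[OF indep_vars_subset[OF indep fin(2)]]) auto
      fix b assume b: "b \<in> I"
      show "0 < \<bar>u \<bullet> b\<bar> * \<tau>" using b \<tau> by (auto simp: I_def)
      show "distributed M lborel (\<lambda>x. (u \<bullet> b) * (Y x \<bullet> b)) (normal_density 0 (\<bar>u \<bullet> b\<bar> * \<tau>))"
        using normal_density_affine[OF coord \<tau>, of b "u \<bullet> b" 0] b by (auto simp: I_def)
    qed
    also have "(\<Sum>b\<in>I. (\<bar>u \<bullet> b\<bar> * \<tau>)\<^sup>2) = \<tau>\<^sup>2"
      using sum_sq by (simp add: power_mult_distrib flip: sum_distrib_right)
    also have "(\<lambda>\<omega>. \<Sum>b\<in>I. (u \<bullet> b) * (Y \<omega> \<bullet> b)) = (\<lambda>\<omega>. u \<bullet> B t \<omega> - u \<bullet> B r \<omega>)"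
    proof
      fix \<omega>
      have "(\<Sum>b\<in>I. (u \<bullet> b) * (Y \<omega> \<bullet> b)) = (\<Sum>b\<in>Basis. (u \<bullet> b) * (Y \<omega> \<bullet> b))"
        by (rule sum.mono_neutral_left) (auto simp: I_def)
      also have "\<dots> = u \<bullet> Y \<omega>" by (rule euclidean_inner[symmetric])
      finally show "(\<Sum>b\<in>I. (u \<bullet> b) * (Y \<omega> \<bullet> b)) = u \<bullet> B t \<omega> - u \<bullet> B r \<omega>"
        by (simp add: Y_def inner_diff_right)
    qed
    finally show ?thesis using \<tau> by (simp add: \<tau>_def)
  qed
  have ind: "indep_set (sets (F r)) {(\<lambda>\<omega>. u \<bullet> B t \<omega> - u \<bullet> B r \<omega>) -` A \<inter> space M | A. A \<in> sets borel}"
    if rt: "0 \<le> r" "r < t" for r t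
  proof (rule indep_set_mono[OF prob_space_axioms])
    show "indep_set (sets (F r)) {(\<lambda>\<omega>. B t \<omega> - B r \<omega>) -` A \<inter> space M | A. A \<in> sets borel}"
      using bm rt unfolding brownian_motion_def by blast
    show "{(\<lambda>\<omega>. u \<bullet> B t \<omega> - u \<bullet> B r \<omega>) -` A \<inter> space M | A. A \<in> sets borel}
        \<subseteq> {(\<lambda>\<omega>. B t \<omega> - B r \<omega>) -` A \<inter> space M | A. A \<in> sets borel}"
    proof safe
      fix A :: "real set" assume "A \<in> sets borel"
      then have "(\<lambda>y. u \<bullet> y) -` A \<in> sets borel"
        using measurable_sets[of "\<lambda>y. u \<bullet> y" borel borel A] by simp
      then show "\<exists>A'. (\<lambda>\<omega>. u \<bullet> B t \<omega> - u \<bullet> B r \<omega>) -` A \<inter> space M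
          = (\<lambda>\<omega>. B t \<omega> - B r \<omega>) -` A' \<inter> space M \<and> A' \<in> sets borel"
        by (intro exI[of _ "(\<lambda>y. u \<bullet> y) -` A"]) (auto simp: inner_diff_right)
    qed
  qed auto
  show ?thesis
    unfolding brownian_motion_def
  proof (intro conjI allI impI ballI)
    show "prob_space M" "filtration_on M F" using bm unfolding brownian_motion_def by auto
    fix t :: real assume "0 \<le> t"
    then show "(\<lambda>\<omega>. u \<bullet> B t \<omega>) \<in> borel_measurable (F t)"
      using brownian_motionD(4)[OF bm] by simp
  next
    fix \<omega> assume \<omega>: "\<omega> \<in> space M"
    show "u \<bullet> B 0 \<omega> = 0" using brownian_motionD(6)[OF bm \<omega>] by simp
    show "continuous_on {0..} (\<lambda>t. u \<bullet> B t \<omega>)"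
      using brownian_motionD(7)[OF bm \<omega>] by (intro continuous_intros)
  next
    fix r t :: real assume "0 \<le> r \<and> r < t"
    then show "distributed M lborel (\<lambda>\<omega>. u \<bullet> B t \<omega> - u \<bullet> B r \<omega>)
        (\<lambda>y. ennreal (\<Prod>b\<in>Basis. normal_density 0 (sqrt (t - r)) (y \<bullet> b)))"
      "indep_set (sets (F r)) {(\<lambda>\<omega>. u \<bullet> B t \<omega> - u \<bullet> B r \<omega>) -` A \<inter> space M | A. A \<in> sets borel}"
      using law ind by auto
  qed
qed

section \<open>Averaging over an exponential time\<close>

text \<open>The law of an exponential time with rate \<open>\<rho>\<close>; averaging against it is discounting, normalized to
  total mass 1.\<close>

definition clock :: "real \<Rightarrow> real measure" where
  "clock \<rho> = density lborel (\<lambda>t. ennreal (exponential_density \<rho> t))"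

lemma sets_clock [simp, measurable_cong]: "sets (clock \<rho>) = sets borel" by (simp add: clock_def)
lemma space_clock [simp]: "space (clock \<rho>) = UNIV" by (simp add: clock_def)

lemma prob_space_clock: "0 < \<rho> \<Longrightarrow> prob_space (clock \<rho>)"
  unfolding clock_def by (rule prob_space_exponential_density)

lemma nn_integral_clock:
  assumes "0 < \<rho>" and [measurable]: "f \<in> borel_measurable borel"
  shows "(\<integral>\<^sup>+ t. f t \<partial>clock \<rho>) = (\<integral>\<^sup>+ t\<in>{0..}. ennreal (\<rho> * exp (- \<rho> * t)) * f t \<partial>lborel)"
  unfolding clock_def
  by (subst nn_integral_density)
    (auto intro!: nn_integral_cong simp: exponential_density_def indicator_def mult.commute)

lemma AE_clock_nonneg: "AE t in clock \<rho>. 0 \<le> t"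
  unfolding clock_def by (subst AE_density) (auto simp: exponential_density_def)

lemma integrable_clock_iff:
  assumes "0 < \<rho>" and [measurable]: "f \<in> borel_measurable borel"
  shows "integrable (clock \<rho>) f \<longleftrightarrow> integrable lborel (\<lambda>t. exponential_density \<rho> t * f t)"
  unfolding clock_def using assms
  by (subst integrable_density) (auto simp: exponential_density_nonneg)

lemma integral_clock:
  fixes f :: "real \<Rightarrow> real"
  assumes "0 < \<rho>" and [measurable]: "f \<in> borel_measurable borel"
  shows "(\<integral>t. f t \<partial>clock \<rho>) = (\<integral>t. exponential_density \<rho> t * f t \<partial>lborel)"
  unfolding clock_def using assms
  by (subst integral_density) (auto simp: exponential_density_nonneg)

lemma integrable_clock_power:
  assumes "0 < \<rho>"
  shows "integrable (clock \<rho>) (\<lambda>t. t ^ i)"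
proof -
  interpret prob_space "clock \<rho>" by (rule prob_space_clock[OF assms])
  have "distributed (clock \<rho>) lborel (\<lambda>t. t) (exponential_density \<rho>)"
    unfolding distributed_def using assms
    by (auto simp: clock_def distr_id2 exponential_density_nonneg
        intro!: measure_eqI simp: emeasure_distr)
  from erlang_ith_moment_integrable[OF assms this] show ?thesis .
qed

text \<open>The loss of memory of the exponential time.\<close>

lemma clock_shift:
  fixes f :: "real \<Rightarrow> real"
  assumes \<rho>: "0 < \<rho>" and d: "0 \<le> d" and f: "integrable (clock \<rho>) f"
  shows "integrable (clock \<rho>) (\<lambda>t. f (t + d))"
    and "(\<integral>t. f (t + d) \<partial>clock \<rho>) = exp (\<rho> * d) * (\<integral>t. indicator {d..} t * f t \<partial>clock \<rho>)"
proof -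
  have [measurable]: "f \<in> borel_measurable borel" using borel_measurable_integrable[OF f] by simp
  define g where "g t = exp (\<rho> * d) * (exponential_density \<rho> t * (indicator {d..} t * f t))" for t
  have g_eq: "exponential_density \<rho> t * f (t + d) = g (d + 1 * t)" for t
    unfolding g_def using d
    by (auto simp: exponential_density_def indicator_def add.commute algebra_simps simp flip: exp_add)
  have ind: "integrable (clock \<rho>) (\<lambda>t. indicator {d..} t * f t)"
    using f integrable_mult_indicator[of "{d..}" "clock \<rho>" f] by simp
  have g_int: "integrable lborel g"
    unfolding g_def using ind by (subst (asm) integrable_clock_iff[OF \<rho>]) auto
  show "integrable (clock \<rho>) (\<lambda>t. f (t + d))"
    by (subst integrable_clock_iff[OF \<rho>]) (use lborel_integrable_real_affine[OF g_int, of 1 d] in \<open>auto simp: g_eq\<close>)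
  have "(\<integral>t. f (t + d) \<partial>clock \<rho>) = (\<integral>t. g (d + 1 * t) \<partial>lborel)"
    by (subst integral_clock[OF \<rho>]) (auto simp: g_eq)
  also have "\<dots> = (\<integral>t. g t \<partial>lborel)"
    using lborel_integral_real_affine[of 1 g d] by simp
  also have "\<dots> = exp (\<rho> * d) * (\<integral>t. indicator {d..} t * f t \<partial>clock \<rho>)"
    unfolding g_def by (subst integral_clock[OF \<rho>]) auto
  finally show "(\<integral>t. f (t + d) \<partial>clock \<rho>) = exp (\<rho> * d) * (\<integral>t. indicator {d..} t * f t \<partial>clock \<rho>)" .
qed

lemma exp_difference_quotient:
  "(\<lambda>n. real (Suc n) * (exp (\<rho> * (1 / real (Suc n))) - 1)) \<longlonglongrightarrow> \<rho>"
proof -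
  have "((\<lambda>x. exp (\<rho> * x)) has_real_derivative \<rho>) (at 0)"
    by (auto intro!: derivative_eq_intros)
  then have "((\<lambda>x. (exp (\<rho> * x) - 1) / x) \<longlongrightarrow> \<rho>) (at 0)"
    unfolding has_field_derivative_iff by simp
  moreover have "filterlim (\<lambda>n. 1 / real (Suc n)) (at 0) sequentially"
    unfolding filterlim_at using LIMSEQ_Suc[OF lim_1_over_n] by simp
  ultimately have "(\<lambda>n. (exp (\<rho> * (1 / real (Suc n))) - 1) / (1 / real (Suc n))) \<longlonglongrightarrow> \<rho>"
    by (rule filterlim_compose)
  then show ?thesis by (simp add: mult.commute)
qed

text \<open>Averaging \<open>n (G (t + 1/n) - G t)\<close> over the exponential time gives \<open>\<rho> (\<integral> G - G 0)\<close> in the limit, by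
  the loss of memory. A lower bound \<open>Q\<close> for the averaged drift of \<open>G\<close> therefore gives an upper bound for its
  starting value. Only a lower bound \<open>G0\<close> near time 0 is required, which lets \<open>G0\<close> be the value before
  an initial jump of the control.\<close>

lemma clock_generator_bound:
  fixes G :: "real \<Rightarrow> real"
  assumes \<rho>: "0 < \<rho>" and G: "integrable (clock \<rho>) G"
    and start: "\<And>\<epsilon>. 0 < \<epsilon> \<Longrightarrow> \<exists>d>0. \<forall>t. 0 \<le> t \<and> t < d \<longrightarrow> G0 - \<epsilon> \<le> G t"
    and drift: "\<And>n. Q - r n \<le> real (Suc n) * ((\<integral>t. G (t + 1 / real (Suc n)) \<partial>clock \<rho>) - (\<integral>t. G t \<partial>clock \<rho>))"
    and r: "r \<longlonglongrightarrow> 0"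
  shows "G0 \<le> (\<integral>t. G t \<partial>clock \<rho>) - Q / \<rho>"
proof -
  interpret prob_space "clock \<rho>" by (rule prob_space_clock[OF \<rho>])
  define I where "I = (\<integral>t. G t \<partial>clock \<rho>)"
  have "Q \<le> \<rho> * (I - G0 + \<epsilon>)" if \<epsilon>: "0 < \<epsilon>" for \<epsilon>
  proof -
    obtain d where d: "0 < d" "\<And>t. 0 \<le> t \<Longrightarrow> t < d \<Longrightarrow> G0 - \<epsilon> \<le> G t" using start[OF \<epsilon>] by blast
    have bound: "Q - r n \<le> real (Suc n) * (exp (\<rho> * (1 / real (Suc n))) - 1) * (I - G0 + \<epsilon>)"
      if n: "1 / real (Suc n) < d" for n
    proof -
      define \<delta> where "\<delta> = 1 / real (Suc n)"
      have \<delta>: "0 < \<delta>" "\<delta> < d" using n by (auto simp: \<delta>_def)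
      have late: "integrable (clock \<rho>) (\<lambda>t. indicator {\<delta>..} t * G t)"
        "integrable (clock \<rho>) (\<lambda>t. indicator {\<delta>..} t :: real)"
        using G integrable_mult_indicator[of "{\<delta>..}" "clock \<rho>" G] by (simp_all add: emeasure_eq_measure)
      have tail: "exp (\<rho> * \<delta>) * (\<integral>t. indicator {\<delta>..} t \<partial>clock \<rho>) = (1::real)"
        using clock_shift(2)[OF \<rho>, of \<delta> "\<lambda>_. 1"] \<delta> prob_space by simp
      (* Before time \<delta>, G may be replaced by its lower bound G0 - \<epsilon>. *)
      have "(\<integral>t. indicator {\<delta>..} t * G t + (1 - indicator {\<delta>..} t) * (G0 - \<epsilon>) \<partial>clock \<rho>) \<le> I"
        unfolding I_def
      proof (rule integral_mono_AE)
        show "AE t in clock \<rho>. indicator {\<delta>..} t * G t + (1 - indicator {\<delta>..} t) * (G0 - \<epsilon>) \<le> G t"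
          using AE_clock_nonneg by eventually_elim (use d \<delta> in \<open>auto simp: indicator_def\<close>)
      qed (use late G in auto)
      moreover have "(\<integral>t. indicator {\<delta>..} t * G t + (1 - indicator {\<delta>..} t) * (G0 - \<epsilon>) \<partial>clock \<rho>)
          = (\<integral>t. indicator {\<delta>..} t * G t \<partial>clock \<rho>)
            + (1 - (\<integral>t. indicator {\<delta>..} t \<partial>clock \<rho>)) * (G0 - \<epsilon>)"
        using late prob_space by simp
      ultimately have "(\<integral>t. indicator {\<delta>..} t * G t \<partial>clock \<rho>)
          \<le> I - (1 - (\<integral>t. indicator {\<delta>..} t \<partial>clock \<rho>)) * (G0 - \<epsilon>)" by simp
      then have "exp (\<rho> * \<delta>) * (\<integral>t. indicator {\<delta>..} t * G t \<partial>clock \<rho>)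
          \<le> exp (\<rho> * \<delta>) * (I - (1 - (\<integral>t. indicator {\<delta>..} t \<partial>clock \<rho>)) * (G0 - \<epsilon>))"
        by (rule mult_left_mono) simp
      also have "\<dots> = exp (\<rho> * \<delta>) * I - (exp (\<rho> * \<delta>) - 1) * (G0 - \<epsilon>)"
        using tail by (simp add: algebra_simps)
      finally have "(\<integral>t. G (t + \<delta>) \<partial>clock \<rho>) - I \<le> (exp (\<rho> * \<delta>) - 1) * (I - G0 + \<epsilon>)"
        using clock_shift(2)[OF \<rho> _ G, of \<delta>] \<delta> by (simp add: algebra_simps)
      then have "real (Suc n) * ((\<integral>t. G (t + \<delta>) \<partial>clock \<rho>) - I)
          \<le> real (Suc n) * ((exp (\<rho> * \<delta>) - 1) * (I - G0 + \<epsilon>))"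
        by (rule mult_left_mono) simp
      then show ?thesis using drift[of n] unfolding \<delta>_def I_def by (simp only: mult.assoc)
    qed
    have "\<forall>\<^sub>F n in sequentially. 1 / real (Suc n) < d"
      using LIMSEQ_Suc[OF lim_1_over_n] d(1) by (rule order_tendstoD(2))
    then have ev: "\<forall>\<^sub>F n in sequentially. Q - r n \<le> real (Suc n) * (exp (\<rho> * (1 / real (Suc n))) - 1) * (I - G0 + \<epsilon>)"
      by eventually_elim (rule bound)
    have lhs: "(\<lambda>n. Q - r n) \<longlonglongrightarrow> Q - 0" by (intro tendsto_intros r)
    have rhs: "(\<lambda>n. real (Suc n) * (exp (\<rho> * (1 / real (Suc n))) - 1) * (I - G0 + \<epsilon>)) \<longlonglongrightarrow> \<rho> * (I - G0 + \<epsilon>)"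
      by (rule tendsto_mult[OF exp_difference_quotient tendsto_const])
    show "Q \<le> \<rho> * (I - G0 + \<epsilon>)"
      using tendsto_le[OF trivial_limit_sequentially rhs lhs ev] by simp
  qed
  then have "Q / \<rho> \<le> I - G0 + \<epsilon>" if "0 < \<epsilon>" for \<epsilon>
    using that \<rho> by (simp add: pos_divide_le_eq mult.commute)
  then have "Q / \<rho> \<le> I - G0" by (rule field_le_epsilon)
  then show ?thesis unfolding I_def by simp
qed

lemma clock_generator_upper_bound:
  fixes G :: "real \<Rightarrow> real"
  assumes \<rho>: "0 < \<rho>" and G: "integrable (clock \<rho>) G"
    and start: "\<And>\<epsilon>. 0 < \<epsilon> \<Longrightarrow> \<exists>d>0. \<forall>t. 0 \<le> t \<and> t < d \<longrightarrow> G t \<le> G0 + \<epsilon>"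
    and drift: "\<And>n. real (Suc n) * ((\<integral>t. G (t + 1 / real (Suc n)) \<partial>clock \<rho>) - (\<integral>t. G t \<partial>clock \<rho>)) \<le> Q + r n"
    and r: "r \<longlonglongrightarrow> 0"
  shows "(\<integral>t. G t \<partial>clock \<rho>) - Q / \<rho> \<le> G0"
proof -
  have "- G0 \<le> (\<integral>t. - G t \<partial>clock \<rho>) - (- Q) / \<rho>"
  proof (rule clock_generator_bound[OF \<rho> _ _ _ r])
    show "integrable (clock \<rho>) (\<lambda>t. - G t)" using G by simp
    show "\<exists>d>0. \<forall>t. 0 \<le> t \<and> t < d \<longrightarrow> - G0 - \<epsilon> \<le> - G t" if \<epsilon>: "0 < \<epsilon>" for \<epsilon>
    proof -
      obtain d where "0 < d" "\<forall>t. 0 \<le> t \<and> t < d \<longrightarrow> G t \<le> G0 + \<epsilon>" using start[OF \<epsilon>] by blast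
      then show ?thesis by (intro exI[of _ d]) (auto simp: algebra_simps)
    qed
    show "- Q - r n \<le> real (Suc n) * ((\<integral>t. - G (t + 1 / real (Suc n)) \<partial>clock \<rho>) - (\<integral>t. - G t \<partial>clock \<rho>))" for n
      using drift[of n] by (simp add: algebra_simps)
  qed
  then show ?thesis by simp
qed

text \<open>Averages a one-step expansion with error \<open>d powr (3/2)\<close> over the exponential time. The term \<open>e\<close> collects
  contributions of the step that are not proportional to \<open>d\<close>.\<close>

lemma clock_increment_expansion:
  fixes G q e :: "real \<Rightarrow> real"
  assumes \<rho>: "0 < \<rho>" and int: "integrable (clock \<rho>) G" "integrable (clock \<rho>) q" "integrable (clock \<rho>) e"
    and expansion: "\<And>t. 0 \<le> t \<Longrightarrow> \<bar>G (t + d) - (G t + d * q t + e t)\<bar> \<le> C * (d * sqrt d)"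
    and d: "d = 1 / real (Suc n)"
  shows "\<bar>real (Suc n) * ((\<integral>t. G (t + d) \<partial>clock \<rho>) - (\<integral>t. G t \<partial>clock \<rho>))
    - ((\<integral>t. q t \<partial>clock \<rho>) + real (Suc n) * (\<integral>t. e t \<partial>clock \<rho>))\<bar> \<le> C * sqrt d"
proof -
  interpret prob_space "clock \<rho>" by (rule prob_space_clock[OF \<rho>])
  have d1: "0 \<le> d" "real (Suc n) * d = 1" by (auto simp: d)
  define X where "X = ((\<integral>t. G (t + d) \<partial>clock \<rho>) - (\<integral>t. G t \<partial>clock \<rho>))
    - (d * (\<integral>t. q t \<partial>clock \<rho>) + (\<integral>t. e t \<partial>clock \<rho>))"
  note shifted = clock_shift(1)[OF \<rho> d1(1) int(1)]
  have "X = (\<integral>t. G (t + d) - (G t + d * q t + e t) \<partial>clock \<rho>)"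
    unfolding X_def using shifted int by simp
  also have "\<bar>\<dots>\<bar> \<le> (\<integral>t. \<bar>G (t + d) - (G t + d * q t + e t)\<bar> \<partial>clock \<rho>)" by simp
  also have "\<dots> \<le> (\<integral>t. C * (d * sqrt d) \<partial>clock \<rho>)"
  proof (rule integral_mono_AE)
    show "AE t in clock \<rho>. \<bar>G (t + d) - (G t + d * q t + e t)\<bar> \<le> C * (d * sqrt d)"
      using AE_clock_nonneg by eventually_elim (rule expansion)
  qed (use shifted int in auto)
  finally have le: "\<bar>X\<bar> \<le> C * (d * sqrt d)" using prob_space by simp
  have "\<bar>real (Suc n) * X\<bar> = real (Suc n) * \<bar>X\<bar>" by (simp only: abs_mult abs_of_nat)
  also have "\<dots> \<le> real (Suc n) * (C * (d * sqrt d))" by (rule mult_left_mono[OF le]) simp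
  also have "\<dots> = (real (Suc n) * d) * (C * sqrt d)" by (simp only: ac_simps)
  finally have "\<bar>real (Suc n) * X\<bar> \<le> C * sqrt d" unfolding d1(2) by simp
  moreover have "real (Suc n) * X = real (Suc n) * ((\<integral>t. G (t + d) \<partial>clock \<rho>) - (\<integral>t. G t \<partial>clock \<rho>))
      - ((real (Suc n) * d) * (\<integral>t. q t \<partial>clock \<rho>) + real (Suc n) * (\<integral>t. e t \<partial>clock \<rho>))"
    unfolding X_def by (simp only: algebra_simps)
  ultimately show ?thesis unfolding d1(2) by simp
qed

lemma sqrt_inverse_Suc_tendsto_0: "(\<lambda>n. C * sqrt (1 / real (Suc n))) \<longlonglongrightarrow> 0"
  using tendsto_mult[OF tendsto_const tendsto_real_sqrt[OF LIMSEQ_Suc[OF lim_1_over_n]], of C] by simp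

text \<open>Approximates the time from the left by multiples of \<open>1/n\<close>, so that only countably many of the
  functions \<open>f t\<close> are used at a time.\<close>

lemma measurable_pair_continuous_paths:
  fixes f :: "real \<Rightarrow> 'a \<Rightarrow> real"
  assumes meas: "\<And>t. f t \<in> borel_measurable N"
    and cont: "\<And>\<omega>. \<omega> \<in> space N \<Longrightarrow> continuous_on UNIV (\<lambda>t. f t \<omega>)"
  shows "(\<lambda>(t, \<omega>). f t \<omega>) \<in> borel_measurable (borel \<Otimes>\<^sub>M N)"
proof -
  have "(\<lambda>p. f (fst p) (snd p)) \<in> borel_measurable (borel \<Otimes>\<^sub>M N)"
  proof (rule borel_measurable_LIMSEQ_real)
    fix i :: nat
    have "(\<lambda>p. (\<lambda>k p. f (real_of_int k / real (Suc i)) (snd p)) \<lfloor>real (Suc i) * fst p\<rfloor> p)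
        \<in> borel_measurable (borel \<Otimes>\<^sub>M N)"
      by (rule measurable_compose_countable) (use meas in measurable)
    then show "(\<lambda>p. f (real_of_int \<lfloor>real (Suc i) * fst p\<rfloor> / real (Suc i)) (snd p)) \<in> borel_measurable (borel \<Otimes>\<^sub>M N)"
      by simp
  next
    fix p assume "p \<in> space ((borel :: real measure) \<Otimes>\<^sub>M N)"
    then have \<omega>: "snd p \<in> space N" by (auto simp: space_pair_measure)
    have "(\<lambda>i. real_of_int \<lfloor>real (Suc i) * fst p\<rfloor> / real (Suc i)) \<longlonglongrightarrow> fst p"
    proof (rule tendsto_sandwich)
      show "\<forall>\<^sub>F i in sequentially. fst p - 1 / real (Suc i) \<le> real_of_int \<lfloor>real (Suc i) * fst p\<rfloor> / real (Suc i)"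
      proof (intro always_eventually allI)
        fix i
        have "real (Suc i) * fst p - 1 \<le> real_of_int \<lfloor>real (Suc i) * fst p\<rfloor>" by linarith
        then have "(real (Suc i) * fst p - 1) / real (Suc i) \<le> real_of_int \<lfloor>real (Suc i) * fst p\<rfloor> / real (Suc i)"
          by (rule divide_right_mono) simp
        then show "fst p - 1 / real (Suc i) \<le> real_of_int \<lfloor>real (Suc i) * fst p\<rfloor> / real (Suc i)"
          by (simp add: diff_divide_distrib)
      qed
      show "\<forall>\<^sub>F i in sequentially. real_of_int \<lfloor>real (Suc i) * fst p\<rfloor> / real (Suc i) \<le> fst p"
        by (intro always_eventually allI) (simp add: pos_divide_le_eq mult.commute[of "fst p"])
      show "(\<lambda>i. fst p - 1 / real (Suc i)) \<longlonglongrightarrow> fst p"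
        using tendsto_diff[OF tendsto_const LIMSEQ_Suc[OF lim_1_over_n], of "fst p"] by simp
    qed simp
    from continuous_on_tendsto_compose[OF cont[OF \<omega>] this]
    show "(\<lambda>i. f (real_of_int \<lfloor>real (Suc i) * fst p\<rfloor> / real (Suc i)) (snd p)) \<longlonglongrightarrow> f (fst p) (snd p)"
      by simp
  qed
  then show ?thesis by (simp add: case_prod_beta')
qed

section \<open>The discounted cost of the uncontrolled gap\<close>

lemma brownian_jointly_measurable:
  fixes w :: "real \<Rightarrow> 'a \<Rightarrow> real"
  assumes bm: "brownian_motion M F w"
  shows "(\<lambda>(t, \<omega>). w (max 0 t) \<omega>) \<in> borel_measurable (borel \<Otimes>\<^sub>M M)"
proof (rule measurable_pair_continuous_paths)
  show "w (max 0 t) \<in> borel_measurable M" for t using brownian_motionD(5)[OF bm, of "max 0 t"] by simp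
  show "continuous_on UNIV (\<lambda>t. w (max 0 t) \<omega>)" if "\<omega> \<in> space M" for \<omega>
    by (rule continuous_on_compose2[OF brownian_motionD(7)[OF bm that]]) (auto intro!: continuous_intros)
qed

lemma sqrt_le_1_plus: "0 \<le> t \<Longrightarrow> sqrt t \<le> 1 + t"
  by (rule real_le_lsqrt) (auto simp: power2_eq_square algebra_simps)

text \<open>With \<open>G t = E[P (x + s W t)]\<close> and no control, the expansion holds with equality, so that
  \<open>P x = \<integral> G - 1/\<rho> \<integral> s\<^sup>2/2 E[P2 (x + s W t)]\<close> over the exponential time. By the differential equation
  the right-hand side is \<open>1/\<rho>\<close> times the averaged running cost.\<close>

lemma (in resolvent_cost) discounted_running_cost_eq:
  assumes bm: "brownian_motion N F W"
  shows "discounted_running_cost N W \<rho> h s x = P x"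
proof -
  interpret N: prob_space N by (rule brownian_motionD[OF bm])
  interpret clock: prob_space "clock \<rho>" by (rule prob_space_clock[OF \<rho>_pos])
  interpret pair_sigma_finite "clock \<rho>" N ..
  define X where "X t \<omega> = x + s * W (max 0 t) \<omega>" for t \<omega>
  have W_joint [measurable]: "(\<lambda>(t, \<omega>). W (max 0 t) \<omega>) \<in> borel_measurable (borel \<Otimes>\<^sub>M N)"
    by (rule brownian_jointly_measurable[OF bm])
  have X_joint [measurable]: "(\<lambda>(t, \<omega>). X t \<omega>) \<in> borel_measurable (borel \<Otimes>\<^sub>M N)"
    unfolding X_def by measurable
  have [measurable]: "X t \<in> borel_measurable N" for t
    unfolding X_def using brownian_motionD(5)[OF bm, of "max 0 t"] by simp
  have X_adapted: "X t \<in> borel_measurable (F t)" if "0 \<le> t" for t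
    unfolding X_def using brownian_motionD(4)[OF bm that] that by simp
  have [measurable]: "P \<in> borel_measurable borel" "P2 \<in> borel_measurable borel" "h \<in> borel_measurable borel"
    using DERIV_continuous_on[of UNIV P P1] P_deriv DERIV_continuous_on[of UNIV P2 P3] P2_deriv
      DERIV_continuous_on[of UNIV h h1] h_deriv
    by (simp_all add: borel_measurable_continuous_onI)
  have P1_meas [measurable]: "P1 \<in> borel_measurable borel"
    using DERIV_continuous_on[of UNIV P1 P2] P1_deriv by (simp add: borel_measurable_continuous_onI)
  have B_pos: "0 < B" using P2_pos[of 0] P2_upper[of 0] by linarith
  note P2_lip = DERIV_bounded_imp_lipschitz[OF P2_deriv P3_bound]
  note P1_lip = DERIV_bounded_imp_lipschitz[OF P1_deriv, of B]
  have P2_abs: "\<bar>P2 y\<bar> \<le> B" for y using P2_pos[of y] P2_upper[of y] by simp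
  have int_P2: "integrable N (\<lambda>\<omega>. P2 (X t \<omega>))" for t
    by (rule N.integrable_const_bound[of _ B]) (use P2_abs in auto)
  have int_P1: "integrable N (\<lambda>\<omega>. P1 (X t \<omega>))" if t: "0 \<le> t" for t
  proof (rule Bochner_Integration.integrable_bound)
    show "integrable N (\<lambda>\<omega>. \<bar>P1 x\<bar> + B * (s * \<bar>W t \<omega>\<bar>))"
      using brownian_abs_moment_bounds(3)[OF bm t] by auto
    show "AE \<omega> in N. norm (P1 (X t \<omega>)) \<le> norm (\<bar>P1 x\<bar> + B * (s * \<bar>W t \<omega>\<bar>))"
    proof (rule AE_I2)
      fix \<omega>
      have "\<bar>P1 (X t \<omega>) - P1 x\<bar> \<le> B * \<bar>X t \<omega> - x\<bar>" using P1_lip P2_abs by blast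
      also have "\<bar>X t \<omega> - x\<bar> = s * \<bar>W t \<omega>\<bar>" using t s_pos by (simp add: X_def abs_mult)
      finally show "norm (P1 (X t \<omega>)) \<le> norm (\<bar>P1 x\<bar> + B * (s * \<bar>W t \<omega>\<bar>))" by auto
    qed
  qed (use P1_meas in measurable)
  have X0: "X 0 \<omega> = x" if "\<omega> \<in> space N" for \<omega>
    using brownian_motionD(6)[OF bm that] by (simp add: X_def)
  have int_P0: "integrable N (\<lambda>\<omega>. P (X 0 \<omega>)) \<and> (\<integral>\<omega>. P (X 0 \<omega>) \<partial>N) = P x"
  proof -
    have "integrable N (\<lambda>\<omega>. P (X 0 \<omega>)) \<longleftrightarrow> integrable N (\<lambda>\<omega>. P x)"
      "(\<integral>\<omega>. P (X 0 \<omega>) \<partial>N) = (\<integral>\<omega>. P x \<partial>N)"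
      using X0 by (intro Bochner_Integration.integrable_cong Bochner_Integration.integral_cong; simp)+
    then show ?thesis using N.prob_space by simp
  qed
  have step_eq: "X (t + d) \<omega> = X t \<omega> + s * (W (t + d) \<omega> - W t \<omega>)" if "0 \<le> t" "0 \<le> d" for t d \<omega>
    using that by (simp add: X_def algebra_simps)
  have int_P: "integrable N (\<lambda>\<omega>. P (X t \<omega>))" if t: "0 \<le> t" for t
  proof (cases "t = 0")
    case False
    then have p: "0 < t" using t by simp
    (* One step from the constant X 0 gives integrability in spite of the quadratic growth of P. *)
    have "integrable N (\<lambda>\<omega>. P (X 0 \<omega> + s * (W (0 + t) \<omega> - W 0 \<omega>)))"
      by (rule brownian_step_expansion(1)[OF bm order_refl p _ X_adapted P_deriv P1_deriv P2_lip _ int_P1 int_P2])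
        (use int_P0 s_pos in auto)
    then show ?thesis using step_eq[of 0 t] t by simp
  qed (use int_P0 in simp)
  define G where "G t = (\<integral>\<omega>. P (X t \<omega>) \<partial>N)" for t
  define q where "q t = s\<^sup>2 / 2 * (\<integral>\<omega>. P2 (X t \<omega>) \<partial>N)" for t
  have expansion: "\<bar>G (t + d) - (G t + d * q t)\<bar> \<le> B * s ^ 3 * (d * sqrt d)" if t: "0 \<le> t" and d: "0 < d" for t d
    using brownian_step_expansion(2)[OF bm t d _ X_adapted[OF t] P_deriv P1_deriv P2_lip int_P[OF t] int_P1[OF t] int_P2]
      s_pos step_eq[of t d] t d unfolding G_def q_def by simp
  have G_meas [measurable]: "G \<in> borel_measurable borel" unfolding G_def by measurable
  have q_meas [measurable]: "q \<in> borel_measurable borel" unfolding q_def by measurable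
  have q_bound: "\<bar>q t\<bar> \<le> s\<^sup>2 / 2 * B" for t
  proof -
    have "\<bar>\<integral>\<omega>. P2 (X t \<omega>) \<partial>N\<bar> \<le> (\<integral>\<omega>. \<bar>P2 (X t \<omega>)\<bar> \<partial>N)" by simp
    also have "\<dots> \<le> (\<integral>\<omega>. B \<partial>N)"
      by (rule integral_mono) (use int_P2 P2_abs in auto)
    finally show ?thesis unfolding q_def abs_mult using N.prob_space by (simp add: mult_left_mono)
  qed
  have int_q: "integrable (clock \<rho>) q"
    by (rule clock.integrable_const_bound[of _ "s\<^sup>2 / 2 * B"]) (use q_bound in auto)
  have G_bound: "\<bar>G t - P x\<bar> \<le> s\<^sup>2 / 2 * B * t + B * s ^ 3 * (t * sqrt t)" if "0 \<le> t" for t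
  proof (cases "t = 0")
    case False
    then have t: "0 < t" using that by simp
    have "\<bar>G t - (P x + t * q 0)\<bar> \<le> B * s ^ 3 * (t * sqrt t)"
      using expansion[OF order_refl t] int_P0 by (simp add: G_def)
    moreover have "\<bar>t * q 0\<bar> \<le> s\<^sup>2 / 2 * B * t" using q_bound[of 0] t by (simp add: abs_mult)
    ultimately show ?thesis by linarith
  qed (use int_P0 in \<open>simp add: G_def\<close>)
  have int_G: "integrable (clock \<rho>) G"
  proof (rule Bochner_Integration.integrable_bound)
    show "integrable (clock \<rho>) (\<lambda>t. \<bar>P x\<bar> + s\<^sup>2 / 2 * B * t ^ 1 + B * s ^ 3 * (t ^ 1 + t ^ 2))"
      by (intro Bochner_Integration.integrable_add integrable_mult_right integrable_clock_power \<rho>_pos) simp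
    show "AE t in clock \<rho>. norm (G t) \<le> norm (\<bar>P x\<bar> + s\<^sup>2 / 2 * B * t ^ 1 + B * s ^ 3 * (t ^ 1 + t ^ 2))"
      using AE_clock_nonneg
    proof eventually_elim
      fix t :: real assume t: "0 \<le> t"
      have "t * sqrt t \<le> t * (1 + t)" using sqrt_le_1_plus[OF t] t by (rule mult_left_mono)
      then have "B * s ^ 3 * (t * sqrt t) \<le> B * s ^ 3 * (t ^ 1 + t ^ 2)"
        using B_pos s_pos by (intro mult_left_mono) (auto simp: power2_eq_square algebra_simps)
      then show "norm (G t) \<le> norm (\<bar>P x\<bar> + s\<^sup>2 / 2 * B * t ^ 1 + B * s ^ 3 * (t ^ 1 + t ^ 2))"
        using G_bound[OF t] by simp
    qed
  qed simp
  define Q where "Q = (\<integral>t. q t \<partial>clock \<rho>)"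
  have increments: "\<bar>real (Suc n) * ((\<integral>t. G (t + 1 / real (Suc n)) \<partial>clock \<rho>) - (\<integral>t. G t \<partial>clock \<rho>)) - Q\<bar>
      \<le> B * s ^ 3 * sqrt (1 / real (Suc n))" for n
  proof -
    define d where "d = 1 / real (Suc n)"
    have "\<bar>G (t + d) - (G t + d * q t + 0)\<bar> \<le> B * s ^ 3 * (d * sqrt d)" if "0 \<le> t" for t
      using expansion[OF that, of d] by (simp add: d_def)
    from clock_increment_expansion[OF \<rho>_pos int_G int_q integrable_zero this d_def]
    show ?thesis unfolding d_def Q_def by simp
  qed
  have start: "\<exists>d>0. \<forall>t. 0 \<le> t \<and> t < d \<longrightarrow> \<bar>G t - P x\<bar> \<le> \<epsilon>" if \<epsilon>: "0 < \<epsilon>" for \<epsilon>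
  proof -
    have "((\<lambda>t. s\<^sup>2 / 2 * B * t + B * s ^ 3 * (t * sqrt t)) \<longlongrightarrow> s\<^sup>2 / 2 * B * 0 + B * s ^ 3 * (0 * sqrt 0)) (at 0)"
      by (intro tendsto_intros)
    then have "\<forall>\<^sub>F t in at 0. s\<^sup>2 / 2 * B * t + B * s ^ 3 * (t * sqrt t) < \<epsilon>"
      using \<epsilon> by (intro order_tendstoD(2)) auto
    then obtain d where d: "0 < d" "\<And>t. t \<noteq> 0 \<Longrightarrow> dist t 0 < d \<Longrightarrow> s\<^sup>2 / 2 * B * t + B * s ^ 3 * (t * sqrt t) < \<epsilon>"
      unfolding eventually_at by auto
    show ?thesis
    proof (intro exI[of _ d] conjI d(1) allI impI)
      fix t assume t: "0 \<le> t \<and> t < d"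
      show "\<bar>G t - P x\<bar> \<le> \<epsilon>"
        using G_bound[of t] d(2)[of t] t \<epsilon> by (cases "t = 0") auto
    qed
  qed
  have "P x \<le> (\<integral>t. G t \<partial>clock \<rho>) - Q / \<rho>"
  proof (rule clock_generator_bound[OF \<rho>_pos int_G _ _ sqrt_inverse_Suc_tendsto_0])
    show "\<exists>d>0. \<forall>t. 0 \<le> t \<and> t < d \<longrightarrow> P x - \<epsilon> \<le> G t" if "0 < \<epsilon>" for \<epsilon>
      using start[OF that] by (meson abs_diff_le_iff)
    show "Q - B * s ^ 3 * sqrt (1 / real (Suc n))
        \<le> real (Suc n) * ((\<integral>t. G (t + 1 / real (Suc n)) \<partial>clock \<rho>) - (\<integral>t. G t \<partial>clock \<rho>))" for n
      using increments[of n] by linarith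
  qed
  moreover have "(\<integral>t. G t \<partial>clock \<rho>) - Q / \<rho> \<le> P x"
  proof (rule clock_generator_upper_bound[OF \<rho>_pos int_G _ _ sqrt_inverse_Suc_tendsto_0])
    show "\<exists>d>0. \<forall>t. 0 \<le> t \<and> t < d \<longrightarrow> G t \<le> P x + \<epsilon>" if "0 < \<epsilon>" for \<epsilon>
      using start[OF that] by (meson abs_diff_le_iff)
    show "real (Suc n) * ((\<integral>t. G (t + 1 / real (Suc n)) \<partial>clock \<rho>) - (\<integral>t. G t \<partial>clock \<rho>))
        \<le> Q + B * s ^ 3 * sqrt (1 / real (Suc n))" for n
      using increments[of n] by linarith
  qed
  ultimately have P_eq: "P x = (\<integral>t. G t \<partial>clock \<rho>) - Q / \<rho>" by simp
  have h_eq: "h y = \<rho> * P y - s\<^sup>2 / 2 * P2 y" for y using P_ODE[of y] by simp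
  have int_h: "integrable N (\<lambda>\<omega>. h (X t \<omega>))" "(\<integral>\<omega>. h (X t \<omega>) \<partial>N) = \<rho> * G t - q t" if "0 \<le> t" for t
    unfolding h_eq G_def q_def using int_P[OF that] int_P2[of t] by simp_all
  have [measurable]: "(\<lambda>(t, \<omega>). h (X t \<omega>)) \<in> borel_measurable (clock \<rho> \<Otimes>\<^sub>M N)" by measurable
  have prod_int: "integrable (clock \<rho> \<Otimes>\<^sub>M N) (\<lambda>(t, \<omega>). h (X t \<omega>))"
  proof (rule Fubini_integrable)
    have "integrable (clock \<rho>) (\<lambda>t. \<rho> * G t - q t)" using int_G int_q by simp
    then show "integrable (clock \<rho>) (\<lambda>t. \<integral>\<omega>. norm (case (t, \<omega>) of (t, \<omega>) \<Rightarrow> h (X t \<omega>)) \<partial>N)"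
    proof (rule integrable_cong_AE[THEN iffD1, rotated 3])
      show "AE t in clock \<rho>. \<rho> * G t - q t = (\<integral>\<omega>. norm (case (t, \<omega>) of (t, \<omega>) \<Rightarrow> h (X t \<omega>)) \<partial>N)"
        using AE_clock_nonneg by eventually_elim (simp add: int_h h_nonneg)
    qed measurable
    show "AE t in clock \<rho>. integrable N (\<lambda>\<omega>. case (t, \<omega>) of (t, \<omega>) \<Rightarrow> h (X t \<omega>))"
      using AE_clock_nonneg by eventually_elim (simp add: int_h)
  qed measurable
  have inner: "(LINT t:{0..}|lborel. exp (- \<rho> * t) * h (x + s * W t \<omega>)) = (\<integral>t. h (X t \<omega>) \<partial>clock \<rho>) / \<rho>"
    if \<omega>: "\<omega> \<in> space N" for \<omega>
  proof -
    have [measurable]: "(\<lambda>t. X t \<omega>) \<in> borel_measurable borel"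
      using measurable_compose[OF measurable_Pair2'[OF \<omega>] X_joint] by simp
    have "(\<integral>t. h (X t \<omega>) \<partial>clock \<rho>) = (\<integral>t. \<rho> * (indicator {0..} t * (exp (- \<rho> * t) * h (x + s * W t \<omega>))) \<partial>lborel)"
    proof (subst integral_clock[OF \<rho>_pos])
      show "(\<lambda>t. h (X t \<omega>)) \<in> borel_measurable borel" by measurable
      show "(\<integral>t. exponential_density \<rho> t * h (X t \<omega>) \<partial>lborel)
          = (\<integral>t. \<rho> * (indicator {0..} t * (exp (- \<rho> * t) * h (x + s * W t \<omega>))) \<partial>lborel)"
        by (rule Bochner_Integration.integral_cong)
          (auto simp: exponential_density_def X_def mult.commute split: split_indicator)
    qed
    then show ?thesis using \<rho>_pos by (simp add: set_lebesgue_integral_def)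
  qed
  have "discounted_running_cost N W \<rho> h s x = (\<integral>\<omega>. (\<integral>t. h (X t \<omega>) \<partial>clock \<rho>) / \<rho> \<partial>N)"
    unfolding discounted_running_cost_def by (rule Bochner_Integration.integral_cong[OF refl inner])
  also have "\<dots> = (\<integral>t. (\<integral>\<omega>. h (X t \<omega>) \<partial>N) \<partial>clock \<rho>) / \<rho>"
    using integral_snd[OF prod_int] integral_fst[OF prod_int] by simp
  also have "(\<integral>t. (\<integral>\<omega>. h (X t \<omega>) \<partial>N) \<partial>clock \<rho>) = (\<integral>t. \<rho> * G t - q t \<partial>clock \<rho>)"
  proof (rule integral_cong_AE)
    show "AE t in clock \<rho>. (\<integral>\<omega>. h (X t \<omega>) \<partial>N) = \<rho> * G t - q t"
      using AE_clock_nonneg by eventually_elim (simp add: int_h)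
  qed measurable
  also have "\<dots> / \<rho> = P x"
    unfolding P_eq Q_def using int_G int_q \<rho>_pos by (simp add: field_simps)
  finally show ?thesis .
qed

text \<open>The average rate at which a nonnegative function increases is controlled by its average. For
  accumulated effort this bounds the effort per unit of time uniformly in the step size.\<close>

lemma clock_increment_bound:
  fixes f :: "real \<Rightarrow> real"
  assumes \<rho>: "0 < \<rho>" and f: "integrable (clock \<rho>) f" and nn: "\<And>t. 0 \<le> t \<Longrightarrow> 0 \<le> f t"
  shows "real (Suc n) * ((\<integral>t. f (t + 1 / real (Suc n)) \<partial>clock \<rho>) - (\<integral>t. f t \<partial>clock \<rho>))
    \<le> \<rho> * exp \<rho> * (\<integral>t. f t \<partial>clock \<rho>)"
proof -
  define d where "d = 1 / real (Suc n)"
  define I where "I = (\<integral>t. f t \<partial>clock \<rho>)"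
  have d: "0 < d" "d \<le> 1" "real (Suc n) * d = 1" by (auto simp: d_def)
  have I: "0 \<le> I" unfolding I_def
    by (rule integral_nonneg_AE) (use AE_clock_nonneg in \<open>eventually_elim, use nn in auto\<close>)
  have "(\<integral>t. indicator {d..} t * f t \<partial>clock \<rho>) \<le> I"
    unfolding I_def
  proof (rule integral_mono_AE)
    show "AE t in clock \<rho>. indicator {d..} t * f t \<le> f t"
      using AE_clock_nonneg by eventually_elim (use nn in \<open>auto simp: indicator_def\<close>)
  qed (use f integrable_mult_indicator[of "{d..}" "clock \<rho>" f] in auto)
  then have "(\<integral>t. f (t + d) \<partial>clock \<rho>) \<le> exp (\<rho> * d) * I"
    using clock_shift(2)[OF \<rho> _ f, of d] d by simp
  moreover have "exp (\<rho> * d) - 1 \<le> \<rho> * d * exp (\<rho> * d)"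
  proof -
    have "(1 - \<rho> * d) * exp (\<rho> * d) \<le> exp (- (\<rho> * d)) * exp (\<rho> * d)"
      using exp_ge_add_one_self[of "- (\<rho> * d)"] by (intro mult_right_mono) auto
    then show ?thesis by (simp add: algebra_simps flip: exp_add)
  qed
  moreover have "exp (\<rho> * d) \<le> exp \<rho>" using \<rho> d by (simp add: mult_left_le)
  ultimately have "(\<integral>t. f (t + d) \<partial>clock \<rho>) - I \<le> \<rho> * d * exp \<rho> * I"
  proof -
    assume a: "(\<integral>t. f (t + d) \<partial>clock \<rho>) \<le> exp (\<rho> * d) * I"
      and b: "exp (\<rho> * d) - 1 \<le> \<rho> * d * exp (\<rho> * d)" and c: "exp (\<rho> * d) \<le> exp \<rho>"
    have "exp (\<rho> * d) - 1 \<le> \<rho> * d * exp \<rho>"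
      using b c \<rho> d by (smt (verit) mult_left_mono mult_nonneg_nonneg)
    then have "(exp (\<rho> * d) - 1) * I \<le> \<rho> * d * exp \<rho> * I" using I by (rule mult_right_mono)
    then show ?thesis using a by (simp add: algebra_simps)
  qed
  then have "real (Suc n) * ((\<integral>t. f (t + d) \<partial>clock \<rho>) - I) \<le> real (Suc n) * (\<rho> * d * exp \<rho> * I)"
    by (rule mult_left_mono) simp
  also have "\<dots> = (real (Suc n) * d) * (\<rho> * exp \<rho> * I)" by (simp only: ac_simps)
  finally show ?thesis using d(3) by (simp add: d_def I_def)
qed

section \<open>The lower bound for an arbitrary control\<close>

context barrier_value
begin

lemma V1_mono: "x \<le> y \<Longrightarrow> V1 x \<le> V1 y"
  by (rule DERIV_nonneg_imp_nondecreasing) (use V1_deriv V2_nonneg in blast)+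

lemma V1_bound: "\<bar>V1 z\<bar> \<le> k / 2"
  using V1_mono[of z "max z c"] V1_mono[of "min z (- c)" z] V1_right[of "max z c"] V1_left[of "min z (- c)"]
  by (simp add: abs_le_iff)

lemma V_lip: "\<bar>V x - V y\<bar> \<le> k / 2 * \<bar>x - y\<bar>"
  by (rule DERIV_bounded_imp_lipschitz[OF V_deriv V1_bound])

lemma V1_lip: "\<bar>V1 x - V1 y\<bar> \<le> B * \<bar>x - y\<bar>"
  by (rule DERIV_bounded_imp_lipschitz[OF V1_deriv]) (use V2_nonneg V2_upper in \<open>simp add: abs_le_iff order_trans[of _ 0]\<close>)

lemma V_measurable [measurable]: "V \<in> borel_measurable borel" "V1 \<in> borel_measurable borel"
  "V2 \<in> borel_measurable borel"
proof -
  show "V \<in> borel_measurable borel" "V1 \<in> borel_measurable borel"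
    using DERIV_continuous_on[of UNIV V V1] V_deriv DERIV_continuous_on[of UNIV V1 V2] V1_deriv
    by (simp_all add: borel_measurable_continuous_onI)
  have "0 \<le> L" using V2_lip[of 1 0] by simp
  then have "L-lipschitz_on UNIV V2"
    by (intro lipschitz_onI) (use V2_lip in \<open>auto simp: dist_real_def\<close>)
  then show "V2 \<in> borel_measurable borel"
    by (intro borel_measurable_continuous_onI lipschitz_on_continuous_on)
qed

end

text \<open>A gap that starts at \<open>z\<close> and is moved by a control \<open>A\<close>. All that is retained of the control is a
  process \<open>S\<close> that dominates its variation, so that all admissible pairs of controls of the two
  players are covered.\<close>

locale controlled_difference = barrier_value +
  fixes M :: "'a measure" and F :: "real \<Rightarrow> 'a measure" and w A S :: "real \<Rightarrow> 'a \<Rightarrow> real" and z :: real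
  assumes bm: "brownian_motion M F w"
    and A_adapted: "\<And>t. 0 \<le> t \<Longrightarrow> A t \<in> borel_measurable (F t)"
    and A_joint [measurable]: "(\<lambda>(t, \<omega>). A t \<omega>) \<in> borel_measurable (borel \<Otimes>\<^sub>M M)"
    and S_joint [measurable]: "(\<lambda>(t, \<omega>). S t \<omega>) \<in> borel_measurable (borel \<Otimes>\<^sub>M M)"
    and S_dominates: "\<And>r t \<omega>. \<omega> \<in> space M \<Longrightarrow> 0 \<le> r \<Longrightarrow> r \<le> t \<Longrightarrow> \<bar>A t \<omega> - A r \<omega>\<bar> \<le> S t \<omega> - S r \<omega>"
    and S_dominates_0: "\<And>\<omega>. \<omega> \<in> space M \<Longrightarrow> \<bar>A 0 \<omega>\<bar> \<le> S 0 \<omega>"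
    and effort_finite: "(\<integral>\<^sup>+p. ennreal (S (fst p) (snd p)) \<partial>(clock \<rho> \<Otimes>\<^sub>M M)) < \<infinity>"
begin

sublocale M: prob_space M by (rule brownian_motionD[OF bm])
sublocale clock: prob_space "clock \<rho>" by (rule prob_space_clock[OF \<rho>_pos])
sublocale pair_prob_space "clock \<rho>" M ..

abbreviation "Q \<equiv> clock \<rho> \<Otimes>\<^sub>M M"

definition Z :: "real \<Rightarrow> 'a \<Rightarrow> real" where "Z t \<omega> = z + s * w (max 0 t) \<omega> + A t \<omega>"

definition increment :: "real \<Rightarrow> real \<Rightarrow> 'a \<Rightarrow> real" where
  "increment t d \<omega> = s * (w (max 0 (t + d)) \<omega> - w (max 0 t) \<omega>)"

text \<open>The cost of the control between \<open>t\<close> and \<open>t + d\<close> minus the reduction of the value that it achieves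
  at the end of the step.\<close>

definition slack :: "real \<Rightarrow> real \<Rightarrow> 'a \<Rightarrow> real" where
  "slack t d \<omega> = (V (Z (t + d) \<omega>) + k / 2 * S (t + d) \<omega>)
     - (V (Z t \<omega> + increment t d \<omega>) + k / 2 * S t \<omega>)"

lemma w_joint [measurable]: "(\<lambda>(t, \<omega>). w (max 0 t) \<omega>) \<in> borel_measurable (borel \<Otimes>\<^sub>M M)"
  by (rule brownian_jointly_measurable[OF bm])

lemma Z_joint [measurable]: "(\<lambda>(t, \<omega>). Z t \<omega>) \<in> borel_measurable (borel \<Otimes>\<^sub>M M)"
  unfolding Z_def by measurable

lemma section_measurable [measurable]: "A t \<in> borel_measurable M" "S t \<in> borel_measurable M"
    "Z t \<in> borel_measurable M" "w (max 0 t) \<in> borel_measurable M"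
  using measurable_compose[OF measurable_Pair1' A_joint, of t] measurable_compose[OF measurable_Pair1' S_joint, of t]
    measurable_compose[OF measurable_Pair1' Z_joint, of t] measurable_compose[OF measurable_Pair1' w_joint, of t]
  by simp_all

lemma slack_joint [measurable]: "(\<lambda>(t, \<omega>). slack t d \<omega>) \<in> borel_measurable (borel \<Otimes>\<^sub>M M)"
proof -
  have shift: "(\<lambda>(t, \<omega>). (t + d, \<omega>)) \<in> (borel \<Otimes>\<^sub>M M) \<rightarrow>\<^sub>M (borel \<Otimes>\<^sub>M M)" by measurable
  have [measurable]: "(\<lambda>(t, \<omega>). Z (t + d) \<omega>) \<in> borel_measurable (borel \<Otimes>\<^sub>M M)"
    "(\<lambda>(t, \<omega>). S (t + d) \<omega>) \<in> borel_measurable (borel \<Otimes>\<^sub>M M)"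
    "(\<lambda>(t, \<omega>). w (max 0 (t + d)) \<omega>) \<in> borel_measurable (borel \<Otimes>\<^sub>M M)"
    using measurable_compose[OF shift Z_joint] measurable_compose[OF shift S_joint]
      measurable_compose[OF shift w_joint] by (simp_all add: case_prod_beta')
  show ?thesis unfolding slack_def increment_def by measurable
qed

lemma S_mono: "\<omega> \<in> space M \<Longrightarrow> 0 \<le> r \<Longrightarrow> r \<le> t \<Longrightarrow> S r \<omega> \<le> S t \<omega>"
  using S_dominates[of \<omega> r t] by linarith

lemma A_le_S: "\<omega> \<in> space M \<Longrightarrow> 0 \<le> t \<Longrightarrow> \<bar>A t \<omega>\<bar> \<le> S t \<omega>"
  using S_dominates[of \<omega> 0 t] S_dominates_0[of \<omega>] by linarith

lemma S_nonneg: "\<omega> \<in> space M \<Longrightarrow> 0 \<le> t \<Longrightarrow> 0 \<le> S t \<omega>"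
  using A_le_S[of \<omega> t] by linarith

lemma AE_Q: "AE p in Q. 0 \<le> fst p \<and> snd p \<in> space M"
proof (rule AE_conjI)
  show "AE p in Q. 0 \<le> fst p"
  proof (rule AE_pair_measure)
    show "{p \<in> space Q. 0 \<le> fst p} \<in> sets Q" by measurable
    show "AE t in clock \<rho>. AE \<omega> in M. 0 \<le> fst (t, \<omega>)"
      using AE_clock_nonneg by eventually_elim simp
  qed
  show "AE p in Q. snd p \<in> space M" by (rule AE_I2) (auto simp: space_pair_measure)
qed

lemma slack_bounds:
  assumes \<omega>: "\<omega> \<in> space M" and t: "0 \<le> t" "0 \<le> d"
  shows "0 \<le> slack t d \<omega>" "slack t d \<omega> \<le> k * (S (t + d) \<omega> - S t \<omega>)"
proof -
  have "Z (t + d) \<omega> - (Z t \<omega> + increment t d \<omega>) = A (t + d) \<omega> - A t \<omega>"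
    unfolding Z_def increment_def by (simp add: algebra_simps)
  then have "\<bar>V (Z (t + d) \<omega>) - V (Z t \<omega> + increment t d \<omega>)\<bar> \<le> k / 2 * \<bar>A (t + d) \<omega> - A t \<omega>\<bar>"
    using V_lip by metis
  also have "\<dots> \<le> k / 2 * (S (t + d) \<omega> - S t \<omega>)"
    using S_dominates[OF \<omega>, of t "t + d"] t k_pos by (intro mult_left_mono) auto
  finally show "0 \<le> slack t d \<omega>" "slack t d \<omega> \<le> k * (S (t + d) \<omega> - S t \<omega>)"
    unfolding slack_def right_diff_distrib by linarith+
qed

lemma S_integrable_Q: "integrable Q (\<lambda>(t, \<omega>). S t \<omega>)"
proof (rule integrableI_nonneg)
  show "AE p in Q. 0 \<le> (case p of (t, \<omega>) \<Rightarrow> S t \<omega>)"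
    using AE_Q by eventually_elim (auto simp: S_nonneg)
qed (use effort_finite in \<open>auto simp: case_prod_beta'\<close>)

text \<open>The average over the exponential time is finite, hence \<open>S r\<close> is integrable for arbitrarily large
  \<open>r\<close>, and \<open>S\<close> is monotone.\<close>

lemma S_integrable: "0 \<le> t \<Longrightarrow> integrable M (S t)"
proof -
  assume t: "0 \<le> t"
  have "AE r in clock \<rho>. integrable M (S r)" using AE_integrable_fst[OF S_integrable_Q] by simp
  moreover have "\<not> (AE r in clock \<rho>. r < t)"
  proof
    assume a: "AE r in clock \<rho>. r < t"
    have "exp (\<rho> * t) * (\<integral>r. indicator {t..} r \<partial>clock \<rho>) = (1::real)"
      using clock_shift(2)[OF \<rho>_pos t, of "\<lambda>_. 1"] clock.prob_space by simp
    moreover have "(\<integral>r. indicator {t..} r \<partial>clock \<rho>) = (\<integral>r. 0 \<partial>clock \<rho> :: real)"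
      by (rule integral_cong_AE) (use a in \<open>auto simp: indicator_def\<close>)
    ultimately show False by simp
  qed
  ultimately have "\<exists>r\<ge>t. integrable M (S r)"
  proof (rule_tac ccontr)
    assume ae: "AE r in clock \<rho>. integrable M (S r)" and n: "\<not> (AE r in clock \<rho>. r < t)"
      and none: "\<not> (\<exists>r\<ge>t. integrable M (S r))"
    have "AE r in clock \<rho>. r < t" using ae by eventually_elim (metis none not_le)
    then show False using n by simp
  qed
  then obtain r where r: "integrable M (S r)" "t \<le> r" by blast
  show "integrable M (S t)"
  proof (rule Bochner_Integration.integrable_bound[OF r(1)])
    show "AE \<omega> in M. norm (S t \<omega>) \<le> norm (S r \<omega>)"
      using S_nonneg[OF _ t] S_mono[OF _ t r(2)] by (intro AE_I2) fastforce
  qed simp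
qed

lemma V_growth: "\<omega> \<in> space M \<Longrightarrow> 0 \<le> t \<Longrightarrow> V (Z t \<omega>) \<le> V z + k / 2 * (s * \<bar>w t \<omega>\<bar> + S t \<omega>)"
proof -
  assume \<omega>: "\<omega> \<in> space M" and t: "0 \<le> t"
  have "\<bar>V (Z t \<omega>) - V z\<bar> \<le> k / 2 * \<bar>Z t \<omega> - z\<bar>" by (rule V_lip)
  also have "\<bar>Z t \<omega> - z\<bar> \<le> s * \<bar>w t \<omega>\<bar> + S t \<omega>"
    using A_le_S[OF \<omega> t] t s_pos abs_triangle_ineq[of "s * w t \<omega>" "A t \<omega>"] by (simp add: Z_def abs_mult)
  finally have "\<bar>V (Z t \<omega>) - V z\<bar> \<le> k / 2 * (s * \<bar>w t \<omega>\<bar> + S t \<omega>)"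
    using k_pos by (simp add: mult_left_mono)
  then show ?thesis by linarith
qed

lemma V_Z_integrable: "0 \<le> t \<Longrightarrow> integrable M (\<lambda>\<omega>. V (Z t \<omega>))"
proof -
  assume t: "0 \<le> t"
  show ?thesis
  proof (rule Bochner_Integration.integrable_bound)
    show "integrable M (\<lambda>\<omega>. V z + k / 2 * (s * \<bar>w t \<omega>\<bar> + S t \<omega>))"
      using brownian_abs_moment_bounds(3)[OF bm t] S_integrable[OF t] by auto
    show "AE \<omega> in M. norm (V (Z t \<omega>)) \<le> norm (V z + k / 2 * (s * \<bar>w t \<omega>\<bar> + S t \<omega>))"
      using V_growth[OF _ t] V_nonneg by (intro AE_I2) (fastforce simp: abs_le_iff intro: order_trans[OF _ abs_ge_self])
  qed measurable
qed

lemma V1_Z_integrable: "integrable M (\<lambda>\<omega>. V1 (Z t \<omega>))"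
  by (rule M.integrable_const_bound[of _ "k / 2"]) (use V1_bound in auto)

lemma V2_abs: "\<bar>V2 y\<bar> \<le> B" using V2_nonneg[of y] V2_upper[of y] by simp

lemma V2_Z_integrable: "integrable M (\<lambda>\<omega>. V2 (Z t \<omega>))"
  by (rule M.integrable_const_bound[of _ B]) (use V2_abs in auto)

lemma Z_adapted: "0 \<le> t \<Longrightarrow> Z t \<in> borel_measurable (F t)"
  unfolding Z_def using A_adapted[of t] brownian_motionD(4)[OF bm, of t] by simp

text \<open>The expected value plus the cost of the effort spent so far.\<close>

definition G :: "real \<Rightarrow> real" where "G t = (\<integral>\<omega>. V (Z t \<omega>) + k / 2 * S t \<omega> \<partial>M)"

text \<open>The expected drift of \<open>V (Z t)\<close> that is due to the Brownian motion alone.\<close>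

definition q :: "real \<Rightarrow> real" where "q t = s\<^sup>2 / 2 * (\<integral>\<omega>. V2 (Z t \<omega>) \<partial>M)"

lemma G_measurable [measurable]: "G \<in> borel_measurable borel" unfolding G_def by measurable
lemma q_measurable [measurable]: "q \<in> borel_measurable borel" unfolding q_def by measurable

lemma slack_integrable:
  assumes "0 \<le> t" "0 < d"
  shows "integrable M (slack t d)"
proof (rule Bochner_Integration.integrable_bound)
  show "integrable M (\<lambda>\<omega>. k * (S (t + d) \<omega> - S t \<omega>))"
    using S_integrable[of t] S_integrable[of "t + d"] assms by auto
  show "AE \<omega> in M. norm (slack t d \<omega>) \<le> norm (k * (S (t + d) \<omega> - S t \<omega>))"
    using slack_bounds[of _ t d] assms by (intro AE_I2) fastforce
  show "slack t d \<in> borel_measurable M"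
    using measurable_compose[OF measurable_Pair1' slack_joint, of t] by simp
qed

lemma G_increment:
  assumes t: "0 \<le> t" and d: "0 < d"
  shows "\<bar>G (t + d) - (G t + d * q t + (\<integral>\<omega>. slack t d \<omega> \<partial>M))\<bar> \<le> L * s ^ 3 * (d * sqrt d)"
proof -
  have inc: "increment t d \<omega> = s * (w (t + d) \<omega> - w t \<omega>)" for \<omega>
    using t d by (simp add: increment_def)
  note step = brownian_step_expansion[OF bm t d less_imp_le[OF s_pos] Z_adapted[OF t] V_deriv V1_deriv V2_lip
      V_Z_integrable[OF t] V1_Z_integrable V2_Z_integrable, folded inc]
  have td: "0 \<le> t + d" using t d by simp
  have "G (t + d) - (\<integral>\<omega>. slack t d \<omega> \<partial>M) = (\<integral>\<omega>. V (Z (t + d) \<omega>) + k / 2 * S (t + d) \<omega> - slack t d \<omega> \<partial>M)"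
    unfolding G_def using V_Z_integrable[OF td] S_integrable[OF td] slack_integrable[OF t d] by simp
  also have "\<dots> = (\<integral>\<omega>. V (Z t \<omega> + increment t d \<omega>) + k / 2 * S t \<omega> \<partial>M)"
    by (rule Bochner_Integration.integral_cong) (auto simp: slack_def)
  also have "\<dots> = (\<integral>\<omega>. V (Z t \<omega> + increment t d \<omega>) \<partial>M) + k / 2 * (\<integral>\<omega>. S t \<omega> \<partial>M)"
    using step(1) S_integrable[OF t] by simp
  finally have "G (t + d) - (\<integral>\<omega>. slack t d \<omega> \<partial>M)
      = (\<integral>\<omega>. V (Z t \<omega> + increment t d \<omega>) \<partial>M) + k / 2 * (\<integral>\<omega>. S t \<omega> \<partial>M)" .
  moreover have "G t = (\<integral>\<omega>. V (Z t \<omega>) \<partial>M) + k / 2 * (\<integral>\<omega>. S t \<omega> \<partial>M)"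
    unfolding G_def using V_Z_integrable[OF t] S_integrable[OF t] by simp
  ultimately show ?thesis using step(2) unfolding q_def by (simp add: abs_le_iff)
qed

lemma V_Z_integrable_Q: "integrable Q (\<lambda>(t, \<omega>). V (Z t \<omega>))"
proof (rule Fubini_integrable)
  show "AE t in clock \<rho>. integrable M (\<lambda>\<omega>. case (t, \<omega>) of (t, \<omega>) \<Rightarrow> V (Z t \<omega>))"
    using AE_clock_nonneg by eventually_elim (simp add: V_Z_integrable)
  show "integrable (clock \<rho>) (\<lambda>t. \<integral>\<omega>. norm (case (t, \<omega>) of (t, \<omega>) \<Rightarrow> V (Z t \<omega>)) \<partial>M)"
  proof (rule Bochner_Integration.integrable_bound)
    show "integrable (clock \<rho>) (\<lambda>t. V z + k / 2 * (s * (1 + t ^ 1) + (\<integral>\<omega>. S t \<omega> \<partial>M)))"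
      using integrable_fst[OF S_integrable_Q] integrable_clock_power[OF \<rho>_pos, of 1] by auto
    show "AE t in clock \<rho>. norm (\<integral>\<omega>. norm (case (t, \<omega>) of (t, \<omega>) \<Rightarrow> V (Z t \<omega>)) \<partial>M)
        \<le> norm (V z + k / 2 * (s * (1 + t ^ 1) + (\<integral>\<omega>. S t \<omega> \<partial>M)))"
      using AE_clock_nonneg
    proof eventually_elim
      fix t :: real assume t: "0 \<le> t"
      have "(\<integral>\<omega>. V (Z t \<omega>) \<partial>M) \<le> (\<integral>\<omega>. V z + k / 2 * (s * \<bar>w t \<omega>\<bar> + S t \<omega>) \<partial>M)"
        by (rule integral_mono) (use V_Z_integrable[OF t] brownian_abs_moment_bounds(3)[OF bm t] S_integrable[OF t] V_growth t in auto)
      also have "\<dots> = V z + k / 2 * (s * (\<integral>\<omega>. \<bar>w t \<omega>\<bar> \<partial>M) + (\<integral>\<omega>. S t \<omega> \<partial>M))"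
        using brownian_abs_moment_bounds(3)[OF bm t] S_integrable[OF t] M.prob_space by simp
      also have "\<dots> \<le> V z + k / 2 * (s * (1 + t ^ 1) + (\<integral>\<omega>. S t \<omega> \<partial>M))"
        using brownian_abs_moment_bounds(4)[OF bm t] sqrt_le_1_plus[OF t] s_pos k_pos
        by (intro add_left_mono mult_left_mono add_right_mono) auto
      finally show "norm (\<integral>\<omega>. norm (case (t, \<omega>) of (t, \<omega>) \<Rightarrow> V (Z t \<omega>)) \<partial>M)
          \<le> norm (V z + k / 2 * (s * (1 + t ^ 1) + (\<integral>\<omega>. S t \<omega> \<partial>M)))"
        using V_nonneg by (simp add: abs_le_iff integral_nonneg)
    qed
  qed measurable
qed measurable

lemma V2_Z_integrable_Q: "integrable Q (\<lambda>(t, \<omega>). V2 (Z t \<omega>))"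
  by (rule integrable_const_bound[of _ B]) (use V2_abs in auto)

lemma G_integrable: "integrable (clock \<rho>) G"
  and G_integral: "(\<integral>t. G t \<partial>clock \<rho>) = (\<integral>(t, \<omega>). V (Z t \<omega>) + k / 2 * S t \<omega> \<partial>Q)"
proof -
  have i: "integrable Q (\<lambda>(t, \<omega>). V (Z t \<omega>) + k / 2 * S t \<omega>)"
    using Bochner_Integration.integrable_add[OF V_Z_integrable_Q integrable_mult_right[OF S_integrable_Q, of "k / 2"]]
    by (simp add: case_prod_beta')
  show "integrable (clock \<rho>) G" "(\<integral>t. G t \<partial>clock \<rho>) = (\<integral>(t, \<omega>). V (Z t \<omega>) + k / 2 * S t \<omega> \<partial>Q)"
    using integrable_fst[OF i] integral_fst[OF i] unfolding G_def by auto
qed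

lemma q_integrable: "integrable (clock \<rho>) q"
  and q_integral: "(\<integral>t. q t \<partial>clock \<rho>) = s\<^sup>2 / 2 * (\<integral>(t, \<omega>). V2 (Z t \<omega>) \<partial>Q)"
  using integrable_fst[OF V2_Z_integrable_Q] integral_fst[OF V2_Z_integrable_Q]
  unfolding q_def by auto

text \<open>Inside the barriers the integrand is \<open>h / \<rho> + k/2 S\<close>, the averaged cost.\<close>

lemma value_functional:
  "(\<integral>t. G t \<partial>clock \<rho>) - (\<integral>t. q t \<partial>clock \<rho>) / \<rho>
    = (\<integral>(t, \<omega>). (\<rho> * V (Z t \<omega>) - s\<^sup>2 / 2 * V2 (Z t \<omega>)) / \<rho> + k / 2 * S t \<omega> \<partial>Q)"
proof -
  note i = V_Z_integrable_Q[unfolded case_prod_beta'] V2_Z_integrable_Q[unfolded case_prod_beta']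
    S_integrable_Q[unfolded case_prod_beta']
  have "(\<integral>p. (\<rho> * V (Z (fst p) (snd p)) - s\<^sup>2 / 2 * V2 (Z (fst p) (snd p))) / \<rho> + k / 2 * S (fst p) (snd p) \<partial>Q)
     = (\<integral>p. (V (Z (fst p) (snd p)) + k / 2 * S (fst p) (snd p)) - (s\<^sup>2 / 2 / \<rho>) * V2 (Z (fst p) (snd p)) \<partial>Q)"
    by (rule Bochner_Integration.integral_cong) (use \<rho>_pos in \<open>auto simp: field_simps\<close>)
  also have "\<dots> = (\<integral>p. V (Z (fst p) (snd p)) + k / 2 * S (fst p) (snd p) \<partial>Q)
      - (s\<^sup>2 / 2 / \<rho>) * (\<integral>p. V2 (Z (fst p) (snd p)) \<partial>Q)"
    using i by simp
  finally show ?thesis unfolding G_integral q_integral by (simp add: case_prod_beta')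
qed

lemma value_functional_integrable:
  "integrable Q (\<lambda>(t, \<omega>). (\<rho> * V (Z t \<omega>) - s\<^sup>2 / 2 * V2 (Z t \<omega>)) / \<rho> + k / 2 * S t \<omega>)"
  using V_Z_integrable_Q V2_Z_integrable_Q S_integrable_Q by (simp add: case_prod_beta')

definition mean_slack :: "nat \<Rightarrow> real" where
  "mean_slack n = real (Suc n) * (\<integral>(t, \<omega>). slack t (1 / real (Suc n)) \<omega> \<partial>Q)"

lemma slack_integrable_Q:
  assumes d: "0 \<le> d"
  shows "integrable Q (\<lambda>(t, \<omega>). slack t d \<omega>)"
proof (rule Fubini_integrable)
  show "(\<lambda>(t, \<omega>). slack t d \<omega>) \<in> borel_measurable Q" by measurable
  show "AE t in clock \<rho>. integrable M (\<lambda>\<omega>. case (t, \<omega>) of (t, \<omega>) \<Rightarrow> slack t d \<omega>)"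
  proof (cases "d = 0")
    case True
    show ?thesis using AE_clock_nonneg by eventually_elim (simp add: slack_def increment_def True)
  next
    case False
    then have "0 < d" using d by simp
    show ?thesis using AE_clock_nonneg by eventually_elim (simp add: slack_integrable \<open>0 < d\<close>)
  qed
  define \<sigma> where "\<sigma> t = (\<integral>\<omega>. S t \<omega> \<partial>M)" for t
  have \<sigma>: "integrable (clock \<rho>) \<sigma>" using integrable_fst[OF S_integrable_Q] by (simp add: \<sigma>_def[abs_def])
  show "integrable (clock \<rho>) (\<lambda>t. \<integral>\<omega>. norm (case (t, \<omega>) of (t, \<omega>) \<Rightarrow> slack t d \<omega>) \<partial>M)"
  proof (rule Bochner_Integration.integrable_bound)
    show "integrable (clock \<rho>) (\<lambda>t. k * (\<sigma> (t + d) - \<sigma> t))"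
      using clock_shift(1)[OF \<rho>_pos d \<sigma>] \<sigma> by auto
    show "AE t in clock \<rho>. norm (\<integral>\<omega>. norm (case (t, \<omega>) of (t, \<omega>) \<Rightarrow> slack t d \<omega>) \<partial>M) \<le> norm (k * (\<sigma> (t + d) - \<sigma> t))"
      using AE_clock_nonneg
    proof eventually_elim
      fix t :: real assume t: "0 \<le> t"
      have "(\<integral>\<omega>. \<bar>slack t d \<omega>\<bar> \<partial>M) \<le> (\<integral>\<omega>. k * (S (t + d) \<omega> - S t \<omega>) \<partial>M)"
      proof (rule Bochner_Integration.integral_mono')
        show "integrable M (\<lambda>\<omega>. k * (S (t + d) \<omega> - S t \<omega>))" using S_integrable[of t] S_integrable[of "t + d"] t d by auto
        show "\<bar>slack t d \<omega>\<bar> \<le> k * (S (t + d) \<omega> - S t \<omega>)" if "\<omega> \<in> space M" for \<omega>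
          using slack_bounds[OF that t d] by simp
        show "0 \<le> k * (S (t + d) \<omega> - S t \<omega>)" if "\<omega> \<in> space M" for \<omega>
          using slack_bounds[OF that t d] by simp
      qed
      also have "\<dots> = k * (\<sigma> (t + d) - \<sigma> t)"
        unfolding \<sigma>_def using S_integrable[of t] S_integrable[of "t + d"] t d by simp
      finally show "norm (\<integral>\<omega>. norm (case (t, \<omega>) of (t, \<omega>) \<Rightarrow> slack t d \<omega>) \<partial>M) \<le> norm (k * (\<sigma> (t + d) - \<sigma> t))"
        by (simp add: abs_le_iff integral_nonneg)
    qed
  qed measurable
qed

lemma G_clock_increment:
  "\<bar>real (Suc n) * ((\<integral>t. G (t + 1 / real (Suc n)) \<partial>clock \<rho>) - (\<integral>t. G t \<partial>clock \<rho>))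
     - ((\<integral>t. q t \<partial>clock \<rho>) + mean_slack n)\<bar> \<le> L * s ^ 3 * sqrt (1 / real (Suc n))"
proof -
  define d where "d = 1 / real (Suc n)"
  have d: "0 < d" by (simp add: d_def)
  note int = slack_integrable_Q[OF less_imp_le[OF d]]
  have "mean_slack n = real (Suc n) * (\<integral>t. (\<integral>\<omega>. slack t d \<omega> \<partial>M) \<partial>clock \<rho>)"
    unfolding mean_slack_def d_def[symmetric] by (simp add: integral_fst[OF int])
  then show ?thesis
    using clock_increment_expansion[OF \<rho>_pos G_integrable q_integrable integrable_fst[OF int] G_increment[OF _ d] d_def]
    unfolding d_def by simp
qed

lemma mean_slack_nonneg: "0 \<le> mean_slack n"
proof -
  have "0 \<le> (\<integral>p. slack (fst p) (1 / real (Suc n)) (snd p) \<partial>Q)"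
    by (rule integral_nonneg_AE) (use AE_Q in \<open>eventually_elim, auto intro: slack_bounds\<close>)
  then show ?thesis unfolding mean_slack_def by (simp add: case_prod_beta')
qed

text \<open>Effort can decrease \<open>V\<close> by at most \<open>k/2\<close> per unit, including an initial jump at time 0; what remains is
  the fluctuation of the Brownian motion.\<close>

lemma G_lower:
  assumes t: "0 \<le> t"
  shows "V z - k / 2 * s * sqrt t \<le> G t"
proof -
  have "V z - k / 2 * s * sqrt t \<le> V z - k / 2 * s * (\<integral>\<omega>. \<bar>w t \<omega>\<bar> \<partial>M)"
    using brownian_abs_moment_bounds(4)[OF bm t] k_pos s_pos by (intro diff_left_mono mult_left_mono) auto
  also have "\<dots> = (\<integral>\<omega>. V z - k / 2 * s * \<bar>w t \<omega>\<bar> \<partial>M)"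
    using brownian_abs_moment_bounds(3)[OF bm t] M.prob_space by simp
  also have "\<dots> \<le> G t"
    unfolding G_def
  proof (rule integral_mono)
    fix \<omega> assume \<omega>: "\<omega> \<in> space M"
    have "V z - V (Z t \<omega>) \<le> k / 2 * \<bar>z - Z t \<omega>\<bar>" using V_lip[of z "Z t \<omega>"] by linarith
    also have "\<bar>z - Z t \<omega>\<bar> \<le> s * \<bar>w t \<omega>\<bar> + S t \<omega>"
      using A_le_S[OF \<omega> t] t s_pos abs_triangle_ineq[of "s * w t \<omega>" "A t \<omega>"] by (simp add: Z_def abs_mult)
    finally show "V z - k / 2 * s * \<bar>w t \<omega>\<bar> \<le> V (Z t \<omega>) + k / 2 * S t \<omega>"
      using k_pos by (simp add: mult_left_mono algebra_simps)
  qed (use brownian_abs_moment_bounds(3)[OF bm t] V_Z_integrable[OF t] S_integrable[OF t] in auto)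
  finally show ?thesis .
qed

text \<open>The averaged slack is nonnegative, so the drift of \<open>G\<close> is at least \<open>q\<close>.\<close>

theorem value_lower_bound:
  "ennreal (V z) \<le> (\<integral>\<^sup>+p. ennreal (h (Z (fst p) (snd p)) / \<rho> + k / 2 * S (fst p) (snd p)) \<partial>Q)"
proof -
  have "V z \<le> (\<integral>t. G t \<partial>clock \<rho>) - (\<integral>t. q t \<partial>clock \<rho>) / \<rho>"
  proof (rule clock_generator_bound[OF \<rho>_pos G_integrable _ _ sqrt_inverse_Suc_tendsto_0])
    fix n
    show "(\<integral>t. q t \<partial>clock \<rho>) - L * s ^ 3 * sqrt (1 / real (Suc n))
      \<le> real (Suc n) * ((\<integral>t. G (t + 1 / real (Suc n)) \<partial>clock \<rho>) - (\<integral>t. G t \<partial>clock \<rho>))"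
      using G_clock_increment[of n] mean_slack_nonneg[of n] by linarith
  next
    fix \<epsilon> :: real assume \<epsilon>: "0 < \<epsilon>"
    define d where "d = (\<epsilon> / (k / 2 * s))\<^sup>2"
    have ks: "0 < k / 2 * s" using k_pos s_pos by simp
    have d: "0 < d" unfolding d_def using \<epsilon> ks by (intro zero_less_power divide_pos_pos)
    show "\<exists>d>0. \<forall>t. 0 \<le> t \<and> t < d \<longrightarrow> V z - \<epsilon> \<le> G t"
    proof (intro exI[of _ d] conjI d allI impI)
      fix t assume t: "0 \<le> t \<and> t < d"
      have "sqrt t \<le> \<epsilon> / (k / 2 * s)"
        using t \<epsilon> ks by (intro real_le_lsqrt) (auto simp: d_def intro: divide_nonneg_nonneg)
      then have "k / 2 * s * sqrt t \<le> \<epsilon>" using ks by (simp add: pos_le_divide_eq mult.commute)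
      then show "V z - \<epsilon> \<le> G t" using G_lower[of t] t by simp
    qed
  qed
  also have "\<dots> = (\<integral>p. (\<rho> * V (Z (fst p) (snd p)) - s\<^sup>2 / 2 * V2 (Z (fst p) (snd p))) / \<rho> + k / 2 * S (fst p) (snd p) \<partial>Q)"
    unfolding value_functional by (simp add: case_prod_beta')
  finally have "ennreal (V z) \<le> ennreal (\<integral>p. (\<rho> * V (Z (fst p) (snd p)) - s\<^sup>2 / 2 * V2 (Z (fst p) (snd p))) / \<rho> + k / 2 * S (fst p) (snd p) \<partial>Q)"
    by (rule ennreal_leI)
  also have "\<dots> \<le> (\<integral>\<^sup>+p. ennreal ((\<rho> * V (Z (fst p) (snd p)) - s\<^sup>2 / 2 * V2 (Z (fst p) (snd p))) / \<rho> + k / 2 * S (fst p) (snd p)) \<partial>Q)"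
  proof -
    note vi = value_functional_integrable[unfolded case_prod_beta']
    have "ennreal (\<integral>p. (\<rho> * V (Z (fst p) (snd p)) - s\<^sup>2 / 2 * V2 (Z (fst p) (snd p))) / \<rho> + k / 2 * S (fst p) (snd p) \<partial>Q)
        \<le> ennreal (\<integral>p. max 0 ((\<rho> * V (Z (fst p) (snd p)) - s\<^sup>2 / 2 * V2 (Z (fst p) (snd p))) / \<rho> + k / 2 * S (fst p) (snd p)) \<partial>Q)"
      using vi by (intro ennreal_leI integral_mono integrable_max) auto
    also have "\<dots> = (\<integral>\<^sup>+p. ennreal (max 0 ((\<rho> * V (Z (fst p) (snd p)) - s\<^sup>2 / 2 * V2 (Z (fst p) (snd p))) / \<rho> + k / 2 * S (fst p) (snd p))) \<partial>Q)"
      using vi by (intro nn_integral_eq_integral[symmetric] integrable_max) auto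
    finally show ?thesis by simp
  qed
  also have "\<dots> \<le> (\<integral>\<^sup>+p. ennreal (h (Z (fst p) (snd p)) / \<rho> + k / 2 * S (fst p) (snd p)) \<partial>Q)"
    by (intro nn_integral_mono ennreal_leI add_right_mono divide_right_mono HJB) (use \<rho>_pos in simp)
  finally show ?thesis .
qed

end

section \<open>Controls with negligible slack\<close>

context controlled_difference
begin

lemma S_path_measurable: "\<omega> \<in> space M \<Longrightarrow> (\<lambda>t. S t \<omega>) \<in> borel_measurable borel"
  using measurable_compose[OF measurable_Pair2' S_joint, of \<omega>] by simp

lemma slack_path_measurable: "\<omega> \<in> space M \<Longrightarrow> (\<lambda>t. slack t d \<omega>) \<in> borel_measurable borel"
  using measurable_compose[OF measurable_Pair2' slack_joint, of \<omega>] by simp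

text \<open>Applied with large \<open>T\<close>, this makes the contribution of late times to the averaged slack small,
  uniformly in the step size.\<close>

lemma effort_rate_after:
  assumes \<omega>: "\<omega> \<in> space M" and int: "integrable (clock \<rho>) (\<lambda>t. S t \<omega>)"
  shows "integrable (clock \<rho>) (\<lambda>t. indicator {T<..} t * (S (t + 1 / real (Suc n)) \<omega> - S t \<omega>))"
    and "real (Suc n) * (\<integral>t. indicator {T<..} t * (S (t + 1 / real (Suc n)) \<omega> - S t \<omega>) \<partial>clock \<rho>)
      \<le> \<rho> * exp \<rho> * (\<integral>t. indicator {T<..} t * S t \<omega> \<partial>clock \<rho>)"
proof -
  define d where "d = 1 / real (Suc n)"
  have d: "0 < d" by (simp add: d_def)
  define f where "f t = indicator {T<..} t * S t \<omega>" for t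
  have f: "integrable (clock \<rho>) f"
    unfolding f_def using integrable_mult_indicator[OF _ int, of "{T<..}"] by simp
  have f_nn: "0 \<le> f t" if "0 \<le> t" for t using S_nonneg[OF \<omega> that] by (simp add: f_def)
  note shifted = clock_shift(1)[OF \<rho>_pos less_imp_le[OF d]]
  show i: "integrable (clock \<rho>) (\<lambda>t. indicator {T<..} t * (S (t + d) \<omega> - S t \<omega>))"
    using integrable_mult_indicator[OF _ Bochner_Integration.integrable_diff[OF shifted[OF int] int], of "{T<..}"] by simp
  have "(\<integral>t. indicator {T<..} t * (S (t + d) \<omega> - S t \<omega>) \<partial>clock \<rho>) \<le> (\<integral>t. f (t + d) - f t \<partial>clock \<rho>)"
  proof (rule integral_mono_AE)
    show "AE t in clock \<rho>. indicator {T<..} t * (S (t + d) \<omega> - S t \<omega>) \<le> f (t + d) - f t"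
      using AE_clock_nonneg
    proof eventually_elim
      fix t :: real assume "0 \<le> t"
      then show "indicator {T<..} t * (S (t + d) \<omega> - S t \<omega>) \<le> f (t + d) - f t"
        using f_nn[of "t + d"] d by (auto simp: f_def split: split_indicator)
    qed
  qed (use i shifted[OF f] f in auto)
  also have "\<dots> = (\<integral>t. f (t + d) \<partial>clock \<rho>) - (\<integral>t. f t \<partial>clock \<rho>)"
    using shifted[OF f] f by simp
  finally have "real (Suc n) * (\<integral>t. indicator {T<..} t * (S (t + d) \<omega> - S t \<omega>) \<partial>clock \<rho>)
      \<le> real (Suc n) * ((\<integral>t. f (t + d) \<partial>clock \<rho>) - (\<integral>t. f t \<partial>clock \<rho>))"
    by (rule mult_left_mono) simp
  also have "\<dots> \<le> \<rho> * exp \<rho> * (\<integral>t. f t \<partial>clock \<rho>)"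
    unfolding d_def by (rule clock_increment_bound[OF \<rho>_pos f f_nn])
  finally show "real (Suc n) * (\<integral>t. indicator {T<..} t * (S (t + d) \<omega> - S t \<omega>) \<partial>clock \<rho>)
      \<le> \<rho> * exp \<rho> * (\<integral>t. indicator {T<..} t * S t \<omega> \<partial>clock \<rho>)" unfolding f_def .
qed

lemma effort_rate:
  assumes \<omega>: "\<omega> \<in> space M" and int: "integrable (clock \<rho>) (\<lambda>t. S t \<omega>)"
  shows "integrable (clock \<rho>) (\<lambda>t. S (t + 1 / real (Suc n)) \<omega> - S t \<omega>)"
    and "real (Suc n) * (\<integral>t. S (t + 1 / real (Suc n)) \<omega> - S t \<omega> \<partial>clock \<rho>)
      \<le> \<rho> * exp \<rho> * (\<integral>t. S t \<omega> \<partial>clock \<rho>)"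
proof -
  define d where "d = 1 / real (Suc n)"
  have d: "0 \<le> d" by (simp add: d_def)
  note shifted = clock_shift(1)[OF \<rho>_pos d int]
  show "integrable (clock \<rho>) (\<lambda>t. S (t + d) \<omega> - S t \<omega>)" using shifted int by simp
  show "real (Suc n) * (\<integral>t. S (t + d) \<omega> - S t \<omega> \<partial>clock \<rho>) \<le> \<rho> * exp \<rho> * (\<integral>t. S t \<omega> \<partial>clock \<rho>)"
    using clock_increment_bound[OF \<rho>_pos int S_nonneg[OF \<omega>], of n] shifted int by (simp add: d_def)
qed

lemma path_slack_bounds:
  assumes \<omega>: "\<omega> \<in> space M" and int: "integrable (clock \<rho>) (\<lambda>t. S t \<omega>)"
  shows "integrable (clock \<rho>) (\<lambda>t. slack t (1 / real (Suc n)) \<omega>)"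
    and "0 \<le> real (Suc n) * (\<integral>t. slack t (1 / real (Suc n)) \<omega> \<partial>clock \<rho>)"
    and "real (Suc n) * (\<integral>t. slack t (1 / real (Suc n)) \<omega> \<partial>clock \<rho>) \<le> k * (\<rho> * exp \<rho> * (\<integral>t. S t \<omega> \<partial>clock \<rho>))"
proof -
  define d where "d = 1 / real (Suc n)"
  have d: "0 \<le> d" by (simp add: d_def)
  note rate = effort_rate[OF \<omega> int, of n, folded d_def]
  have bounds: "AE t in clock \<rho>. 0 \<le> slack t d \<omega> \<and> slack t d \<omega> \<le> k * (S (t + d) \<omega> - S t \<omega>)"
    using AE_clock_nonneg by eventually_elim (use slack_bounds[OF \<omega> _ d] in auto)
  show i: "integrable (clock \<rho>) (\<lambda>t. slack t d \<omega>)"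
  proof (rule Bochner_Integration.integrable_bound)
    show "integrable (clock \<rho>) (\<lambda>t. k * (S (t + d) \<omega> - S t \<omega>))" using rate(1) by simp
    show "AE t in clock \<rho>. norm (slack t d \<omega>) \<le> norm (k * (S (t + d) \<omega> - S t \<omega>))"
      using bounds by eventually_elim auto
  qed (use slack_path_measurable[OF \<omega>] in simp)
  have "0 \<le> (\<integral>t. slack t d \<omega> \<partial>clock \<rho>)"
    by (rule integral_nonneg_AE) (use bounds in \<open>eventually_elim, auto\<close>)
  then show "0 \<le> real (Suc n) * (\<integral>t. slack t d \<omega> \<partial>clock \<rho>)" by simp
  have "(\<integral>t. slack t d \<omega> \<partial>clock \<rho>) \<le> (\<integral>t. k * (S (t + d) \<omega> - S t \<omega>) \<partial>clock \<rho>)"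
    by (rule integral_mono_AE) (use i rate(1) bounds in \<open>auto elim: eventually_mono\<close>)
  also have "\<dots> = k * (\<integral>t. S (t + d) \<omega> - S t \<omega> \<partial>clock \<rho>)" using rate(1) by simp
  finally have "real (Suc n) * (\<integral>t. slack t d \<omega> \<partial>clock \<rho>) \<le> real (Suc n) * (k * (\<integral>t. S (t + d) \<omega> - S t \<omega> \<partial>clock \<rho>))"
    by (rule mult_left_mono) simp
  also have "\<dots> = k * (real (Suc n) * (\<integral>t. S (t + d) \<omega> - S t \<omega> \<partial>clock \<rho>))" by (simp only: ac_simps)
  also have "\<dots> \<le> k * (\<rho> * exp \<rho> * (\<integral>t. S t \<omega> \<partial>clock \<rho>))"
    using rate(2) k_pos by (intro mult_left_mono) auto
  finally show "real (Suc n) * (\<integral>t. slack t d \<omega> \<partial>clock \<rho>) \<le> k * (\<rho> * exp \<rho> * (\<integral>t. S t \<omega> \<partial>clock \<rho>))" .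
qed

text \<open>The slack of a step is eventually an arbitrarily small fraction of the effort spent in it,
  uniformly on bounded time intervals.\<close>

definition tame :: "'a \<Rightarrow> bool" where
  "tame \<omega> \<longleftrightarrow> (\<forall>T\<ge>0. \<forall>\<epsilon>>0. \<exists>\<delta>>0. \<forall>t d. 0 \<le> t \<and> t \<le> T \<and> 0 < d \<and> d < \<delta> \<longrightarrow>
     slack t d \<omega> \<le> \<epsilon> * (S (t + d) \<omega> - S t \<omega>))"

text \<open>Up to a large time \<open>m\<close> the slack is at most \<open>\<eta>\<close> times the effort, and later at most \<open>k\<close> times the
  effort; both contributions are bounded by averages of \<open>S\<close>.\<close>

lemma path_slack_tendsto_0:
  assumes \<omega>: "\<omega> \<in> space M" and int: "integrable (clock \<rho>) (\<lambda>t. S t \<omega>)" and tame: "tame \<omega>"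
  shows "(\<lambda>n. real (Suc n) * (\<integral>t. slack t (1 / real (Suc n)) \<omega> \<partial>clock \<rho>)) \<longlonglongrightarrow> 0"
proof (rule LIMSEQ_I)
  fix \<epsilon> :: real assume \<epsilon>: "0 < \<epsilon>"
  define J where "J = (\<integral>t. S t \<omega> \<partial>clock \<rho>)"
  have J: "0 \<le> J" unfolding J_def
    by (rule integral_nonneg_AE) (use AE_clock_nonneg in \<open>eventually_elim, use S_nonneg[OF \<omega>] in auto\<close>)
  define R where "R = \<rho> * exp \<rho>"
  have R: "0 < R" unfolding R_def using \<rho>_pos by simp
  have "(\<lambda>m. \<integral>t. indicator {real m<..} t * S t \<omega> \<partial>clock \<rho>) \<longlonglongrightarrow> (\<integral>t. 0 \<partial>clock \<rho>)"
  proof (rule integral_dominated_convergence)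
    show "integrable (clock \<rho>) (\<lambda>t. \<bar>S t \<omega>\<bar>)" using int by simp
    show "AE t in clock \<rho>. (\<lambda>m. indicator {real m<..} t * S t \<omega>) \<longlonglongrightarrow> 0"
    proof (rule AE_I2)
      fix t :: real
      obtain m0 :: nat where m0: "t \<le> real m0" using real_arch_simple by blast
      have "\<forall>\<^sub>F m in sequentially. indicator {real m<..} t * S t \<omega> = 0"
        using eventually_ge_at_top[of m0] by eventually_elim (use m0 in auto)
      then show "(\<lambda>m. indicator {real m<..} t * S t \<omega>) \<longlonglongrightarrow> 0" by (rule tendsto_eventually)
    qed
    show "AE t in clock \<rho>. norm (indicator {real m<..} t * S t \<omega>) \<le> \<bar>S t \<omega>\<bar>" for m
      by (rule AE_I2) (auto simp: indicator_def)
  qed (use S_path_measurable[OF \<omega>] in auto)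
  then have "\<forall>\<^sub>F m in sequentially. (\<integral>t. indicator {real m<..} t * S t \<omega> \<partial>clock \<rho>) < \<epsilon> / (2 * k * R)"
    using \<epsilon> k_pos R by (intro order_tendstoD(2)) auto
  then obtain m :: nat where m: "(\<integral>t. indicator {real m<..} t * S t \<omega> \<partial>clock \<rho>) < \<epsilon> / (2 * k * R)"
    by (auto simp: eventually_sequentially)
  (* J may be 0, hence the summand 1. *)
  define \<eta> where "\<eta> = \<epsilon> / (2 * R * (J + 1))"
  have \<eta>: "0 < \<eta>" unfolding \<eta>_def using \<epsilon> R J by simp
  obtain \<delta> where \<delta>: "0 < \<delta>" "\<And>t d. 0 \<le> t \<Longrightarrow> t \<le> real m \<Longrightarrow> 0 < d \<Longrightarrow> d < \<delta> \<Longrightarrow> slack t d \<omega> \<le> \<eta> * (S (t + d) \<omega> - S t \<omega>)"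
    using tame \<eta> unfolding tame_def by (metis of_nat_0_le_iff)
  have "\<forall>\<^sub>F n in sequentially. 1 / real (Suc n) < \<delta>"
    using LIMSEQ_Suc[OF lim_1_over_n] \<delta>(1) by (rule order_tendstoD(2))
  then obtain N where N: "\<And>n. N \<le> n \<Longrightarrow> 1 / real (Suc n) < \<delta>" by (auto simp: eventually_sequentially)
  show "\<exists>N. \<forall>n\<ge>N. norm (real (Suc n) * (\<integral>t. slack t (1 / real (Suc n)) \<omega> \<partial>clock \<rho>) - 0) < \<epsilon>"
  proof (intro exI allI impI)
    fix n assume n: "N \<le> n"
    define d where "d = 1 / real (Suc n)"
    have d: "0 < d" "d < \<delta>" using N[OF n] by (auto simp: d_def)
    note rate = effort_rate[OF \<omega> int, of n, folded d_def J_def R_def]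
    note rate_m = effort_rate_after[OF \<omega> int, where T = "real m" and n = n, folded d_def R_def]
    note ps = path_slack_bounds[OF \<omega> int, of n, folded d_def]
    have "(\<integral>t. slack t d \<omega> \<partial>clock \<rho>)
        \<le> (\<integral>t. \<eta> * (S (t + d) \<omega> - S t \<omega>) + k * (indicator {real m<..} t * (S (t + d) \<omega> - S t \<omega>)) \<partial>clock \<rho>)"
    proof (rule integral_mono_AE)
      show "AE t in clock \<rho>. slack t d \<omega> \<le> \<eta> * (S (t + d) \<omega> - S t \<omega>) + k * (indicator {real m<..} t * (S (t + d) \<omega> - S t \<omega>))"
        using AE_clock_nonneg
      proof eventually_elim
        fix t :: real assume t: "0 \<le> t"
        have "0 \<le> \<eta> * (S (t + d) \<omega> - S t \<omega>)" using S_mono[OF \<omega> t, of "t + d"] d \<eta> by simp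
        then show "slack t d \<omega> \<le> \<eta> * (S (t + d) \<omega> - S t \<omega>) + k * (indicator {real m<..} t * (S (t + d) \<omega> - S t \<omega>))"
          using \<delta>(2)[OF t _ d] slack_bounds(2)[OF \<omega> t, of d] d by (cases "t \<le> real m") auto
      qed
    qed (use ps(1) rate(1) rate_m(1) in auto)
    also have "\<dots> = \<eta> * (\<integral>t. S (t + d) \<omega> - S t \<omega> \<partial>clock \<rho>)
        + k * (\<integral>t. indicator {real m<..} t * (S (t + d) \<omega> - S t \<omega>) \<partial>clock \<rho>)"
      using rate(1) rate_m(1) by (simp only: Bochner_Integration.integral_add integrable_mult_right integral_mult_right_zero)
    finally have "real (Suc n) * (\<integral>t. slack t d \<omega> \<partial>clock \<rho>) \<le> real (Suc n) * (\<eta> * (\<integral>t. S (t + d) \<omega> - S t \<omega> \<partial>clock \<rho>)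
        + k * (\<integral>t. indicator {real m<..} t * (S (t + d) \<omega> - S t \<omega>) \<partial>clock \<rho>))"
      by (rule mult_left_mono) simp
    also have "\<dots> = \<eta> * (real (Suc n) * (\<integral>t. S (t + d) \<omega> - S t \<omega> \<partial>clock \<rho>))
        + k * (real (Suc n) * (\<integral>t. indicator {real m<..} t * (S (t + d) \<omega> - S t \<omega>) \<partial>clock \<rho>))"
      by (simp only: algebra_simps)
    also have "\<dots> \<le> \<eta> * (R * J) + k * (R * (\<integral>t. indicator {real m<..} t * S t \<omega> \<partial>clock \<rho>))"
      using rate(2) rate_m(2) \<eta> k_pos by (intro add_mono mult_left_mono) auto
    also have "\<dots> < \<epsilon>"
    proof -
      have "\<eta> * (R * J) \<le> \<epsilon> / 2"
      proof -
        have "\<eta> * (R * J) = \<epsilon> / 2 * (J / (J + 1))" unfolding \<eta>_def using R J by simp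
        also have "\<dots> \<le> \<epsilon> / 2" using \<epsilon> J by (intro mult_left_le) auto
        finally show ?thesis .
      qed
      moreover have "k * (R * (\<integral>t. indicator {real m<..} t * S t \<omega> \<partial>clock \<rho>)) < \<epsilon> / 2"
        using m k_pos R by (simp add: field_simps)
      ultimately show ?thesis by linarith
    qed
    finally show "norm (real (Suc n) * (\<integral>t. slack t (1 / real (Suc n)) \<omega> \<partial>clock \<rho>) - 0) < \<epsilon>"
      using ps(2) by (simp add: d_def)
  qed
qed

text \<open>Dominated convergence over the paths, with the bound from \<open>path_slack_bounds\<close>.\<close>

lemma mean_slack_tendsto_0:
  assumes tame: "AE \<omega> in M. tame \<omega>"
  shows "mean_slack \<longlonglongrightarrow> 0"
proof -
  have pint: "AE \<omega> in M. integrable (clock \<rho>) (\<lambda>t. S t \<omega>)"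
    using AE_integrable_snd[OF S_integrable_Q] by simp
  have space: "AE \<omega> in M. \<omega> \<in> space M" by (rule AE_I2)
  define f where "f n \<omega> = real (Suc n) * (\<integral>t. slack t (1 / real (Suc n)) \<omega> \<partial>clock \<rho>)" for n \<omega>
  have slack_int: "integrable Q (\<lambda>(t, \<omega>). slack t (1 / real (Suc n)) \<omega>)" for n
    by (rule slack_integrable_Q) simp
  have f_int: "integrable M (f n)" and mean: "mean_slack n = (\<integral>\<omega>. f n \<omega> \<partial>M)" for n
    using integrable_snd[OF slack_int[of n]] integral_snd[OF slack_int[of n]]
    unfolding f_def mean_slack_def by simp_all
  have "(\<lambda>n. \<integral>\<omega>. f n \<omega> \<partial>M) \<longlonglongrightarrow> (\<integral>\<omega>. 0 \<partial>M)"
  proof (rule integral_dominated_convergence)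
    show "integrable M (\<lambda>\<omega>. k * (\<rho> * exp \<rho> * (\<integral>t. S t \<omega> \<partial>clock \<rho>)))"
      using integrable_snd[OF S_integrable_Q] by simp
    show "AE \<omega> in M. (\<lambda>n. f n \<omega>) \<longlonglongrightarrow> 0"
      using pint space tame unfolding f_def by eventually_elim (rule path_slack_tendsto_0)
    show "AE \<omega> in M. norm (f n \<omega>) \<le> k * (\<rho> * exp \<rho> * (\<integral>t. S t \<omega> \<partial>clock \<rho>))" for n
      using pint space
    proof eventually_elim
      fix \<omega> assume "integrable (clock \<rho>) (\<lambda>t. S t \<omega>)" "\<omega> \<in> space M"
      then show "norm (f n \<omega>) \<le> k * (\<rho> * exp \<rho> * (\<integral>t. S t \<omega> \<partial>clock \<rho>))"
        using path_slack_bounds(2,3)[of \<omega> n] unfolding f_def by simp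
    qed
  qed (use f_int in auto)
  moreover have "mean_slack = (\<lambda>n. \<integral>\<omega>. f n \<omega> \<partial>M)" using mean by auto
  ultimately show ?thesis by simp
qed

lemma G_upper_start:
  assumes right: "AE \<omega> in M. (\<lambda>n. S (1 / real (Suc n)) \<omega>) \<longlonglongrightarrow> S 0 \<omega>"
    and \<epsilon>: "0 < \<epsilon>"
  shows "\<exists>d>0. \<forall>t. 0 \<le> t \<and> t < d \<longrightarrow> G t \<le> G 0 + \<epsilon>"
proof -
  define m where "m t = (\<integral>\<omega>. S t \<omega> \<partial>M)" for t
  have m_mono: "m r \<le> m t" if "0 \<le> r" "r \<le> t" for r t
    unfolding m_def by (rule integral_mono) (use S_integrable S_mono that in auto)
  have "(\<lambda>n. \<integral>\<omega>. S (1 / real (Suc n)) \<omega> \<partial>M) \<longlonglongrightarrow> (\<integral>\<omega>. S 0 \<omega> \<partial>M)"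
  proof (rule integral_dominated_convergence)
    show "integrable M (S 1)" by (rule S_integrable) simp
    show "AE \<omega> in M. norm (S (1 / real (Suc n)) \<omega>) \<le> S 1 \<omega>" for n
      using S_nonneg[of _ "1 / real (Suc n)"] S_mono[of _ "1 / real (Suc n)" 1] by (intro AE_I2) simp
  qed (use right in auto)
  then have "\<forall>\<^sub>F n in sequentially. m (1 / real (Suc n)) < m 0 + \<epsilon> / (2 * k)"
    unfolding m_def using \<epsilon> k_pos by (intro order_tendstoD(2)) auto
  then obtain n where n: "m (1 / real (Suc n)) < m 0 + \<epsilon> / (2 * k)" by (auto simp: eventually_sequentially)
  have "((\<lambda>t. t * q 0 + L * s ^ 3 * (t * sqrt t)) \<longlongrightarrow> 0 * q 0 + L * s ^ 3 * (0 * sqrt 0)) (at 0)"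
    by (intro tendsto_intros)
  then have "\<forall>\<^sub>F t in at 0. t * q 0 + L * s ^ 3 * (t * sqrt t) < \<epsilon> / 2"
    using \<epsilon> by (intro order_tendstoD(2)) auto
  then obtain d where d: "0 < d" "\<And>t. t \<noteq> 0 \<Longrightarrow> dist t 0 < d \<Longrightarrow> t * q 0 + L * s ^ 3 * (t * sqrt t) < \<epsilon> / 2"
    unfolding eventually_at by auto
  show ?thesis
  proof (intro exI[of _ "min d (1 / real (Suc n))"] conjI allI impI)
    fix t assume t: "0 \<le> t \<and> t < min d (1 / real (Suc n))"
    show "G t \<le> G 0 + \<epsilon>"
    proof (cases "t = 0")
      case False
      then have p: "0 < t" using t by simp
      have "(\<integral>\<omega>. slack 0 t \<omega> \<partial>M) \<le> (\<integral>\<omega>. k * (S t \<omega> - S 0 \<omega>) \<partial>M)"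
        by (rule integral_mono) (use slack_integrable[of 0 t] S_integrable[of 0] S_integrable[of t] slack_bounds(2)[of _ 0 t] p in auto)
      also have "\<dots> = k * (m t - m 0)"
        unfolding m_def using S_integrable[of 0] S_integrable[of t] p by simp
      also have "\<dots> \<le> \<epsilon> / 2"
      proof -
        have "m t - m 0 \<le> \<epsilon> / (2 * k)"
          using m_mono[of t "1 / real (Suc n)"] n t p by linarith
        then have "k * (m t - m 0) \<le> k * (\<epsilon> / (2 * k))" using k_pos by (intro mult_left_mono) auto
        then show ?thesis using k_pos by simp
      qed
      finally have "(\<integral>\<omega>. slack 0 t \<omega> \<partial>M) \<le> \<epsilon> / 2" .
      then show ?thesis using G_increment[OF order_refl p] d(2)[of t] t p by simp
    qed (use \<epsilon> in simp)
  qed (use d in simp)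
qed

text \<open>With negligible slack the drift of \<open>G\<close> is exactly \<open>q\<close> in the limit, and inside the barriers the
  variational inequality is an equality.\<close>

theorem value_upper_bound:
  assumes inside: "AE \<omega> in M. \<forall>t\<ge>0. \<bar>Z t \<omega>\<bar> \<le> c"
    and tame: "AE \<omega> in M. tame \<omega>"
    and right: "AE \<omega> in M. (\<lambda>n. S (1 / real (Suc n)) \<omega>) \<longlonglongrightarrow> S 0 \<omega>"
    and initial: "AE \<omega> in M. V (Z 0 \<omega>) + k / 2 * S 0 \<omega> = V z"
  shows "(\<integral>\<^sup>+p. ennreal (h (Z (fst p) (snd p)) / \<rho> + k / 2 * S (fst p) (snd p)) \<partial>Q) \<le> ennreal (V z)"
proof -
  have G0: "G 0 = V z"
  proof -
    have "G 0 = (\<integral>\<omega>. V z \<partial>M)"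
      unfolding G_def by (rule integral_cong_AE) (use initial in auto)
    then show ?thesis using M.prob_space by simp
  qed
  have le: "(\<integral>t. G t \<partial>clock \<rho>) - (\<integral>t. q t \<partial>clock \<rho>) / \<rho> \<le> V z"
  proof (rule clock_generator_upper_bound[OF \<rho>_pos G_integrable])
    show "\<exists>d>0. \<forall>t. 0 \<le> t \<and> t < d \<longrightarrow> G t \<le> V z + \<epsilon>" if "0 < \<epsilon>" for \<epsilon>
      using G_upper_start[OF right that] G0 by simp
    show "real (Suc n) * ((\<integral>t. G (t + 1 / real (Suc n)) \<partial>clock \<rho>) - (\<integral>t. G t \<partial>clock \<rho>))
      \<le> (\<integral>t. q t \<partial>clock \<rho>) + (L * s ^ 3 * sqrt (1 / real (Suc n)) + mean_slack n)" for n
      using G_clock_increment[of n] by linarith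
    show "(\<lambda>n. L * s ^ 3 * sqrt (1 / real (Suc n)) + mean_slack n) \<longlonglongrightarrow> 0"
      using tendsto_add[OF sqrt_inverse_Suc_tendsto_0 mean_slack_tendsto_0[OF tame]] by simp
  qed
  have AE_inside: "AE p in Q. \<bar>Z (fst p) (snd p)\<bar> \<le> c"
  proof (rule AE_pair_measure)
    have [measurable]: "(\<lambda>p. Z (fst p) (snd p)) \<in> borel_measurable Q"
      using Z_joint by (simp add: case_prod_beta' cong: measurable_cong_sets)
    show "{p \<in> space Q. \<bar>Z (fst p) (snd p)\<bar> \<le> c} \<in> sets Q" by measurable
    show "AE t in clock \<rho>. AE \<omega> in M. \<bar>Z (fst (t, \<omega>)) (snd (t, \<omega>))\<bar> \<le> c"
      using AE_clock_nonneg
    proof eventually_elim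
      fix t :: real assume "0 \<le> t"
      then show "AE \<omega> in M. \<bar>Z (fst (t, \<omega>)) (snd (t, \<omega>))\<bar> \<le> c"
        using inside by (auto elim: eventually_mono)
    qed
  qed
  define f where "f p = (\<rho> * V (Z (fst p) (snd p)) - s\<^sup>2 / 2 * V2 (Z (fst p) (snd p))) / \<rho> + k / 2 * S (fst p) (snd p)" for p
  have f_int: "integrable Q f" unfolding f_def using value_functional_integrable by (simp add: case_prod_beta')
  have "(\<integral>\<^sup>+p. ennreal (h (Z (fst p) (snd p)) / \<rho> + k / 2 * S (fst p) (snd p)) \<partial>Q) = (\<integral>\<^sup>+p. ennreal (f p) \<partial>Q)"
    by (rule nn_integral_cong_AE) (use AE_inside in \<open>eventually_elim, simp only: f_def ODE\<close>)
  also have "\<dots> = ennreal (\<integral>p. f p \<partial>Q)"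
  proof (rule nn_integral_eq_integral[OF f_int])
    show "AE p in Q. 0 \<le> f p"
      using AE_inside AE_Q
    proof eventually_elim
      fix p assume "\<bar>Z (fst p) (snd p)\<bar> \<le> c" "0 \<le> fst p \<and> snd p \<in> space M"
      then show "0 \<le> f p" unfolding f_def using h_nonneg \<rho>_pos k_pos by (subst ODE) (auto simp: S_nonneg)
    qed
  qed
  also have "\<dots> \<le> ennreal (V z)"
    using le unfolding value_functional f_def by (intro ennreal_leI) (simp add: case_prod_beta')
  finally show ?thesis .
qed

end

section \<open>Reflection of a path between two barriers\<close>

lemma running_max0_0: "running_max0 g 0 = max 0 (g 0)" by (simp add: running_max0_def)

lemma running_max0_nonneg: "0 \<le> running_max0 g t" by (simp add: running_max0_def)

lemma running_max0_upper:
  assumes "bdd_above (g ` {0..t})" "0 \<le> u" "u \<le> t"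
  shows "g u \<le> running_max0 g t"
  unfolding running_max0_def using cSUP_upper[OF _ assms(1), of u] assms(2,3) by auto

lemma running_max0_least:
  assumes "0 \<le> t" "0 \<le> y" "\<And>u. 0 \<le> u \<Longrightarrow> u \<le> t \<Longrightarrow> g u \<le> y"
  shows "running_max0 g t \<le> y"
  unfolding running_max0_def using assms by (intro max.boundedI cSUP_least) auto

lemma running_max0_attained_approx:
  assumes "0 \<le> t" "y < running_max0 g t" "0 \<le> y"
  obtains u where "0 \<le> u" "u \<le> t" "y < g u"
  using running_max0_least[of t y g] assms by (meson not_le)

lemma running_max0_mono_time:
  assumes "bdd_above (g ` {0..t})" "0 \<le> r" "r \<le> t"
  shows "running_max0 g r \<le> running_max0 g t"
  by (rule running_max0_least) (use assms running_max0_nonneg running_max0_upper[OF assms(1)] in auto)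

lemma continuous_bdd_above:
  fixes g :: "real \<Rightarrow> real"
  assumes "continuous_on {0..} g"
  shows "bdd_above (g ` {0..t})"
  by (intro bounded_imp_bdd_above compact_imp_bounded compact_continuous_image
      continuous_on_subset[OF assms]) auto

lemma continuous_on_path_small_oscillation:
  fixes g :: "real \<Rightarrow> real"
  assumes "continuous_on {0..} g" "0 < e"
  obtains d where "0 < d" "\<And>u v. 0 \<le> u \<Longrightarrow> u \<le> T \<Longrightarrow> 0 \<le> v \<Longrightarrow> v \<le> T \<Longrightarrow> \<bar>u - v\<bar> < d \<Longrightarrow> \<bar>g u - g v\<bar> \<le> e"
proof -
  have "uniformly_continuous_on {0..T} g"
    by (intro compact_uniformly_continuous continuous_on_subset[OF assms(1)]) auto
  then obtain d where "0 < d" "\<And>u v. u \<in> {0..T} \<Longrightarrow> v \<in> {0..T} \<Longrightarrow> dist u v < d \<Longrightarrow> dist (g u) (g v) < e"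
    unfolding uniformly_continuous_on_def using assms(2) by metis
  then show ?thesis by (intro that[of d]) (auto simp: dist_real_def less_imp_le)
qed

lemma running_max0_continuous:
  assumes g: "continuous_on {0..} g"
  shows "continuous_on {0..} (running_max0 g)"
  unfolding continuous_on_iff
proof (intro ballI allI impI)
  fix t e :: real assume t: "t \<in> {0..}" and e: "0 < e"
  have e2: "0 < e / 2" using e by simp
  obtain d where d: "0 < d" "\<And>u v. 0 \<le> u \<Longrightarrow> u \<le> t + 1 \<Longrightarrow> 0 \<le> v \<Longrightarrow> v \<le> t + 1 \<Longrightarrow> \<bar>u - v\<bar> < d \<Longrightarrow> \<bar>g u - g v\<bar> \<le> e / 2"
    using continuous_on_path_small_oscillation[OF g e2, of "t + 1"] by metis
  note bdd = continuous_bdd_above[OF g]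
  have step: "\<bar>running_max0 g v - running_max0 g r\<bar> \<le> e / 2"
    if r: "0 \<le> r" "r \<le> v" "v \<le> t + 1" "v - r < d" for r v
  proof -
    have "running_max0 g v \<le> running_max0 g r + e / 2"
    proof (rule running_max0_least)
      fix u assume u: "0 \<le> u" "u \<le> v"
      show "g u \<le> running_max0 g r + e / 2"
      proof (cases "u \<le> r")
        case True
        then show ?thesis using running_max0_upper[OF bdd u(1) True] e by simp
      next
        case False
        then have "\<bar>g u - g r\<bar> \<le> e / 2" using d(2)[of u r] u r by auto
        then have "g u \<le> g r + e / 2" by linarith
        then show ?thesis using running_max0_upper[OF bdd r(1) order_refl] by linarith
      qed
    qed (use r e running_max0_nonneg[of g r] in auto)
    then show ?thesis using running_max0_mono_time[OF bdd r(1,2)] by simp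
  qed
  show "\<exists>d>0. \<forall>x'\<in>{0..}. dist x' t < d \<longrightarrow> dist (running_max0 g x') (running_max0 g t) < e"
  proof (intro exI[of _ "min d 1"] conjI ballI impI)
    fix x' assume x': "x' \<in> {0..}" "dist x' t < min d 1"
    then have "\<bar>running_max0 g x' - running_max0 g t\<bar> \<le> e / 2"
      using step[of x' t] step[of t x'] t by (cases "x' \<le> t") (auto simp: dist_real_def abs_minus_commute)
    then show "dist (running_max0 g x') (running_max0 g t) < e" using e by (simp add: dist_real_def)
  qed (use d in simp)
qed

text \<open>The coupled equations of the reflecting policies for a single path \<open>f\<close> of the uncontrolled gap: \<open>a\<close>
  pushes down at \<open>c\<close>, \<open>b\<close> pushes up at \<open>-c\<close>.\<close>

definition reflects :: "real \<Rightarrow> (real \<Rightarrow> real) \<Rightarrow> (real \<Rightarrow> real) \<Rightarrow> (real \<Rightarrow> real) \<Rightarrow> bool" where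
  "reflects c f a b \<longleftrightarrow> (\<forall>t\<ge>0. a t = running_max0 (\<lambda>u. f u + b u - c) t \<and>
     b t = running_max0 (\<lambda>u. - f u + a u - c) t)"

lemma reflects_swap: "reflects c f a b \<Longrightarrow> reflects c (\<lambda>u. - f u) b a"
  unfolding reflects_def by simp

locale reflected_path =
  fixes c :: real and f a b :: "real \<Rightarrow> real"
  assumes c_pos: "0 < c" and f_cont: "continuous_on {0..} f"
    and a_mono: "\<And>r t. 0 \<le> r \<Longrightarrow> r \<le> t \<Longrightarrow> a r \<le> a t"
    and b_mono: "\<And>r t. 0 \<le> r \<Longrightarrow> r \<le> t \<Longrightarrow> b r \<le> b t"
    and system: "reflects c f a b"
begin

lemma swapped: "reflected_path c (\<lambda>u. - f u) b a"
  using c_pos f_cont a_mono b_mono system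
  by (intro reflected_path.intro reflects_swap) (auto intro!: continuous_intros)

lemma bdd: "bdd_above ((\<lambda>u. f u + b u - c) ` {0..t})"
proof -
  obtain y where "\<forall>x\<in>f ` {0..t}. x \<le> y"
    using continuous_bdd_above[OF f_cont, of t] unfolding bdd_above_def by blast
  then have y: "f u \<le> y" if "u \<in> {0..t}" for u using that by auto
  show ?thesis
    by (rule bdd_aboveI[of _ "y + b t - c"]) (use y b_mono in \<open>auto intro!: add_mono\<close>)
qed

lemma a_eq: "0 \<le> t \<Longrightarrow> a t = running_max0 (\<lambda>u. f u + b u - c) t"
  using system by (simp add: reflects_def)

lemma a_nonneg: "0 \<le> t \<Longrightarrow> 0 \<le> a t" using a_eq running_max0_nonneg by simp

lemma upper_barrier: "0 \<le> t \<Longrightarrow> f t + b t - a t \<le> c"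
  using running_max0_upper[OF bdd, of t t] a_eq[of t] by simp

lemma a_increases_at_barrier:
  assumes r: "0 \<le> r" "r \<le> t" and inc: "a r < a t" and \<epsilon>: "0 < \<epsilon>"
  obtains u where "r < u" "u \<le> t" "a t - \<epsilon> < f u + b u - c"
proof -
  have t: "0 \<le> t" using r by simp
  have "max (a r) (a t - \<epsilon>) < a t" using inc \<epsilon> by simp
  then obtain u where u: "0 \<le> u" "u \<le> t" "max (a r) (a t - \<epsilon>) < f u + b u - c"
    using running_max0_attained_approx[of t "max (a r) (a t - \<epsilon>)" "\<lambda>u. f u + b u - c"]
      a_eq[OF t] a_nonneg[OF r(1)] t by (metis le_max_iff_disj)
  have "r < u"
  proof (rule ccontr)
    assume "\<not> r < u"
    then have "f u + b u - c \<le> a r" using running_max0_upper[OF bdd u(1), of r] a_eq[OF r(1)] by simp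
    then show False using u(3) by simp
  qed
  then show ?thesis using u by (intro that) auto
qed

end

context reflected_path
begin

interpretation swap: reflected_path c "\<lambda>u. - f u" b a by (rule swapped)

lemma inside: "0 \<le> t \<Longrightarrow> \<bar>f t + b t - a t\<bar> \<le> c"
  using upper_barrier[of t] swap.upper_barrier[of t] by (simp add: abs_le_iff)

text \<open>If both increased, there would be times \<open>u\<close>, \<open>v\<close> in the interval with \<open>f u + b u - c\<close> close to \<open>a t\<close> and
  \<open>- f v + a v - c\<close> close to \<open>b t\<close>. Adding the two and using that \<open>a\<close> and \<open>b\<close> are nondecreasing gives
  \<open>2 c \<le> f u - f v\<close> up to a small error.\<close>

lemma not_both_increase:
  assumes r: "0 \<le> r" "r \<le> t" and osc: "\<And>u v. r \<le> u \<Longrightarrow> u \<le> t \<Longrightarrow> r \<le> v \<Longrightarrow> v \<le> t \<Longrightarrow> \<bar>f u - f v\<bar> \<le> \<eta>"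
    and \<eta>: "\<eta> < c"
  shows "a r = a t \<or> b r = b t"
proof (rule ccontr)
  assume "\<not> (a r = a t \<or> b r = b t)"
  then have inc: "a r < a t" "b r < b t" using a_mono[OF r] b_mono[OF r] by auto
  (* The suprema need not be attained; this margin suffices. *)
  define \<epsilon> where "\<epsilon> = (c - \<eta>) / 2"
  have \<epsilon>: "0 < \<epsilon>" using \<eta> by (simp add: \<epsilon>_def)
  obtain u where u: "r < u" "u \<le> t" "a t - \<epsilon> < f u + b u - c"
    using a_increases_at_barrier[OF r inc(1) \<epsilon>] by metis
  obtain v where v: "r < v" "v \<le> t" "b t - \<epsilon> < - f v + a v - c"
    using swap.a_increases_at_barrier[OF r inc(2) \<epsilon>] by metis
  have "b u \<le> b t" "a v \<le> a t" using b_mono[of u t] a_mono[of v t] u v r by auto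
  moreover have "f u - f v \<le> \<eta>" using osc[of u v] u v by linarith
  ultimately show False using u(3) v(3) \<eta> c_pos by (simp add: \<epsilon>_def field_simps)
qed

lemma increase_near_barrier:
  assumes r: "0 \<le> r" "r \<le> t" and osc: "\<And>u v. r \<le> u \<Longrightarrow> u \<le> t \<Longrightarrow> r \<le> v \<Longrightarrow> v \<le> t \<Longrightarrow> \<bar>f u - f v\<bar> \<le> \<eta>"
    and inc: "a r < a t"
  shows "c - \<eta> \<le> f t + b t - a t"
proof (rule field_le_epsilon)
  fix \<epsilon> :: real assume \<epsilon>: "0 < \<epsilon>"
  obtain u where u: "r < u" "u \<le> t" "a t - \<epsilon> < f u + b u - c"
    using a_increases_at_barrier[OF r inc \<epsilon>] by metis
  have "b u \<le> b t" using b_mono[of u t] u r by auto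
  moreover have "f u - f t \<le> \<eta>" using osc[of u t] u r by linarith
  ultimately show "c - \<eta> \<le> f t + b t - a t + \<epsilon>" using u(3) by linarith
qed

text \<open>Continuity of the solution after time 0 is a consequence of the equations: a push only
  compensates movements of \<open>f\<close>.\<close>

lemma increment_le_oscillation:
  assumes r: "0 \<le> r" "r \<le> t" and osc: "\<And>u v. r \<le> u \<Longrightarrow> u \<le> t \<Longrightarrow> r \<le> v \<Longrightarrow> v \<le> t \<Longrightarrow> \<bar>f u - f v\<bar> \<le> \<eta>"
    and \<eta>: "\<eta> < c"
  shows "a t - a r \<le> 2 * \<eta>"
proof (cases "a r = a t")
  case True
  then show ?thesis using osc[of r r] r by simp
next
  case False
  then have inc: "a r < a t" and b: "b r = b t"
    using a_mono[OF r] not_both_increase[OF r osc \<eta>] by auto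
  have "c - \<eta> \<le> f t + b t - a t" by (rule increase_near_barrier[OF r osc inc])
  moreover have "f r + b r - a r \<le> c" by (rule upper_barrier[OF r(1)])
  moreover have "f t - f r \<le> \<eta>" using osc[of t r] r by linarith
  ultimately show ?thesis using b by linarith
qed

lemma a_continuous: "continuous_on {0..} a"
  unfolding continuous_on_iff
proof (intro ballI allI impI)
  fix t e :: real assume t: "t \<in> {0..}" and e: "0 < e"
  define \<eta> where "\<eta> = min (c / 2) (e / 4)"
  have \<eta>: "0 < \<eta>" "\<eta> < c" "2 * \<eta> < e" using c_pos e by (auto simp: \<eta>_def)
  obtain d where d: "0 < d" "\<And>u v. 0 \<le> u \<Longrightarrow> u \<le> t + 1 \<Longrightarrow> 0 \<le> v \<Longrightarrow> v \<le> t + 1 \<Longrightarrow> \<bar>u - v\<bar> < d \<Longrightarrow> \<bar>f u - f v\<bar> \<le> \<eta>"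
    using continuous_on_path_small_oscillation[OF f_cont \<eta>(1), of "t + 1"] by metis
  have step: "\<bar>a v - a r\<bar> < e" if r: "0 \<le> r" "r \<le> v" "v \<le> t + 1" "v - r < d" for r v
  proof -
    have "a v - a r \<le> 2 * \<eta>" by (rule increment_le_oscillation[OF r(1,2) d(2) \<eta>(2)]) (use r in auto)
    then show ?thesis using a_mono[OF r(1,2)] \<eta> by simp
  qed
  show "\<exists>d>0. \<forall>x'\<in>{0..}. dist x' t < d \<longrightarrow> dist (a x') (a t) < e"
  proof (intro exI[of _ "min d 1"] conjI ballI impI)
    fix x' assume "x' \<in> {0..}" "dist x' t < min d 1"
    then show "dist (a x') (a t) < e"
      using step[of x' t] step[of t x'] t by (cases "x' \<le> t") (auto simp: dist_real_def abs_minus_commute)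
  qed (use d in simp)
qed

text \<open>At time 0 the equations are two coupled real equations; adding them shows that the two jumps
  cannot both be positive.\<close>

lemma initial_jump:
  shows "a 0 = max 0 (f 0 - c)" "b 0 = max 0 (- f 0 - c)"
  using a_eq[of 0] swap.a_eq[of 0] c_pos by (auto simp: running_max0_0 max_def split: if_splits)

end

lemma (in reflected_path) b_continuous: "continuous_on {0..} b"
  by (rule reflected_path.a_continuous[OF swapped])

lemma (in reflected_path) b_increase_near_barrier:
  assumes "0 \<le> r" "r \<le> t" "\<And>u v. r \<le> u \<Longrightarrow> u \<le> t \<Longrightarrow> r \<le> v \<Longrightarrow> v \<le> t \<Longrightarrow> \<bar>f u - f v\<bar> \<le> \<eta>" "b r < b t"
  shows "f t + b t - a t \<le> - (c - \<eta>)"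
  using reflected_path.increase_near_barrier[OF swapped assms(1,2) _ assms(4), of \<eta>] assms(3)
  by (force simp: abs_minus_commute)

text \<open>The monotone iteration of the coupled equations. By symmetry the upward push for \<open>f\<close> is the downward
  push for \<open>-f\<close>, so a single sequence suffices.\<close>

fun reflection_iterate :: "real \<Rightarrow> (real \<Rightarrow> real) \<Rightarrow> nat \<Rightarrow> real \<Rightarrow> real" where
  "reflection_iterate c f 0 = (\<lambda>t. 0)"
| "reflection_iterate c f (Suc n) = running_max0 (\<lambda>u. f u + reflection_iterate c (\<lambda>u. - f u) n u - c)"

definition push :: "real \<Rightarrow> (real \<Rightarrow> real) \<Rightarrow> real \<Rightarrow> real" where
  "push c f t = (if t < 0 then 0 else SUP n. reflection_iterate c f n t)"

lemma push_negative_time: "t < 0 \<Longrightarrow> push c f t = 0"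
  by (simp add: push_def)

lemma reflection_iterate_continuous:
  "continuous_on {0..} f \<Longrightarrow> continuous_on {0..} (reflection_iterate c f n)"
proof (induction n arbitrary: f)
  case (Suc n)
  have "continuous_on {0..} (reflection_iterate c (\<lambda>u. - f u) n)"
    by (intro Suc continuous_intros)
  with Suc.prems show ?case by (auto intro!: running_max0_continuous continuous_intros)
qed simp

lemma reflection_iterate_mono_time:
  assumes f: "continuous_on {0..} f" and r: "0 \<le> r" "r \<le> t"
  shows "reflection_iterate c f n r \<le> reflection_iterate c f n t"
proof (cases n)
  case (Suc m)
  have "bdd_above ((\<lambda>u. f u + reflection_iterate c (\<lambda>u. - f u) m u - c) ` {0..t})"
    by (intro continuous_bdd_above continuous_intros reflection_iterate_continuous f)
  then show ?thesis unfolding Suc by (simp add: running_max0_mono_time r)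
qed simp

text \<open>Nondecreasing \<open>a\<close>, \<open>b\<close> whose difference keeps the path within distance \<open>c\<close> of 0 up to time \<open>T\<close>,
  with no condition on where they increase.\<close>

definition tracks :: "real \<Rightarrow> (real \<Rightarrow> real) \<Rightarrow> real \<Rightarrow> (real \<Rightarrow> real) \<Rightarrow> (real \<Rightarrow> real) \<Rightarrow> bool" where
  "tracks c f T a b \<longleftrightarrow> (\<forall>r t. 0 \<le> r \<and> r \<le> t \<and> t \<le> T \<longrightarrow>
     0 \<le> a r \<and> a r \<le> a t \<and> 0 \<le> b r \<and> b r \<le> b t \<and> \<bar>f t + b t - a t\<bar> \<le> c)"

lemma tracks_swap: "tracks c f T a b \<Longrightarrow> tracks c (\<lambda>u. - f u) T b a"
proof -
  have flip: "\<bar>- f t + a t - b t\<bar> = \<bar>f t + b t - a t\<bar>" for t by (simp add: abs_if)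
  then show "tracks c f T a b \<Longrightarrow> tracks c (\<lambda>u. - f u) T b a" unfolding tracks_def flip by blast
qed

text \<open>Any tracking pair satisfies the coupled equations with inequality, so the iteration from 0 stays
  below it.\<close>

lemma reflection_iterate_minimal:
  "tracks c f T a b \<Longrightarrow> 0 \<le> t \<Longrightarrow> t \<le> T \<Longrightarrow> reflection_iterate c f n t \<le> a t"
proof (induction n arbitrary: f a b t)
  case 0
  then show ?case by (auto simp: tracks_def)
next
  case (Suc n)
  have "f u + reflection_iterate c (\<lambda>u. - f u) n u - c \<le> a t" if u: "0 \<le> u" "u \<le> t" for u
  proof -
    have "reflection_iterate c (\<lambda>u. - f u) n u \<le> b u"
      using Suc.IH[OF tracks_swap[OF Suc.prems(1)]] u Suc.prems by simp
    moreover have "f u + b u - a u \<le> c" "a u \<le> a t"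
      using Suc.prems(1)[unfolded tracks_def, rule_format, of u u]
        Suc.prems(1)[unfolded tracks_def, rule_format, of u t] Suc.prems(3) u by (auto simp: abs_le_iff)
    ultimately show ?thesis by linarith
  qed
  moreover have "0 \<le> a t" using Suc.prems unfolding tracks_def by auto
  ultimately show ?case using Suc.prems by (auto intro!: running_max0_least)
qed

text \<open>The path is sampled with step \<open>\<tau>\<close> and the sampled walk is projected to \<open>[-d, d]\<close> after each step.\<close>

fun euler_position :: "real \<Rightarrow> (real \<Rightarrow> real) \<Rightarrow> real \<Rightarrow> nat \<Rightarrow> real" where
  "euler_position d f \<tau> 0 = clip d (f 0)"
| "euler_position d f \<tau> (Suc k) =
     clip d (euler_position d f \<tau> k + (f (real (Suc k) * \<tau>) - f (real k * \<tau>)))"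

definition euler_shift :: "real \<Rightarrow> (real \<Rightarrow> real) \<Rightarrow> real \<Rightarrow> nat \<Rightarrow> real" where
  "euler_shift d f \<tau> k = euler_position d f \<tau> k - f (real k * \<tau>)"

fun euler_effort :: "real \<Rightarrow> (real \<Rightarrow> real) \<Rightarrow> real \<Rightarrow> nat \<Rightarrow> real" where
  "euler_effort d f \<tau> 0 = \<bar>euler_shift d f \<tau> 0\<bar>"
| "euler_effort d f \<tau> (Suc k) = euler_effort d f \<tau> k + \<bar>euler_shift d f \<tau> (Suc k) - euler_shift d f \<tau> k\<bar>"

lemma euler_position_range: "0 \<le> d \<Longrightarrow> \<bar>euler_position d f \<tau> k\<bar> \<le> d"
  by (cases k) (simp_all add: clip_range)

lemma euler_shift_le_effort: "\<bar>euler_shift d f \<tau> k\<bar> \<le> euler_effort d f \<tau> k"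
  by (induction k) auto

lemma euler_effort_nonneg: "0 \<le> euler_effort d f \<tau> k"
  using euler_shift_le_effort[of d f \<tau> k] by linarith

lemma euler_parts_mono:
  assumes "j \<le> k"
  shows "euler_effort d f \<tau> j - euler_shift d f \<tau> j \<le> euler_effort d f \<tau> k - euler_shift d f \<tau> k"
    and "euler_effort d f \<tau> j + euler_shift d f \<tau> j \<le> euler_effort d f \<tau> k + euler_shift d f \<tau> k"
  using lift_Suc_mono_le[of "\<lambda>k. euler_effort d f \<tau> k - euler_shift d f \<tau> k", OF _ assms]
    lift_Suc_mono_le[of "\<lambda>k. euler_effort d f \<tau> k + euler_shift d f \<tau> k", OF _ assms]
  by auto

text \<open>The walk is reflected at half the distance; the other half accommodates the movement of the path
  between two grid points.\<close>

lemma euler_tracks: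
  assumes c: "0 \<le> c" and \<tau>: "0 < \<tau>"
    and osc: "\<And>u v. 0 \<le> u \<Longrightarrow> u \<le> v \<Longrightarrow> v \<le> T \<Longrightarrow> v - u \<le> \<tau> \<Longrightarrow> \<bar>f v - f u\<bar> \<le> c / 2"
  defines "k \<equiv> \<lambda>t. nat \<lfloor>t / \<tau>\<rfloor>"
  shows "tracks c f T (\<lambda>t. (euler_effort (c / 2) f \<tau> (k t) - euler_shift (c / 2) f \<tau> (k t)) / 2)
    (\<lambda>t. (euler_effort (c / 2) f \<tau> (k t) + euler_shift (c / 2) f \<tau> (k t)) / 2)"
  unfolding tracks_def
proof (intro allI impI, elim conjE)
  fix r t :: real assume t: "0 \<le> r" "r \<le> t" "t \<le> T"
  have le_k: "k r \<le> k t"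
    unfolding k_def using t \<tau> by (intro nat_mono floor_mono divide_right_mono) auto
  have fl: "real (k t) = real_of_int \<lfloor>t / \<tau>\<rfloor>" unfolding k_def using t \<tau> by (simp add: of_nat_nat)
  have "real (k t) \<le> t / \<tau>" "t / \<tau> \<le> real (k t) + 1" unfolding fl by linarith+
  then have grid: "real (k t) * \<tau> \<le> t" "t - real (k t) * \<tau> \<le> \<tau>"
    using \<tau> by (simp_all add: field_simps)
  have "\<bar>f t - f (real (k t) * \<tau>)\<bar> \<le> c / 2" by (rule osc) (use grid t \<tau> in auto)
  moreover have "\<bar>euler_position (c / 2) f \<tau> (k t)\<bar> \<le> c / 2"
    by (rule euler_position_range) (use c in simp)
  moreover have "f t + euler_shift (c / 2) f \<tau> (k t)
      = euler_position (c / 2) f \<tau> (k t) + (f t - f (real (k t) * \<tau>))"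
    by (simp add: euler_shift_def)
  ultimately have "\<bar>f t + euler_shift (c / 2) f \<tau> (k t)\<bar> \<le> c" by linarith
  with euler_parts_mono[OF le_k, of "c / 2" f \<tau>] euler_shift_le_effort[of "c / 2" f \<tau> "k r"]
  show "0 \<le> (euler_effort (c / 2) f \<tau> (k r) - euler_shift (c / 2) f \<tau> (k r)) / 2 \<and>
    (euler_effort (c / 2) f \<tau> (k r) - euler_shift (c / 2) f \<tau> (k r)) / 2
      \<le> (euler_effort (c / 2) f \<tau> (k t) - euler_shift (c / 2) f \<tau> (k t)) / 2 \<and>
    0 \<le> (euler_effort (c / 2) f \<tau> (k r) + euler_shift (c / 2) f \<tau> (k r)) / 2 \<and>
    (euler_effort (c / 2) f \<tau> (k r) + euler_shift (c / 2) f \<tau> (k r)) / 2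
      \<le> (euler_effort (c / 2) f \<tau> (k t) + euler_shift (c / 2) f \<tau> (k t)) / 2 \<and>
    \<bar>f t + (euler_effort (c / 2) f \<tau> (k t) + euler_shift (c / 2) f \<tau> (k t)) / 2
      - (euler_effort (c / 2) f \<tau> (k t) - euler_shift (c / 2) f \<tau> (k t)) / 2\<bar> \<le> c"
    by (simp add: abs_le_iff field_simps)
qed

context
  fixes c :: real
  assumes c_pos: "0 < c"
begin

lemma reflection_iterate_bdd:
  assumes f: "continuous_on {0..} f" and t: "0 \<le> t"
  shows "bdd_above (range (\<lambda>n. reflection_iterate c f n t))"
proof -
  have c2: "0 < c / 2" using c_pos by simp
  obtain d where d: "0 < d" "\<And>u v. 0 \<le> u \<Longrightarrow> u \<le> t \<Longrightarrow> 0 \<le> v \<Longrightarrow> v \<le> t \<Longrightarrow> \<bar>u - v\<bar> < d \<Longrightarrow> \<bar>f u - f v\<bar> \<le> c / 2"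
    using continuous_on_path_small_oscillation[OF f c2, of t] by metis
  have osc: "\<bar>f v - f u\<bar> \<le> c / 2" if "0 \<le> u" "u \<le> v" "v \<le> t" "v - u \<le> d / 2" for u v
    using d(2)[of v u] that d(1) by auto
  have "0 \<le> c" "0 < d / 2" using c_pos d(1) by auto
  from reflection_iterate_minimal[OF euler_tracks[OF this osc] t order_refl]
  show ?thesis by (rule bdd_aboveI2)
qed

lemma push_upper: "continuous_on {0..} f \<Longrightarrow> 0 \<le> t \<Longrightarrow> reflection_iterate c f n t \<le> push c f t"
  unfolding push_def using cSUP_upper[OF UNIV_I reflection_iterate_bdd, of f t n] by simp

lemma push_least: "0 \<le> t \<Longrightarrow> (\<And>n. reflection_iterate c f n t \<le> y) \<Longrightarrow> push c f t \<le> y"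
  unfolding push_def by (simp add: cSUP_least)

lemma push_mono:
  assumes f: "continuous_on {0..} f" and r: "0 \<le> r" "r \<le> t"
  shows "push c f r \<le> push c f t"
  by (rule push_least[OF r(1)])
    (use reflection_iterate_mono_time[OF f r] push_upper[OF f, of t] r in \<open>auto intro: order_trans\<close>)

lemma push_nonneg: "continuous_on {0..} f \<Longrightarrow> 0 \<le> push c f t"
  using push_upper[of f t 0] by (cases "t < 0") (auto simp: push_negative_time)

text \<open>The running maximum commutes with the supremum of the iterates, so the limit of the iteration is a
  fixed point.\<close>

lemma push_eq_running_max0:
  assumes f: "continuous_on {0..} f" and t: "0 \<le> t"
  shows "push c f t = running_max0 (\<lambda>u. f u + push c (\<lambda>u. - f u) u - c) t"
proof (rule antisym)
  have f': "continuous_on {0..} (\<lambda>u. - f u)" using f by (intro continuous_intros)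
  obtain y where "\<forall>x\<in>f ` {0..t}. x \<le> y"
    using continuous_bdd_above[OF f, of t] unfolding bdd_above_def by blast
  then have y: "f u \<le> y" if "u \<in> {0..t}" for u using that by auto
  have bdd: "bdd_above ((\<lambda>u. f u + push c (\<lambda>u. - f u) u - c) ` {0..t})"
    by (rule bdd_aboveI[of _ "y + push c (\<lambda>u. - f u) t - c"])
      (use y push_mono[OF f'] in \<open>auto intro!: add_mono\<close>)
  show "push c f t \<le> running_max0 (\<lambda>u. f u + push c (\<lambda>u. - f u) u - c) t"
  proof (rule push_least[OF t])
    fix n
    show "reflection_iterate c f n t \<le> running_max0 (\<lambda>u. f u + push c (\<lambda>u. - f u) u - c) t"
    proof (cases n)
      case (Suc m)
      have "running_max0 (\<lambda>u. f u + reflection_iterate c (\<lambda>u. - f u) m u - c) t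
          \<le> running_max0 (\<lambda>u. f u + push c (\<lambda>u. - f u) u - c) t"
      proof (rule running_max0_least[OF t running_max0_nonneg])
        fix u assume u: "0 \<le> u" "u \<le> t"
        show "f u + reflection_iterate c (\<lambda>u. - f u) m u - c \<le> running_max0 (\<lambda>u. f u + push c (\<lambda>u. - f u) u - c) t"
          using running_max0_upper[OF bdd u] push_upper[OF f' u(1), of m] by linarith
      qed
      then show ?thesis by (simp add: Suc)
    qed (simp add: running_max0_nonneg)
  qed
  show "running_max0 (\<lambda>u. f u + push c (\<lambda>u. - f u) u - c) t \<le> push c f t"
  proof (rule running_max0_least[OF t push_nonneg[OF f]])
    fix u assume u: "0 \<le> u" "u \<le> t"
    have "push c (\<lambda>u. - f u) u \<le> push c f t + c - f u"
    proof (rule push_least[OF u(1)])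
      fix n
      have "bdd_above ((\<lambda>u. f u + reflection_iterate c (\<lambda>u. - f u) n u - c) ` {0..t})"
        by (intro continuous_bdd_above continuous_intros reflection_iterate_continuous f)
      from running_max0_upper[OF this u]
      show "reflection_iterate c (\<lambda>u. - f u) n u \<le> push c f t + c - f u"
        using push_upper[OF f t, of "Suc n"] by simp
    qed
    then show "f u + push c (\<lambda>u. - f u) u - c \<le> push c f t" by simp
  qed
qed

lemma push_reflects:
  assumes f: "continuous_on {0..} f"
  shows "reflects c f (push c f) (push c (\<lambda>u. - f u))"
proof -
  have "continuous_on {0..} (\<lambda>u. - f u)" using f by (intro continuous_intros)
  from push_eq_running_max0[OF f] push_eq_running_max0[OF this]
  show ?thesis by (simp add: reflects_def)
qed

lemma push_reflected_path:
  assumes f: "continuous_on {0..} f"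
  shows "reflected_path c f (push c f) (push c (\<lambda>u. - f u))"
  using c_pos f push_mono[OF f] push_mono[of "\<lambda>u. - f u"] push_reflects[OF f]
  by (intro reflected_path.intro) (auto intro!: continuous_intros)

lemma push_effort_below_euler:
  assumes f: "continuous_on {0..} f" and \<tau>: "0 < \<tau>" and T: "0 \<le> T"
    and osc: "\<And>u v. 0 \<le> u \<Longrightarrow> u \<le> v \<Longrightarrow> v \<le> T \<Longrightarrow> v - u \<le> \<tau> \<Longrightarrow> \<bar>f v - f u\<bar> \<le> c / 2"
  shows "push c f T + push c (\<lambda>u. - f u) T \<le> euler_effort (c / 2) f \<tau> (nat \<lfloor>T / \<tau>\<rfloor>)"
proof -
  let ?k = "nat \<lfloor>T / \<tau>\<rfloor>"
  note tracks = euler_tracks[OF less_imp_le[OF c_pos] \<tau> osc]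
  have "push c f T \<le> (euler_effort (c / 2) f \<tau> ?k - euler_shift (c / 2) f \<tau> ?k) / 2"
    by (rule push_least[OF T reflection_iterate_minimal[OF tracks T order_refl]])
  moreover have "push c (\<lambda>u. - f u) T \<le> (euler_effort (c / 2) f \<tau> ?k + euler_shift (c / 2) f \<tau> ?k) / 2"
    by (rule push_least[OF T reflection_iterate_minimal[OF tracks_swap[OF tracks] T order_refl]])
  ultimately show ?thesis by (simp add: field_simps)
qed

end

section \<open>Admissible processes\<close>

text \<open>The point 0 carries the initial jump, because the function vanishes before 0.\<close>

lemma interval_measure_Icc_from_0:
  assumes g: "cadlag g" "mono g" "\<And>t. t < 0 \<Longrightarrow> g t = 0" and t: "0 \<le> t"
  shows "emeasure (interval_measure g) {0..t} = ennreal (g t)"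
proof -
  have rc: "continuous (at_right x) g" for x using g(1) by (simp add: cadlag_def)
  have m: "x \<le> y \<Longrightarrow> g x \<le> g y" for x y using g(2) by (rule monoD)
  note Ioc = emeasure_interval_measure_Ioc[OF _ m rc]
  have "emeasure (interval_measure g) (\<Union>n. {-1<..- (1 / real (Suc n))}) = 0"
  proof (rule emeasure_UN_eq_0)
    show "emeasure (interval_measure g) {-1<..- (1 / real (Suc n))} = 0" for n
      using Ioc[of "-1" "- (1 / real (Suc n))"] g(3)[of "-1"] g(3)[of "- (1 / real (Suc n))"] by simp
  qed auto
  moreover have "{-1<..<0} \<subseteq> (\<Union>n. {-1<..- (1 / real (Suc n))})"
  proof
    fix x :: real assume x: "x \<in> {-1<..<0}"
    then obtain n where "1 / real (Suc n) < - x" using reals_Archimedean[of "- x"] by (auto simp: inverse_eq_divide)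
    then show "x \<in> (\<Union>n. {-1<..- (1 / real (Suc n))})" using x by (intro UN_I[of n]) auto
  qed
  ultimately have null: "{-1<..<0} \<in> null_sets (interval_measure g)"
    by (intro null_setsI) (auto intro: emeasure_mono[THEN order_trans, THEN antisym])
  (* Any negative left end point would do, as the function is constant on the negative half-line. *)
  have "{-1<..t} = {0..t} \<union> {-1<..<0}" using t by auto
  then have "emeasure (interval_measure g) {-1<..t} = emeasure (interval_measure g) {0..t}"
    using emeasure_Un_null_set[OF _ null, of "{0..t}"] by simp
  then show ?thesis using Ioc[of "-1" t] g(3)[of "-1"] t by simp
qed

lemma emeasure_clock_atLeast:
  assumes \<rho>: "0 < \<rho>" and u: "0 \<le> u"
  shows "emeasure (clock \<rho>) {u..} = ennreal (exp (- \<rho> * u))"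
proof -
  interpret prob_space "clock \<rho>" by (rule prob_space_clock[OF \<rho>])
  have "exp (\<rho> * u) * prob {u..} = 1"
    using clock_shift(2)[OF \<rho> u, of "\<lambda>_. 1"] prob_space by simp
  then have "prob {u..} = exp (- \<rho> * u)" by (simp add: exp_minus field_simps)
  then show ?thesis by (simp add: emeasure_eq_measure)
qed

text \<open>By Fubini's theorem: \<open>exp (- \<rho> u)\<close> is the probability that the exponential time is at least \<open>u\<close>, and
  the measure of \<open>[0, t]\<close> is \<open>g t\<close>.\<close>

lemma discounted_Stieltjes_integral:
  assumes g: "cadlag g" "mono g" "\<And>t. t < 0 \<Longrightarrow> g t = 0" and \<rho>: "0 < \<rho>"
  shows "(\<integral>\<^sup>+ t\<in>{0..}. ennreal (exp (- \<rho> * t)) \<partial>interval_measure g) = (\<integral>\<^sup>+ t. ennreal (g t) \<partial>clock \<rho>)"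
proof -
  interpret I: sigma_finite_measure "interval_measure g"
    using g by (intro sigma_finite_interval_measure) (auto simp: cadlag_def monoD)
  interpret C: prob_space "clock \<rho>" by (rule prob_space_clock[OF \<rho>])
  interpret pair_sigma_finite "interval_measure g" "clock \<rho>" ..
  have "(\<integral>\<^sup>+ u\<in>{0..}. ennreal (exp (- \<rho> * u)) \<partial>interval_measure g)
      = (\<integral>\<^sup>+ u. (\<integral>\<^sup>+ t. indicator {p. 0 \<le> fst p \<and> fst p \<le> snd p} (u, t) \<partial>clock \<rho>) \<partial>interval_measure g)"
  proof (rule nn_integral_cong)
    fix u
    have "(\<integral>\<^sup>+ t. indicator {p. 0 \<le> fst p \<and> fst p \<le> snd p} (u, t) \<partial>clock \<rho>)
        = (\<integral>\<^sup>+ t. indicator {0..} u * indicator {u..} t \<partial>clock \<rho>)"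
      by (rule nn_integral_cong) (auto simp: indicator_def)
    also have "\<dots> = indicator {0..} u * emeasure (clock \<rho>) {u..}" by (simp add: nn_integral_cmult)
    also have "\<dots> = ennreal (exp (- \<rho> * u)) * indicator {0..} u"
      using emeasure_clock_atLeast[OF \<rho>, of u] by (auto simp: indicator_def)
    finally show "ennreal (exp (- \<rho> * u)) * indicator {0..} u
        = (\<integral>\<^sup>+ t. indicator {p. 0 \<le> fst p \<and> fst p \<le> snd p} (u, t) \<partial>clock \<rho>)" by simp
  qed
  also have "\<dots> = (\<integral>\<^sup>+ t. (\<integral>\<^sup>+ u. indicator {p. 0 \<le> fst p \<and> fst p \<le> snd p} (u, t) \<partial>interval_measure g) \<partial>clock \<rho>)"
  proof (rule Fubini'[symmetric])
    have "{p \<in> space ((borel :: real measure) \<Otimes>\<^sub>M (borel :: real measure)). 0 \<le> fst p \<and> fst p \<le> snd p}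
        \<in> sets (borel \<Otimes>\<^sub>M borel)" by measurable
    then have "{p :: real \<times> real. 0 \<le> fst p \<and> fst p \<le> snd p} \<in> sets (borel \<Otimes>\<^sub>M borel)"
      by (simp add: space_pair_measure)
    then show "(\<lambda>(u, t). indicator {p. 0 \<le> fst p \<and> fst p \<le> snd p} (u, t))
        \<in> borel_measurable (interval_measure g \<Otimes>\<^sub>M clock \<rho>)"
      by (simp add: case_prod_beta' cong: measurable_cong_sets sets_pair_measure_cong)
  qed
  also have "\<dots> = (\<integral>\<^sup>+ t. ennreal (g t) \<partial>clock \<rho>)"
  proof (rule nn_integral_cong_AE)
    show "AE t in clock \<rho>. (\<integral>\<^sup>+ u. indicator {p. 0 \<le> fst p \<and> fst p \<le> snd p} (u, t) \<partial>interval_measure g) = ennreal (g t)"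
      using AE_clock_nonneg
    proof eventually_elim
      fix t :: real assume t: "0 \<le> t"
      have "(\<integral>\<^sup>+ u. indicator {p. 0 \<le> fst p \<and> fst p \<le> snd p} (u, t) \<partial>interval_measure g)
          = (\<integral>\<^sup>+ u. indicator {0..t} u \<partial>interval_measure g)"
        by (rule nn_integral_cong) (auto simp: indicator_def)
      then show "(\<integral>\<^sup>+ u. indicator {p. 0 \<le> fst p \<and> fst p \<le> snd p} (u, t) \<partial>interval_measure g) = ennreal (g t)"
        using interval_measure_Icc_from_0[OF g t] by simp
    qed
  qed
  finally show ?thesis .
qed

lemma admissible_processD:
  assumes "admissible_process M F \<rho> \<xi>" "\<omega> \<in> space M"
  shows "cadlag (\<lambda>t. \<xi> t \<omega>)" "mono (\<lambda>t. \<xi> t \<omega>)" "t < 0 \<Longrightarrow> \<xi> t \<omega> = 0" "0 \<le> \<xi> t \<omega>"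
    "r \<le> t \<Longrightarrow> \<xi> r \<omega> \<le> \<xi> t \<omega>" "(\<lambda>n. \<xi> (1 / real (Suc n)) \<omega>) \<longlonglongrightarrow> \<xi> 0 \<omega>"
proof -
  show c: "cadlag (\<lambda>t. \<xi> t \<omega>)" and m: "mono (\<lambda>t. \<xi> t \<omega>)" and z: "t < 0 \<Longrightarrow> \<xi> t \<omega> = 0" for t
    using assms unfolding admissible_process_def by auto
  show le: "r \<le> t \<Longrightarrow> \<xi> r \<omega> \<le> \<xi> t \<omega>" for r t using m by (rule monoD)
  show "0 \<le> \<xi> t \<omega>" using le[of "min (- 1) t" t] z[of "min (- 1) t"] by simp
  have "((\<lambda>t. \<xi> t \<omega>) \<longlongrightarrow> \<xi> 0 \<omega>) (at_right 0)"
    using c unfolding cadlag_def continuous_within by blast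
  moreover have "filterlim (\<lambda>n. 1 / real (Suc n)) (at_right 0) sequentially"
    unfolding filterlim_at using LIMSEQ_Suc[OF lim_1_over_n] by simp
  ultimately show "(\<lambda>n. \<xi> (1 / real (Suc n)) \<omega>) \<longlonglongrightarrow> \<xi> 0 \<omega>" by (rule filterlim_compose)
qed

lemma discounted_effort_eq:
  assumes "admissible_process M F \<rho> \<xi>" "\<omega> \<in> space M" "0 < \<rho>"
  shows "discounted_effort \<rho> \<xi> \<omega> = (\<integral>\<^sup>+ t. ennreal (\<xi> t \<omega>) \<partial>clock \<rho>)"
  unfolding discounted_effort_def
  by (rule discounted_Stieltjes_integral) (use admissible_processD[OF assms(1,2)] assms(3) in auto)

text \<open>Progressive measurability only concerns bounded time intervals; stopping the time at \<open>n\<close> and letting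
  \<open>n\<close> grow covers the whole half-line.\<close>

lemma admissible_process_measurable:
  assumes adm: "admissible_process M F \<rho> \<xi>" and filt: "filtration_on M F"
  shows "(\<lambda>(t, \<omega>). \<xi> t \<omega>) \<in> borel_measurable (borel \<Otimes>\<^sub>M M)"
    and "0 \<le> t \<Longrightarrow> \<xi> t \<in> borel_measurable (F t)"
proof -
  have prog: "(\<lambda>(s, \<omega>). \<xi> s \<omega>) \<in> borel_measurable (restrict_space borel {0..t} \<Otimes>\<^sub>M F t)" if "0 \<le> t" for t
    using adm that unfolding admissible_process_def progressively_measurable_def by blast
  show "\<xi> t \<in> borel_measurable (F t)" if t: "0 \<le> t" for t
    using measurable_compose[OF measurable_Pair1' prog[OF t], of t] t by (simp add: space_restrict_space)
  have "(\<lambda>p. \<xi> (max 0 (fst p)) (snd p)) \<in> borel_measurable (borel \<Otimes>\<^sub>M M)"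
  proof (rule borel_measurable_LIMSEQ_real)
    fix n :: nat
    have sub: "subalgebra M (F (real n))" using filt by (simp add: filtration_on_def)
    have "(\<lambda>p. (max 0 (min (real n) (fst p)), snd p)) \<in> (borel \<Otimes>\<^sub>M M) \<rightarrow>\<^sub>M (restrict_space borel {0..real n} \<Otimes>\<^sub>M F (real n))"
    proof (rule measurable_Pair)
      show "(\<lambda>p. max 0 (min (real n) (fst p))) \<in> (borel \<Otimes>\<^sub>M M) \<rightarrow>\<^sub>M restrict_space borel {0..real n}"
        by (rule measurable_restrict_space2) auto
      show "(\<lambda>p. snd p) \<in> ((borel :: real measure) \<Otimes>\<^sub>M M) \<rightarrow>\<^sub>M F (real n)"
      proof (rule measurable_compose[OF measurable_snd])
        show "(\<lambda>\<omega>. \<omega>) \<in> M \<rightarrow>\<^sub>M F (real n)"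
          using sub by (intro measurableI) (auto simp: subalgebra_def)
      qed
    qed
    from measurable_compose[OF this prog]
    show "(\<lambda>p. \<xi> (max 0 (min (real n) (fst p))) (snd p)) \<in> borel_measurable (borel \<Otimes>\<^sub>M M)" by simp
  next
    fix p :: "real \<times> 'a"
    obtain n0 :: nat where n0: "fst p \<le> real n0" using real_arch_simple by blast
    have "\<forall>\<^sub>F n in sequentially. \<xi> (max 0 (min (real n) (fst p))) (snd p) = \<xi> (max 0 (fst p)) (snd p)"
      using eventually_ge_at_top[of n0] by eventually_elim (use n0 in \<open>simp add: min_absorb2\<close>)
    then show "(\<lambda>n. \<xi> (max 0 (min (real n) (fst p))) (snd p)) \<longlonglongrightarrow> \<xi> (max 0 (fst p)) (snd p)"
      by (rule tendsto_eventually)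
  qed
  then have "(\<lambda>p. if fst p < 0 then 0 else \<xi> (max 0 (fst p)) (snd p)) \<in> borel_measurable (borel \<Otimes>\<^sub>M M)"
    by measurable
  moreover have "(if fst p < 0 then 0 else \<xi> (max 0 (fst p)) (snd p)) = (case p of (t, \<omega>) \<Rightarrow> \<xi> t \<omega>)"
    if "p \<in> space (borel \<Otimes>\<^sub>M M)" for p
    using that admissible_processD(3)[OF adm, of "snd p" "fst p"]
    by (auto simp: space_pair_measure max_def not_less)
  ultimately show "(\<lambda>(t, \<omega>). \<xi> t \<omega>) \<in> borel_measurable (borel \<Otimes>\<^sub>M M)"
    by (subst measurable_cong[symmetric]) auto
qed

lemma continuous_process_admissible:
  assumes bm: "brownian_motion M F B"
    and adapted: "\<And>t. 0 \<le> t \<Longrightarrow> \<xi> t \<in> borel_measurable (F t)"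
    and cont: "\<And>\<omega>. \<omega> \<in> space M \<Longrightarrow> continuous_on {0..} (\<lambda>t. \<xi> t \<omega>)"
    and mono: "\<And>\<omega> r t. \<omega> \<in> space M \<Longrightarrow> 0 \<le> r \<Longrightarrow> r \<le> t \<Longrightarrow> \<xi> r \<omega> \<le> \<xi> t \<omega>"
    and nn: "\<And>\<omega>. \<omega> \<in> space M \<Longrightarrow> 0 \<le> \<xi> 0 \<omega>"
    and zero: "\<And>\<omega> t. t < 0 \<Longrightarrow> \<xi> t \<omega> = 0"
    and \<rho>: "0 < \<rho>" and effort: "(\<integral>\<^sup>+ \<omega>. (\<integral>\<^sup>+ t. ennreal (\<xi> t \<omega>) \<partial>clock \<rho>) \<partial>M) < \<infinity>"
  shows "admissible_process M F \<rho> \<xi>"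
proof -
  have prog: "progressively_measurable F \<xi>"
    unfolding progressively_measurable_def
  proof (intro allI impI)
    fix t :: real assume t: "0 \<le> t"
    have sp: "space (F r) = space M" if "0 \<le> r" for r
      using brownian_motionD(2)[OF bm that] by (simp add: subalgebra_def)
    have "(\<lambda>(r, \<omega>). \<xi> (max 0 (min t r)) \<omega>) \<in> borel_measurable (borel \<Otimes>\<^sub>M F t)"
    proof (rule measurable_pair_continuous_paths)
      show "\<xi> (max 0 (min t r)) \<in> borel_measurable (F t)" for r
        by (rule brownian_motionD(9)[OF bm _ _ adapted]) (use t in auto)
      show "continuous_on UNIV (\<lambda>r. \<xi> (max 0 (min t r)) \<omega>)" if "\<omega> \<in> space (F t)" for \<omega>
        by (rule continuous_on_compose2[OF cont]) (use that sp[OF t] in \<open>auto intro!: continuous_intros\<close>)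
    qed
    moreover have "(\<lambda>p. p) \<in> (restrict_space borel {0..t} \<Otimes>\<^sub>M F t) \<rightarrow>\<^sub>M (borel \<Otimes>\<^sub>M F t)"
    proof -
      have "(\<lambda>p. (fst p, snd p)) \<in> (restrict_space borel {0..t} \<Otimes>\<^sub>M F t) \<rightarrow>\<^sub>M (borel \<Otimes>\<^sub>M F t)"
        by (intro measurable_Pair measurable_compose[OF measurable_fst] measurable_snd measurable_restrict_space1) auto
      then show ?thesis by simp
    qed
    ultimately have "(\<lambda>p. (\<lambda>(r, \<omega>). \<xi> (max 0 (min t r)) \<omega>) p) \<in> borel_measurable (restrict_space borel {0..t} \<Otimes>\<^sub>M F t)"
      by (rule measurable_compose[rotated])
    moreover have "(case p of (r, \<omega>) \<Rightarrow> \<xi> (max 0 (min t r)) \<omega>) = (case p of (r, \<omega>) \<Rightarrow> \<xi> r \<omega>)"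
      if "p \<in> space (restrict_space borel {0..t} \<Otimes>\<^sub>M F t)" for p
      using that by (auto simp: space_pair_measure space_restrict_space)
    ultimately show "(\<lambda>(r, \<omega>). \<xi> r \<omega>) \<in> borel_measurable (restrict_space borel {0..t} \<Otimes>\<^sub>M F t)"
      by (subst measurable_cong[symmetric]) auto
  qed
  have paths: "cadlag (\<lambda>t. \<xi> t \<omega>) \<and> mono (\<lambda>t. \<xi> t \<omega>) \<and> (\<forall>t<0. \<xi> t \<omega> = 0)" if \<omega>: "\<omega> \<in> space M" for \<omega>
  proof (intro conjI)
    have nonneg: "0 \<le> \<xi> t \<omega>" if "0 \<le> t" for t using nn[OF \<omega>] mono[OF \<omega> order_refl that] by linarith
    show "mono (\<lambda>t. \<xi> t \<omega>)"
    proof (rule monoI)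
      fix r t :: real assume "r \<le> t"
      then show "\<xi> r \<omega> \<le> \<xi> t \<omega>"
        using mono[OF \<omega>, of r t] zero[of r \<omega>] zero[of t \<omega>] nonneg[of t] by (cases "r < 0"; cases "t < 0") auto
    qed
    show "\<forall>t<0. \<xi> t \<omega> = 0" using zero by blast
    show "cadlag (\<lambda>t. \<xi> t \<omega>)"
      unfolding cadlag_def
    proof (intro allI conjI)
      fix t :: real
      have neg: "((\<lambda>t. \<xi> t \<omega>) \<longlongrightarrow> 0) (at_left t)" if "t \<le> 0"
      proof (rule tendsto_eventually)
        show "\<forall>\<^sub>F r in at_left t. \<xi> r \<omega> = 0"
          unfolding eventually_at_filter by (rule always_eventually) (use zero that in auto)
      qed
      have pos: "((\<lambda>t. \<xi> t \<omega>) \<longlongrightarrow> \<xi> t \<omega>) (at t within {0..})" if "0 \<le> t"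
        using cont[OF \<omega>] that by (auto simp: continuous_on_def)
      show "continuous (at_right t) (\<lambda>t. \<xi> t \<omega>)"
      proof (cases "t < 0")
        case True
        have "\<forall>\<^sub>F r in at_right t. \<xi> r \<omega> = 0"
          using eventually_at_right_real[OF True] by eventually_elim (simp add: zero)
        then show ?thesis unfolding continuous_within using zero[OF True] by (simp add: tendsto_eventually)
      next
        case False
        then show ?thesis unfolding continuous_within
          by (intro tendsto_within_subset[OF pos]) auto
      qed
      show "\<exists>l. ((\<lambda>t. \<xi> t \<omega>) \<longlongrightarrow> l) (at_left t)"
      proof (cases "t \<le> 0")
        case True then show ?thesis using neg by blast
      next
        case False
        then have "((\<lambda>t. \<xi> t \<omega>) \<longlongrightarrow> \<xi> t \<omega>) (at t)"
          using cont[OF \<omega>] by (auto simp: continuous_on_eq_continuous_at[of "{0<..}"] isCont_def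
              dest!: continuous_on_subset[of "{0..}" _ "{0<..}"])
        then show ?thesis by (auto intro: filterlim_at_split[THEN iffD1, THEN conjunct1])
      qed
    qed
  qed
  have "(\<integral>\<^sup>+ \<omega>. discounted_effort \<rho> \<xi> \<omega> \<partial>M) = (\<integral>\<^sup>+ \<omega>. (\<integral>\<^sup>+ t. ennreal (\<xi> t \<omega>) \<partial>clock \<rho>) \<partial>M)"
    unfolding discounted_effort_def
    by (rule nn_integral_cong, rule discounted_Stieltjes_integral) (use paths \<rho> in auto)
  then show ?thesis unfolding admissible_process_def using prog paths effort by simp
qed

text \<open>By continuity the supremum may be taken over rational times.\<close>

lemma measurable_running_max0:
  assumes t: "0 \<le> t" and meas: "\<And>u. 0 \<le> u \<Longrightarrow> u \<le> t \<Longrightarrow> g u \<in> borel_measurable N"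
    and cont: "\<And>\<omega>. \<omega> \<in> space N \<Longrightarrow> continuous_on {0..} (\<lambda>u. g u \<omega>)"
  shows "(\<lambda>\<omega>. running_max0 (\<lambda>u. g u \<omega>) t) \<in> borel_measurable N"
proof -
  define clamp where "clamp q = max 0 (min t q)" for q :: real
  have clamp: "0 \<le> clamp q" "clamp q \<le> t" for q using t by (auto simp: clamp_def)
  have sup_eq: "(SUP u\<in>{0..t}. g u \<omega>) = (SUP q\<in>\<rat>. g (clamp q) \<omega>)" if \<omega>: "\<omega> \<in> space N" for \<omega>
  proof (rule antisym)
    note bdd = continuous_bdd_above[OF cont[OF \<omega>], of t]
    have bddq: "bdd_above ((\<lambda>q. g (clamp q) \<omega>) ` \<rat>)"
      by (rule bdd_above_mono[OF bdd]) (use clamp in auto)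
    have cl: "continuous_on (closure \<rat>) (\<lambda>q. g (clamp q) \<omega>)"
      by (rule continuous_on_compose2[OF cont[OF \<omega>]]) (use clamp in \<open>auto simp: clamp_def intro!: continuous_intros\<close>)
    have "(\<lambda>q. g (clamp q) \<omega>) ` closure \<rat> \<subseteq> {..(SUP q\<in>\<rat>. g (clamp q) \<omega>)}"
      by (rule image_closure_subset[OF cl]) (use cSUP_upper[OF _ bddq] in auto)
    then have le: "g (clamp q) \<omega> \<le> (SUP q\<in>\<rat>. g (clamp q) \<omega>)" for q
      by (auto simp: Rats_closure_real)
    show "(SUP u\<in>{0..t}. g u \<omega>) \<le> (SUP q\<in>\<rat>. g (clamp q) \<omega>)"
    proof (rule cSUP_least)
      fix u assume "u \<in> {0..t}"
      then show "g u \<omega> \<le> (SUP q\<in>\<rat>. g (clamp q) \<omega>)" using le[of u] by (simp add: clamp_def)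
    qed (use t in simp)
    show "(SUP q\<in>\<rat>. g (clamp q) \<omega>) \<le> (SUP u\<in>{0..t}. g u \<omega>)"
    proof (rule cSUP_least)
      show "(\<rat> :: real set) \<noteq> {}" using Rats_0 by blast
      fix q :: real
      show "g (clamp q) \<omega> \<le> (SUP u\<in>{0..t}. g u \<omega>)"
        using clamp[of q] by (intro cSUP_upper[OF _ bdd]) auto
    qed
  qed
  have "(\<lambda>\<omega>. SUP q\<in>\<rat>. g (clamp q) \<omega>) \<in> borel_measurable N"
  proof (rule borel_measurable_cSUP)
    show "countable (\<rat> :: real set)" by (rule countable_rat)
    show "g (clamp q) \<in> borel_measurable N" for q using meas clamp by blast
    fix \<omega> assume "\<omega> \<in> space N"
    show "bdd_above ((\<lambda>q. g (clamp q) \<omega>) ` \<rat>)"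
      by (rule bdd_above_mono[OF continuous_bdd_above[OF cont[OF \<open>\<omega> \<in> space N\<close>], of t]]) (use clamp in auto)
  qed
  then have "(\<lambda>\<omega>. max 0 (SUP q\<in>\<rat>. g (clamp q) \<omega>)) \<in> borel_measurable N" by measurable
  then show ?thesis unfolding running_max0_def
    by (subst measurable_cong[where g = "\<lambda>\<omega>. max 0 (SUP q\<in>\<rat>. g (clamp q) \<omega>)"]) (auto simp: sup_eq)
qed

lemma measurable_reflection_iterate:
  assumes "\<And>u. 0 \<le> u \<Longrightarrow> u \<le> T \<Longrightarrow> f u \<in> borel_measurable N"
    and "\<And>\<omega>. \<omega> \<in> space N \<Longrightarrow> continuous_on {0..} (\<lambda>u. f u \<omega>)" and "0 \<le> t" "t \<le> T"
  shows "(\<lambda>\<omega>. reflection_iterate c (\<lambda>u. f u \<omega>) n t) \<in> borel_measurable N"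
  using assms
proof (induction n arbitrary: f t)
  case (Suc n)
  have cont: "continuous_on {0..} (\<lambda>u. - f u \<omega>)" if "\<omega> \<in> space N" for \<omega>
    using Suc.prems(2)[OF that] by (intro continuous_intros)
  have "(\<lambda>\<omega>. reflection_iterate c (\<lambda>u. - f u \<omega>) n u) \<in> borel_measurable N" if "0 \<le> u" "u \<le> T" for u
    by (rule Suc.IH[of "\<lambda>u \<omega>. - f u \<omega>"]) (use Suc.prems(1) cont that in auto)
  then have "(\<lambda>\<omega>. running_max0 (\<lambda>u. f u \<omega> + reflection_iterate c (\<lambda>u. - f u \<omega>) n u - c) t) \<in> borel_measurable N"
    using Suc.prems reflection_iterate_continuous[OF cont]
    by (intro measurable_running_max0) (auto intro!: borel_measurable_add borel_measurable_diff continuous_intros)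
  then show ?case by simp
qed simp

lemma measurable_push:
  assumes c: "0 < c" and t: "0 \<le> t" and meas: "\<And>u. 0 \<le> u \<Longrightarrow> u \<le> t \<Longrightarrow> f u \<in> borel_measurable N"
    and cont: "\<And>\<omega>. \<omega> \<in> space N \<Longrightarrow> continuous_on {0..} (\<lambda>u. f u \<omega>)"
  shows "(\<lambda>\<omega>. push c (\<lambda>u. f u \<omega>) t) \<in> borel_measurable N"
  using t c unfolding push_def
  by (auto intro!: borel_measurable_cSUP measurable_reflection_iterate[OF meas cont] reflection_iterate_bdd cont)

section \<open>The effort of the reflecting control\<close>

text \<open>Projection to \<open>[-d, d]\<close> reduces the square by at least \<open>2 d\<close> times the distance moved.\<close>

lemma clip_square: "0 \<le> d \<Longrightarrow> (clip d x)\<^sup>2 + 2 * d * \<bar>clip d x - x\<bar> \<le> x\<^sup>2"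
proof -
  assume d: "0 \<le> d"
  consider "\<bar>x\<bar> \<le> d" | "d < x" | "x < - d" by linarith
  then show ?thesis
  proof cases
    case 1 then show ?thesis by (simp add: clip_eq)
  next
    case 2
    have "0 \<le> (x - d)\<^sup>2" by simp
    with 2 d show ?thesis by (simp add: clip_def power2_eq_square algebra_simps)
  next
    case 3
    have "0 \<le> (x + d)\<^sup>2" by simp
    with 3 d show ?thesis by (simp add: clip_def power2_eq_square algebra_simps)
  qed
qed

lemma clip_distance: "0 \<le> d \<Longrightarrow> \<bar>clip d x - x\<bar> \<le> \<bar>x\<bar>"
  by (auto simp: clip_def)

lemma clip_measurable [measurable]: "clip d \<in> borel_measurable borel"
  unfolding clip_def by measurable

locale scaled_brownian =
  fixes M :: "'a measure" and F :: "real \<Rightarrow> 'a measure" and w :: "real \<Rightarrow> 'a \<Rightarrow> real" and s z :: real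
  assumes bm: "brownian_motion M F w" and s_pos: "0 < s"
begin

sublocale M: prob_space M by (rule brownian_motionD[OF bm])

abbreviation path :: "'a \<Rightarrow> real \<Rightarrow> real" where "path \<omega> u \<equiv> z + s * w u \<omega>"

lemma path_continuous: "\<omega> \<in> space M \<Longrightarrow> continuous_on {0..} (path \<omega>)"
  using brownian_motionD(7)[OF bm] by (intro continuous_intros)

lemma path_negation_continuous: "\<omega> \<in> space M \<Longrightarrow> continuous_on {0..} (\<lambda>u. - path \<omega> u)"
  using path_continuous by (rule continuous_on_minus)

lemma path_adapted: "0 \<le> u \<Longrightarrow> u \<le> t \<Longrightarrow> (\<lambda>\<omega>. path \<omega> u) \<in> borel_measurable (F t)"
  using brownian_motionD(9)[OF bm, of u t "w u"] brownian_motionD(4)[OF bm, of u] by simp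

lemma space_F: "0 \<le> t \<Longrightarrow> space (F t) = space M"
  using brownian_motionD(2)[OF bm] by (simp add: subalgebra_def)

lemma euler_position_adapted:
  assumes "0 < \<tau>"
  shows "(\<lambda>\<omega>. euler_position d (path \<omega>) \<tau> k) \<in> borel_measurable (F (real k * \<tau>))"
proof (induction k)
  case 0
  show ?case using path_adapted[of 0 0] by (simp add: measurable_compose[OF _ clip_measurable])
next
  case (Suc k)
  have le: "0 \<le> real k * \<tau>" "real k * \<tau> \<le> real (Suc k) * \<tau>" using assms by (auto simp: mult_right_mono)
  have "(\<lambda>\<omega>. euler_position d (path \<omega>) \<tau> k) \<in> borel_measurable (F (real (Suc k) * \<tau>))"
    by (rule brownian_motionD(9)[OF bm le Suc])
  moreover have "(\<lambda>\<omega>. path \<omega> (real (Suc k) * \<tau>)) \<in> borel_measurable (F (real (Suc k) * \<tau>))"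
    "(\<lambda>\<omega>. path \<omega> (real k * \<tau>)) \<in> borel_measurable (F (real (Suc k) * \<tau>))"
    using le by (auto intro!: path_adapted)
  ultimately show ?case
    unfolding euler_position.simps by measurable
qed

text \<open>The square of the walk grows by \<open>s\<^sup>2 \<tau>\<close> per step in the mean, and by \<open>clip_square\<close> each projection
  takes at least \<open>2 d\<close> times its effort from it.\<close>

lemma euler_effort_expectation:
  assumes d: "0 < d" and \<tau>: "0 < \<tau>"
  shows "integrable M (\<lambda>\<omega>. euler_effort d (path \<omega>) \<tau> k)"
    and "2 * d * (\<integral>\<omega>. euler_effort d (path \<omega>) \<tau> k \<partial>M) \<le> z\<^sup>2 + real k * \<tau> * s\<^sup>2"
proof -
  define X where "X k \<omega> = euler_position d (path \<omega>) \<tau> k" for k \<omega>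
  define U where "U k \<omega> = euler_effort d (path \<omega>) \<tau> k" for k \<omega>
  define Y where "Y k \<omega> = X k \<omega> + s * (w (real k * \<tau> + \<tau>) \<omega> - w (real k * \<tau>) \<omega>)" for k \<omega>
  have kt: "0 \<le> real k * \<tau>" for k using \<tau> by simp
  have X_adapted: "X k \<in> borel_measurable (F (real k * \<tau>))" for k
    unfolding X_def by (rule euler_position_adapted[OF \<tau>])
  have X_meas [measurable]: "X k \<in> borel_measurable M" for k
    by (rule brownian_motionD(8)[OF bm kt X_adapted])
  have X_range: "\<bar>X k \<omega>\<bar> \<le> d" for k \<omega> unfolding X_def using d by (intro euler_position_range) simp
  have X_sq_int: "integrable M (\<lambda>\<omega>. (X k \<omega>)\<^sup>2)" for k
    by (rule M.integrable_const_bound[of _ "d\<^sup>2"]) (use X_range d in \<open>auto simp: abs_le_square_iff[symmetric]\<close>)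
  have X_int: "integrable M (\<lambda>\<omega>. 2 * X k \<omega>)" for k
    by (rule M.integrable_const_bound[of _ "2 * d"]) (use X_range in \<open>auto simp: abs_mult\<close>)
  have X_Suc: "X (Suc k) \<omega> = clip d (Y k \<omega>)" for k \<omega>
    unfolding X_def Y_def by (simp add: algebra_simps)
  have U_Suc: "U (Suc k) \<omega> = U k \<omega> + \<bar>clip d (Y k \<omega>) - Y k \<omega>\<bar>" for k \<omega>
    unfolding U_def euler_effort.simps euler_shift_def X_def[symmetric] X_Suc
    by (simp add: Y_def algebra_simps)
  have Y_sq: "integrable M (\<lambda>\<omega>. (Y k \<omega>)\<^sup>2)" "(\<integral>\<omega>. (Y k \<omega>)\<^sup>2 \<partial>M) = (\<integral>\<omega>. (X k \<omega>)\<^sup>2 \<partial>M) + \<tau> * s\<^sup>2" for k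
  proof -
    (* For the square the second derivative is constant, so the expansion has no error term. *)
    note step = brownian_step_expansion[OF bm kt \<tau> less_imp_le[OF s_pos] X_adapted, of "\<lambda>x. x\<^sup>2" "\<lambda>x. 2 * x" "\<lambda>_. 2" 0 k]
    show "integrable M (\<lambda>\<omega>. (Y k \<omega>)\<^sup>2)"
      unfolding Y_def by (rule step(1)) (use X_sq_int X_int in \<open>auto intro!: derivative_eq_intros\<close>)
    have "\<bar>(\<integral>\<omega>. (Y k \<omega>)\<^sup>2 \<partial>M) - ((\<integral>\<omega>. (X k \<omega>)\<^sup>2 \<partial>M) + \<tau> * (s\<^sup>2 / 2 * (\<integral>\<omega>. 2 \<partial>M)))\<bar> \<le> 0 * s ^ 3 * (\<tau> * sqrt \<tau>)"
      unfolding Y_def by (rule step(2)) (use X_sq_int X_int in \<open>auto intro!: derivative_eq_intros\<close>)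
    then show "(\<integral>\<omega>. (Y k \<omega>)\<^sup>2 \<partial>M) = (\<integral>\<omega>. (X k \<omega>)\<^sup>2 \<partial>M) + \<tau> * s\<^sup>2"
      using M.prob_space by simp
  qed
  have Y_meas [measurable]: "Y k \<in> borel_measurable M" for k
    unfolding Y_def using brownian_motionD(5)[OF bm kt[of k]] brownian_motionD(5)[OF bm, of "real k * \<tau> + \<tau>"] kt[of k] \<tau>
    by simp
  have push_int: "integrable M (\<lambda>\<omega>. \<bar>clip d (Y k \<omega>) - Y k \<omega>\<bar>)" for k
  proof (rule Bochner_Integration.integrable_bound)
    show "integrable M (\<lambda>\<omega>. 1 + (Y k \<omega>)\<^sup>2)" using Y_sq(1) by simp
    show "AE \<omega> in M. norm \<bar>clip d (Y k \<omega>) - Y k \<omega>\<bar> \<le> norm (1 + (Y k \<omega>)\<^sup>2)"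
    proof (rule AE_I2)
      fix \<omega>
      have "\<bar>clip d (Y k \<omega>) - Y k \<omega>\<bar> \<le> \<bar>Y k \<omega>\<bar>" using d by (intro clip_distance) simp
      also have "\<dots> \<le> 1 + \<bar>Y k \<omega>\<bar>\<^sup>2"
      proof -
        have "0 \<le> (\<bar>Y k \<omega>\<bar> - 1)\<^sup>2" by simp
        then have "2 * \<bar>Y k \<omega>\<bar> \<le> 1 + \<bar>Y k \<omega>\<bar>\<^sup>2" unfolding power2_diff by simp
        then show ?thesis by linarith
      qed
      finally show "norm \<bar>clip d (Y k \<omega>) - Y k \<omega>\<bar> \<le> norm (1 + (Y k \<omega>)\<^sup>2)" by simp
    qed
  qed measurable
  have "integrable M (U k) \<and> (\<integral>\<omega>. (X k \<omega>)\<^sup>2 \<partial>M) + 2 * d * (\<integral>\<omega>. U k \<omega> \<partial>M) \<le> z\<^sup>2 + real k * \<tau> * s\<^sup>2"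
  proof (induction k)
    case 0
    have U0: "U 0 \<omega> = \<bar>clip d z - z\<bar>" and X0: "X 0 \<omega> = clip d z" if "\<omega> \<in> space M" for \<omega>
      unfolding U_def X_def euler_effort.simps euler_shift_def using brownian_motionD(6)[OF bm that] by simp_all
    have "integrable M (U 0) \<longleftrightarrow> integrable M (\<lambda>_. \<bar>clip d z - z\<bar>)"
      "(\<integral>\<omega>. U 0 \<omega> \<partial>M) = (\<integral>\<omega>. \<bar>clip d z - z\<bar> \<partial>M)" "(\<integral>\<omega>. (X 0 \<omega>)\<^sup>2 \<partial>M) = (\<integral>\<omega>. (clip d z)\<^sup>2 \<partial>M)"
      using U0 X0 by (intro Bochner_Integration.integrable_cong Bochner_Integration.integral_cong; simp)+
    then show ?case using clip_square[of d z] d M.prob_space by simp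
  next
    case (Suc k)
    have "(\<integral>\<omega>. (X (Suc k) \<omega>)\<^sup>2 + 2 * d * \<bar>clip d (Y k \<omega>) - Y k \<omega>\<bar> \<partial>M) \<le> (\<integral>\<omega>. (Y k \<omega>)\<^sup>2 \<partial>M)"
      by (rule integral_mono) (use X_sq_int[of "Suc k"] push_int Y_sq d clip_square X_Suc in auto)
    moreover have "(\<integral>\<omega>. U (Suc k) \<omega> \<partial>M) = (\<integral>\<omega>. U k \<omega> \<partial>M) + (\<integral>\<omega>. \<bar>clip d (Y k \<omega>) - Y k \<omega>\<bar> \<partial>M)"
      unfolding U_Suc using Suc push_int by simp
    moreover have "integrable M (U (Suc k))"
      unfolding U_Suc[abs_def] using Suc push_int by simp
    ultimately show ?case
      using Suc Y_sq(2)[of k] X_sq_int[of "Suc k"] push_int[of k] by (simp add: algebra_simps)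
  qed
  moreover have "0 \<le> (\<integral>\<omega>. (X k \<omega>)\<^sup>2 \<partial>M)" by simp
  ultimately show "integrable M (\<lambda>\<omega>. euler_effort d (path \<omega>) \<tau> k)"
    "2 * d * (\<integral>\<omega>. euler_effort d (path \<omega>) \<tau> k \<partial>M) \<le> z\<^sup>2 + real k * \<tau> * s\<^sup>2"
    unfolding U_def by (blast, linarith)
qed

context
  fixes c :: real
  assumes c_pos: "0 < c"
begin

lemma push_path_measurable:
  assumes t: "0 \<le> t"
  shows "(\<lambda>\<omega>. push c (path \<omega>) t) \<in> borel_measurable (F t)"
    "(\<lambda>\<omega>. push c (\<lambda>u. - path \<omega> u) t) \<in> borel_measurable (F t)"
proof -
  show "(\<lambda>\<omega>. push c (path \<omega>) t) \<in> borel_measurable (F t)"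
    by (rule measurable_push[OF c_pos t path_adapted path_continuous]) (use space_F[OF t] in auto)
  show "(\<lambda>\<omega>. push c (\<lambda>u. - path \<omega> u) t) \<in> borel_measurable (F t)"
    by (rule measurable_push[OF c_pos t borel_measurable_uminus[OF path_adapted] path_negation_continuous])
      (use space_F[OF t] in auto)
qed

text \<open>For each path, the walks with step \<open>1/(n+1)\<close> eventually dominate the push, since the path is uniformly
  continuous on \<open>[0, T]\<close>. Fatou's lemma transfers the bound.\<close>

lemma push_effort_expectation:
  assumes T: "0 \<le> T"
  shows "(\<integral>\<^sup>+\<omega>. ennreal (push c (path \<omega>) T + push c (\<lambda>u. - path \<omega> u) T) \<partial>M) \<le> ennreal ((z\<^sup>2 + T * s\<^sup>2) / c)"
proof -
  define \<tau> where "\<tau> n = 1 / real (Suc n)" for n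
  have \<tau>: "0 < \<tau> n" for n by (simp add: \<tau>_def)
  define k where "k n = nat \<lfloor>T / \<tau> n\<rfloor>" for n
  define U where "U n \<omega> = euler_effort (c / 2) (path \<omega>) (\<tau> n) (k n)" for n \<omega>
  have c2: "0 < c / 2" using c_pos by simp
  note euler = euler_effort_expectation[OF c2 \<tau>]
  have kt: "real (k n) * \<tau> n \<le> T" for n
  proof -
    have "real (k n) \<le> T / \<tau> n" unfolding k_def using T \<tau>[of n] by (simp add: of_nat_nat)
    then show ?thesis using \<tau>[of n] by (simp add: pos_le_divide_eq)
  qed
  have U_bound: "(\<integral>\<^sup>+\<omega>. ennreal (U n \<omega>) \<partial>M) \<le> ennreal ((z\<^sup>2 + T * s\<^sup>2) / c)" for n
  proof -
    have "(\<integral>\<^sup>+\<omega>. ennreal (U n \<omega>) \<partial>M) = ennreal (\<integral>\<omega>. U n \<omega> \<partial>M)"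
      unfolding U_def using euler(1) euler_effort_nonneg by (intro nn_integral_eq_integral) auto
    also have "\<dots> \<le> ennreal ((z\<^sup>2 + T * s\<^sup>2) / c)"
    proof (rule ennreal_leI)
      have "c * (\<integral>\<omega>. U n \<omega> \<partial>M) \<le> z\<^sup>2 + real (k n) * \<tau> n * s\<^sup>2"
        using euler(2)[of n "k n"] unfolding U_def by simp
      also have "\<dots> \<le> z\<^sup>2 + T * s\<^sup>2" using kt[of n] by (intro add_left_mono mult_right_mono) auto
      finally show "(\<integral>\<omega>. U n \<omega> \<partial>M) \<le> (z\<^sup>2 + T * s\<^sup>2) / c"
        using c_pos by (simp add: pos_le_divide_eq mult.commute)
    qed
    finally show ?thesis .
  qed
  have "(\<integral>\<^sup>+\<omega>. ennreal (push c (path \<omega>) T + push c (\<lambda>u. - path \<omega> u) T) \<partial>M)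
      \<le> (\<integral>\<^sup>+\<omega>. liminf (\<lambda>n. ennreal (U n \<omega>)) \<partial>M)"
  proof (rule nn_integral_mono)
    fix \<omega> assume \<omega>: "\<omega> \<in> space M"
    obtain \<delta> where \<delta>: "0 < \<delta>" "\<And>u v. 0 \<le> u \<Longrightarrow> u \<le> T \<Longrightarrow> 0 \<le> v \<Longrightarrow> v \<le> T \<Longrightarrow> \<bar>u - v\<bar> < \<delta> \<Longrightarrow> \<bar>path \<omega> u - path \<omega> v\<bar> \<le> c / 2"
      using continuous_on_path_small_oscillation[OF path_continuous[OF \<omega>] c2, of T] by metis
    have "\<forall>\<^sub>F n in sequentially. \<tau> n < \<delta>"
      unfolding \<tau>_def using LIMSEQ_Suc[OF lim_1_over_n] \<delta>(1) by (rule order_tendstoD(2))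
    then have "\<forall>\<^sub>F n in sequentially. ennreal (push c (path \<omega>) T + push c (\<lambda>u. - path \<omega> u) T) \<le> ennreal (U n \<omega>)"
    proof eventually_elim
      fix n assume n: "\<tau> n < \<delta>"
      show "ennreal (push c (path \<omega>) T + push c (\<lambda>u. - path \<omega> u) T) \<le> ennreal (U n \<omega>)"
        unfolding U_def k_def
      proof (rule ennreal_leI, rule push_effort_below_euler[OF c_pos path_continuous[OF \<omega>] \<tau> T])
        fix u v assume "0 \<le> u" "u \<le> v" "v \<le> T" "v - u \<le> \<tau> n"
        then show "\<bar>path \<omega> v - path \<omega> u\<bar> \<le> c / 2" using \<delta>(2)[of v u] n by simp
      qed
    qed
    then show "ennreal (push c (path \<omega>) T + push c (\<lambda>u. - path \<omega> u) T) \<le> liminf (\<lambda>n. ennreal (U n \<omega>))"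
      by (rule Liminf_bounded)
  qed
  also have "\<dots> \<le> liminf (\<lambda>n. \<integral>\<^sup>+\<omega>. ennreal (U n \<omega>) \<partial>M)"
    by (rule nn_integral_liminf) (use euler(1) in \<open>simp add: U_def\<close>)
  also have "\<dots> \<le> ennreal ((z\<^sup>2 + T * s\<^sup>2) / c)"
    by (rule Liminf_le) (use U_bound in auto)
  finally show ?thesis .
qed

lemma push_processes_admissible:
  assumes \<rho>: "0 < \<rho>"
  shows "admissible_process M F \<rho> (\<lambda>t \<omega>. push c (path \<omega>) t)"
    "admissible_process M F \<rho> (\<lambda>t \<omega>. push c (\<lambda>u. - path \<omega> u) t)"
proof -
  interpret clock: prob_space "clock \<rho>" by (rule prob_space_clock[OF \<rho>])
  interpret pair_sigma_finite "clock \<rho>" M ..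
  have *: "admissible_process M F \<rho> \<xi>"
    if adapted: "\<And>t. 0 \<le> t \<Longrightarrow> \<xi> t \<in> borel_measurable (F t)"
    and cont: "\<And>\<omega>. \<omega> \<in> space M \<Longrightarrow> continuous_on {0..} (\<lambda>t. \<xi> t \<omega>)"
    and mono: "\<And>\<omega> r t. \<omega> \<in> space M \<Longrightarrow> 0 \<le> r \<Longrightarrow> r \<le> t \<Longrightarrow> \<xi> r \<omega> \<le> \<xi> t \<omega>"
    and nn: "\<And>\<omega>. \<omega> \<in> space M \<Longrightarrow> 0 \<le> \<xi> 0 \<omega>"
    and zero: "\<And>\<omega> t. t < 0 \<Longrightarrow> \<xi> t \<omega> = 0"
    and le: "\<And>\<omega> t. \<omega> \<in> space M \<Longrightarrow> \<xi> t \<omega> \<le> push c (path \<omega>) t + push c (\<lambda>u. - path \<omega> u) t"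
    for \<xi> :: "'a process"
  proof (rule continuous_process_admissible[OF bm adapted cont mono nn zero \<rho>])
    have joint [measurable]: "(\<lambda>(t, \<omega>). \<xi> (max 0 t) \<omega>) \<in> borel_measurable (borel \<Otimes>\<^sub>M M)"
    proof (rule measurable_pair_continuous_paths)
      show "\<xi> (max 0 t) \<in> borel_measurable M" for t
        by (rule brownian_motionD(8)[OF bm _ adapted]) auto
      show "continuous_on UNIV (\<lambda>t. \<xi> (max 0 t) \<omega>)" if "\<omega> \<in> space M" for \<omega>
        by (rule continuous_on_compose2[OF cont[OF that]]) (auto intro!: continuous_intros)
    qed
    have "(\<integral>\<^sup>+ \<omega>. (\<integral>\<^sup>+ t. ennreal (\<xi> t \<omega>) \<partial>clock \<rho>) \<partial>M) = (\<integral>\<^sup>+ \<omega>. (\<integral>\<^sup>+ t. ennreal (\<xi> (max 0 t) \<omega>) \<partial>clock \<rho>) \<partial>M)"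
    proof (rule nn_integral_cong, rule nn_integral_cong_AE)
      show "AE t in clock \<rho>. ennreal (\<xi> t \<omega>) = ennreal (\<xi> (max 0 t) \<omega>)" for \<omega>
        using AE_clock_nonneg by eventually_elim simp
    qed
    also have "\<dots> = (\<integral>\<^sup>+ t. (\<integral>\<^sup>+ \<omega>. ennreal (\<xi> (max 0 t) \<omega>) \<partial>M) \<partial>clock \<rho>)"
      by (rule Fubini') measurable
    also have "\<dots> \<le> (\<integral>\<^sup>+ t. ennreal ((z\<^sup>2 + t * s\<^sup>2) / c) \<partial>clock \<rho>)"
    proof (rule nn_integral_mono_AE)
      show "AE t in clock \<rho>. (\<integral>\<^sup>+ \<omega>. ennreal (\<xi> (max 0 t) \<omega>) \<partial>M) \<le> ennreal ((z\<^sup>2 + t * s\<^sup>2) / c)"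
        using AE_clock_nonneg
      proof eventually_elim
        fix t :: real assume t: "0 \<le> t"
        have "(\<integral>\<^sup>+ \<omega>. ennreal (\<xi> (max 0 t) \<omega>) \<partial>M)
            \<le> (\<integral>\<^sup>+\<omega>. ennreal (push c (path \<omega>) t + push c (\<lambda>u. - path \<omega> u) t) \<partial>M)"
          using t le by (intro nn_integral_mono ennreal_leI) simp
        then show "(\<integral>\<^sup>+ \<omega>. ennreal (\<xi> (max 0 t) \<omega>) \<partial>M) \<le> ennreal ((z\<^sup>2 + t * s\<^sup>2) / c)"
          using push_effort_expectation[OF t] by (rule order_trans)
      qed
    qed
    also have "\<dots> = ennreal (\<integral>t. (z\<^sup>2 + t * s\<^sup>2) / c \<partial>clock \<rho>)"
    proof (rule nn_integral_eq_integral)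
      show "integrable (clock \<rho>) (\<lambda>t. (z\<^sup>2 + t * s\<^sup>2) / c)"
        using integrable_clock_power[OF \<rho>, of 1] by simp
      show "AE t in clock \<rho>. 0 \<le> (z\<^sup>2 + t * s\<^sup>2) / c"
        using AE_clock_nonneg by eventually_elim (use c_pos in simp)
    qed
    finally show "(\<integral>\<^sup>+ \<omega>. (\<integral>\<^sup>+ t. ennreal (\<xi> t \<omega>) \<partial>clock \<rho>) \<partial>M) < \<infinity>"
      by (rule order_le_less_trans) simp
  qed
  note pos = push_mono[OF c_pos path_continuous] push_nonneg[OF c_pos path_continuous]
  note neg = push_mono[OF c_pos path_negation_continuous] push_nonneg[OF c_pos path_negation_continuous]
  note rp = push_reflected_path[OF c_pos path_continuous]
  show "admissible_process M F \<rho> (\<lambda>t \<omega>. push c (path \<omega>) t)"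
    by (rule *) (use push_path_measurable reflected_path.a_continuous[OF rp] pos neg in \<open>auto simp: push_negative_time\<close>)
  show "admissible_process M F \<rho> (\<lambda>t \<omega>. push c (\<lambda>u. - path \<omega> u) t)"
    by (rule *) (use push_path_measurable reflected_path.b_continuous[OF rp] pos neg in \<open>auto simp: push_negative_time\<close>)
qed

end

end

section \<open>The cost of the reflecting control\<close>

context controlled_difference
begin

text \<open>Near the upper barrier, and above it, the slope of \<open>V\<close> is close to \<open>k/2\<close>: a downward push there is
  worth nearly what it costs.\<close>

lemma V_slope_near_right:
  assumes "0 \<le> D" "c - \<eta> \<le> y" "0 \<le> \<eta>"
  shows "V y + (k / 2 - B * \<eta>) * D \<le> V (y + D)"
proof -
  have le: "y \<le> y + D" using assms by simp
  have "V y - (k / 2 - B * \<eta>) * y \<le> V (y + D) - (k / 2 - B * \<eta>) * (y + D)"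
  proof (rule DERIV_nonneg_imp_nondecreasing[OF le], intro exI conjI)
    fix x assume x: "y \<le> x"
    show "((\<lambda>x. V x - (k / 2 - B * \<eta>) * x) has_real_derivative V1 x - (k / 2 - B * \<eta>)) (at x)"
      by (rule derivative_eq_intros V_deriv refl)+ simp
    have "V1 (c - \<eta>) \<le> V1 x" by (rule V1_mono) (use x assms in linarith)
    moreover have "\<bar>V1 c - V1 (c - \<eta>)\<bar> \<le> B * \<eta>" using V1_lip[of c "c - \<eta>"] assms by simp
    ultimately show "0 \<le> V1 x - (k / 2 - B * \<eta>)" using V1_right[of c] by linarith
  qed
  then show ?thesis by (simp add: field_simps)
qed

lemma V_slope_near_left:
  assumes "0 \<le> D" "y \<le> - (c - \<eta>)" "0 \<le> \<eta>"
  shows "V y + (k / 2 - B * \<eta>) * D \<le> V (y - D)"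
  using V_slope_near_right[of D \<eta> "- y"] assms V_even[of y] V_even[of "- y + D"] by simp

text \<open>During a short step the reflecting control pushes at one barrier only, and ends near it.\<close>

lemma reflected_slack:
  assumes refl: "reflected_path c (\<lambda>u. z + s * w u \<omega>) (\<lambda>t. \<alpha> t \<omega>) (\<lambda>t. \<beta> t \<omega>)"
    and AS: "\<And>t. 0 \<le> t \<Longrightarrow> A t \<omega> = \<beta> t \<omega> - \<alpha> t \<omega> \<and> S t \<omega> = \<alpha> t \<omega> + \<beta> t \<omega>"
    and t: "0 \<le> t" "0 < d" and \<eta>: "\<eta> < c"
    and osc: "\<And>u v. t \<le> u \<Longrightarrow> u \<le> t + d \<Longrightarrow> t \<le> v \<Longrightarrow> v \<le> t + d \<Longrightarrow>
      \<bar>(z + s * w u \<omega>) - (z + s * w v \<omega>)\<bar> \<le> \<eta>"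
  shows "slack t d \<omega> \<le> B * \<eta> * (S (t + d) \<omega> - S t \<omega>)"
proof -
  interpret R: reflected_path c "\<lambda>u. z + s * w u \<omega>" "\<lambda>t. \<alpha> t \<omega>" "\<lambda>t. \<beta> t \<omega>" by (rule refl)
  have td: "0 \<le> t + d" "t \<le> t + d" using t by auto
  have \<eta>0: "0 \<le> \<eta>" using osc[of t t] t by simp
  define y where "y = Z (t + d) \<omega>"
  have y_eq: "y = (z + s * w (t + d) \<omega>) + \<beta> (t + d) \<omega> - \<alpha> (t + d) \<omega>"
    using AS[OF td(1)] td by (simp add: y_def Z_def)
  have pre: "Z t \<omega> + increment t d \<omega> = y + (\<alpha> (t + d) \<omega> - \<alpha> t \<omega>) - (\<beta> (t + d) \<omega> - \<beta> t \<omega>)"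
    using AS[OF t(1)] t unfolding y_eq Z_def increment_def by (simp add: algebra_simps)
  have S_inc: "S (t + d) \<omega> - S t \<omega> = (\<alpha> (t + d) \<omega> - \<alpha> t \<omega>) + (\<beta> (t + d) \<omega> - \<beta> t \<omega>)"
    using AS[OF t(1)] AS[OF td(1)] by simp
  have slack_eq: "slack t d \<omega> = V y + k / 2 * (S (t + d) \<omega> - S t \<omega>) - V (Z t \<omega> + increment t d \<omega>)"
    unfolding slack_def y_def by (simp add: algebra_simps)
  have mono: "\<alpha> t \<omega> \<le> \<alpha> (t + d) \<omega>" "\<beta> t \<omega> \<le> \<beta> (t + d) \<omega>" using R.a_mono R.b_mono t td by auto
  show ?thesis
  proof (cases "\<beta> t \<omega> = \<beta> (t + d) \<omega>")
    case True
    show ?thesis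
    proof (cases "\<alpha> t \<omega> = \<alpha> (t + d) \<omega>")
      case True
      then show ?thesis using \<open>\<beta> t \<omega> = \<beta> (t + d) \<omega>\<close> unfolding slack_eq pre S_inc by simp
    next
      case False
      then have "c - \<eta> \<le> y"
        unfolding y_eq using mono by (intro R.increase_near_barrier[OF t(1) td(2) osc]) auto
      from V_slope_near_right[OF _ this \<eta>0, of "\<alpha> (t + d) \<omega> - \<alpha> t \<omega>"] mono True
      show ?thesis unfolding slack_eq pre S_inc by (simp add: algebra_simps)
    qed
  next
    case False
    then have \<alpha>: "\<alpha> t \<omega> = \<alpha> (t + d) \<omega>" using R.not_both_increase[OF t(1) td(2) osc \<eta>] by auto
    have "y \<le> - (c - \<eta>)"
      unfolding y_eq using mono False by (intro R.b_increase_near_barrier[OF t(1) td(2) osc]) auto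
    from V_slope_near_left[OF _ this \<eta>0, of "\<beta> (t + d) \<omega> - \<beta> t \<omega>"] mono \<alpha>
    show ?thesis unfolding slack_eq pre S_inc by (simp add: algebra_simps)
  qed
qed

theorem reflection_attains_value:
  assumes refl: "AE \<omega> in M. reflected_path c (\<lambda>u. z + s * w u \<omega>) (\<lambda>t. \<alpha> t \<omega>) (\<lambda>t. \<beta> t \<omega>) \<and>
    (\<forall>t\<ge>0. A t \<omega> = \<beta> t \<omega> - \<alpha> t \<omega> \<and> S t \<omega> = \<alpha> t \<omega> + \<beta> t \<omega>)"
    (is "AE \<omega> in M. ?refl \<omega>")
  shows "(\<integral>\<^sup>+p. ennreal (h (Z (fst p) (snd p)) / \<rho> + k / 2 * S (fst p) (snd p)) \<partial>Q) \<le> ennreal (V z)"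
proof (rule value_upper_bound)
  note space = AE_space[of M]
  show "AE \<omega> in M. \<forall>t\<ge>0. \<bar>Z t \<omega>\<bar> \<le> c"
    using refl
  proof eventually_elim
    fix \<omega> assume a: "?refl \<omega>"
    show "\<forall>t\<ge>0. \<bar>Z t \<omega>\<bar> \<le> c"
      using reflected_path.inside[OF conjunct1[OF a]] a by (simp add: Z_def add_diff_eq)
  qed
  show "AE \<omega> in M. tame \<omega>"
    using refl
  proof eventually_elim
    fix \<omega> assume a: "?refl \<omega>"
    interpret R: reflected_path c "\<lambda>u. z + s * w u \<omega>" "\<lambda>t. \<alpha> t \<omega>" "\<lambda>t. \<beta> t \<omega>" using a by blast
    show "tame \<omega>"
      unfolding tame_def
    proof (intro allI impI)
      fix T \<epsilon> :: real assume T: "0 \<le> T" and \<epsilon>: "0 < \<epsilon>"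
      have B: "0 \<le> B" using V2_nonneg[of 0] V2_upper[of 0] by linarith
      (* Below c only one of the pushes can increase; B bounds the second derivative of V. *)
      define \<eta> where "\<eta> = min (c / 2) (\<epsilon> / (B + 1))"
      have \<eta>: "0 < \<eta>" "\<eta> < c" using c_pos \<epsilon> B by (auto simp: \<eta>_def)
      have B\<eta>: "B * \<eta> \<le> \<epsilon>"
      proof -
        have "B * \<eta> \<le> (B + 1) * (\<epsilon> / (B + 1))" using B \<eta> by (intro mult_mono) (auto simp: \<eta>_def)
        then show ?thesis using B by simp
      qed
      obtain \<delta> where \<delta>: "0 < \<delta>" "\<And>u v. 0 \<le> u \<Longrightarrow> u \<le> T + 1 \<Longrightarrow> 0 \<le> v \<Longrightarrow> v \<le> T + 1 \<Longrightarrow> \<bar>u - v\<bar> < \<delta> \<Longrightarrow>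
          \<bar>(z + s * w u \<omega>) - (z + s * w v \<omega>)\<bar> \<le> \<eta>"
        using continuous_on_path_small_oscillation[OF R.f_cont \<eta>(1), of "T + 1"] by metis
      show "\<exists>\<delta>>0. \<forall>t d. 0 \<le> t \<and> t \<le> T \<and> 0 < d \<and> d < \<delta> \<longrightarrow> slack t d \<omega> \<le> \<epsilon> * (S (t + d) \<omega> - S t \<omega>)"
      proof (intro exI[of _ "min \<delta> 1"] conjI allI impI)
        fix t d assume td: "0 \<le> t \<and> t \<le> T \<and> 0 < d \<and> d < min \<delta> 1"
        have "slack t d \<omega> \<le> B * \<eta> * (S (t + d) \<omega> - S t \<omega>)"
        proof (rule reflected_slack[where \<alpha> = \<alpha> and \<beta> = \<beta>])
          show "reflected_path c (\<lambda>u. z + s * w u \<omega>) (\<lambda>t. \<alpha> t \<omega>) (\<lambda>t. \<beta> t \<omega>)" using a by blast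
          fix u v assume "t \<le> u" "u \<le> t + d" "t \<le> v" "v \<le> t + d"
          then show "\<bar>(z + s * w u \<omega>) - (z + s * w v \<omega>)\<bar> \<le> \<eta>" using td by (intro \<delta>(2)) auto
        qed (use a td \<eta> in auto)
        also have "\<dots> \<le> \<epsilon> * (S (t + d) \<omega> - S t \<omega>)"
        proof (rule mult_right_mono[OF B\<eta>])
          have "0 \<le> t" "0 \<le> t + d" "t \<le> t + d" using td by auto
          then show "0 \<le> S (t + d) \<omega> - S t \<omega>"
            using a R.a_mono[of t "t + d"] R.b_mono[of t "t + d"] by simp
        qed
        finally show "slack t d \<omega> \<le> \<epsilon> * (S (t + d) \<omega> - S t \<omega>)" .
      qed (use \<delta> in simp)
    qed
  qed
  show "AE \<omega> in M. (\<lambda>n. S (1 / real (Suc n)) \<omega>) \<longlonglongrightarrow> S 0 \<omega>"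
    using refl
  proof eventually_elim
    fix \<omega> assume a: "?refl \<omega>"
    interpret R: reflected_path c "\<lambda>u. z + s * w u \<omega>" "\<lambda>t. \<alpha> t \<omega>" "\<lambda>t. \<beta> t \<omega>" using a by blast
    have "continuous_on {0..} (\<lambda>t. \<alpha> t \<omega> + \<beta> t \<omega>)"
      by (intro continuous_intros R.a_continuous R.b_continuous)
    from continuous_on_tendsto_compose[OF this LIMSEQ_Suc[OF lim_1_over_n]]
    have "(\<lambda>n. \<alpha> (1 / real (Suc n)) \<omega> + \<beta> (1 / real (Suc n)) \<omega>) \<longlonglongrightarrow> \<alpha> 0 \<omega> + \<beta> 0 \<omega>" by simp
    then show "(\<lambda>n. S (1 / real (Suc n)) \<omega>) \<longlonglongrightarrow> S 0 \<omega>" using a by simp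
  qed
  show "AE \<omega> in M. V (Z 0 \<omega>) + k / 2 * S 0 \<omega> = V z"
    using refl space
  proof eventually_elim
    fix \<omega> assume a: "?refl \<omega>" and \<omega>: "\<omega> \<in> space M"
    have w0: "w 0 \<omega> = 0" by (rule brownian_motionD(6)[OF bm \<omega>])
    note jump = reflected_path.initial_jump[OF conjunct1[OF a], simplified w0, simplified]
    have Z0: "Z 0 \<omega> = z + \<beta> 0 \<omega> - \<alpha> 0 \<omega>" and S0: "S 0 \<omega> = \<alpha> 0 \<omega> + \<beta> 0 \<omega>" using a w0 by (simp_all add: Z_def)
    consider "\<bar>z\<bar> \<le> c" | "c \<le> z" | "z \<le> - c" by linarith
    then show "V (Z 0 \<omega>) + k / 2 * S 0 \<omega> = V z"
    proof cases
      case 1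
      then have "max 0 (z - c) = 0" "max 0 (- z - c) = 0" by auto
      then show ?thesis unfolding Z0 S0 jump by simp
    next
      case 2 then show ?thesis unfolding Z0 S0 jump using V_right[OF 2] c_pos by (simp add: max_def)
    next
      case 3 then show ?thesis unfolding Z0 S0 jump using V_right[of "- z"] V_even[of z] V_even[of c] c_pos
        by (simp add: max_def)
    qed
  qed
qed

end

section \<open>The two-player game\<close>

definition net_control :: "'a profile \<Rightarrow> 'a process" where
  "net_control \<zeta> t \<omega> = (fst (\<zeta> 1) t \<omega> - snd (\<zeta> 1) t \<omega>) - (fst (\<zeta> 2) t \<omega> - snd (\<zeta> 2) t \<omega>)"

definition total_effort :: "'a profile \<Rightarrow> 'a process" where
  "total_effort \<zeta> t \<omega> = (fst (\<zeta> 1) t \<omega> + snd (\<zeta> 1) t \<omega>) + (fst (\<zeta> 2) t \<omega> + snd (\<zeta> 2) t \<omega>)"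

text \<open>The coupled equations in the form in which the policies state them, with \<open>\<alpha>\<close> the downward and \<open>\<beta>\<close> the
  upward push of the gap.\<close>

definition drives_reflection ::
  "'a measure \<Rightarrow> (real \<Rightarrow> 'a \<Rightarrow> real ^ 'd) \<Rightarrow> real ^ 'd ^ 2 \<Rightarrow> real \<Rightarrow> real ^ 2 \<Rightarrow> 'a process \<Rightarrow> 'a process \<Rightarrow> bool" where
  "drives_reflection M B \<sigma> c x \<alpha> \<gamma> \<longleftrightarrow> (AE \<omega> in M. \<forall>t\<ge>0.
     \<alpha> t \<omega> = running_max0 (\<lambda>u. (x $ 1 - x $ 2) + (\<sigma> $ 1 - \<sigma> $ 2) \<bullet> B u \<omega> + \<gamma> u \<omega> - c) t \<and>
     \<gamma> t \<omega> = running_max0 (\<lambda>u. - (x $ 1 - x $ 2) + (\<sigma> $ 2 - \<sigma> $ 1) \<bullet> B u \<omega> + \<alpha> u \<omega> - c) t)"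

lemma sigma_tilde_norm: "sigma_tilde \<sigma> = norm (\<sigma> $ 1 - \<sigma> $ 2)"
  by (simp add: sigma_tilde_def norm_vec_def L2_set_def)

text \<open>Ellipticity is applied to the direction \<open>(1, -1)\<close>.\<close>

lemma sigma_tilde_pos:
  fixes \<sigma> :: "real ^ 'd ^ 2"
  assumes "0 < \<kappa>" "\<forall>y. y \<bullet> ((\<sigma> ** transpose \<sigma>) *v y) \<ge> \<kappa> * (y \<bullet> y)"
  shows "0 < sigma_tilde \<sigma>"
proof -
  define y :: "real ^ 2" where "y = vector [1, - 1]"
  have "y \<bullet> ((\<sigma> ** transpose \<sigma>) *v y) = y \<bullet> (\<sigma> *v (transpose \<sigma> *v y))"
    by (simp only: matrix_vector_mul_assoc)
  also have "\<dots> = (transpose \<sigma> *v y) \<bullet> (transpose \<sigma> *v y)"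
    by (simp only: dot_lmul_matrix[symmetric] transpose_matrix_vector)
  also have "transpose \<sigma> *v y = \<sigma> $ 1 - \<sigma> $ 2"
    by (simp add: vec_eq_iff matrix_vector_mult_def transpose_def sum_2 y_def vector_2)
  finally have "\<kappa> * (y \<bullet> y) \<le> (\<sigma> $ 1 - \<sigma> $ 2) \<bullet> (\<sigma> $ 1 - \<sigma> $ 2)" using assms(2) by metis
  moreover have "y \<bullet> y = 2" by (simp add: inner_vec_def sum_2 y_def vector_2)
  ultimately have "\<sigma> $ 1 - \<sigma> $ 2 \<noteq> 0" using assms(1) by auto
  then show ?thesis by (simp add: sigma_tilde_norm)
qed

text \<open>A dominating policy would have smaller total cost, strictly so because the costs are finite.\<close>

lemma pareto_optimal_of_regulator_optimal:
  assumes adm: "\<And>x. \<xi> x \<in> admissible M F \<rho>"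
    and opt: "\<And>x. regulator_cost M B \<sigma> \<rho> h K x (\<xi> x) = regulator_value M F B \<sigma> \<rho> h K x"
    and fin: "\<And>x. regulator_value M F B \<sigma> \<rho> h K x \<noteq> \<infinity>"
  shows "pareto_optimal M F B \<sigma> \<rho> h K \<xi>"
  unfolding pareto_optimal_def
proof (intro conjI allI notI adm)
  assume "\<exists>\<xi>'. (\<forall>x. \<xi>' x \<in> admissible M F \<rho>) \<and>
    (\<forall>x. (\<forall>i. cost M B \<sigma> \<rho> h K i x (\<xi>' x) \<le> cost M B \<sigma> \<rho> h K i x (\<xi> x)) \<and>
      (\<exists>j. cost M B \<sigma> \<rho> h K j x (\<xi>' x) < cost M B \<sigma> \<rho> h K j x (\<xi> x)))"
  then obtain \<xi>' where adm': "\<xi>' 0 \<in> admissible M F \<rho>"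
    and dom: "(\<forall>i. cost M B \<sigma> \<rho> h K i 0 (\<xi>' 0) \<le> cost M B \<sigma> \<rho> h K i 0 (\<xi> 0)) \<and>
      (\<exists>j. cost M B \<sigma> \<rho> h K j 0 (\<xi>' 0) < cost M B \<sigma> \<rho> h K j 0 (\<xi> 0))"
    by (elim exE conjE) (drule spec[of _ 0])+
  have le: "cost M B \<sigma> \<rho> h K i 0 (\<xi>' 0) \<le> cost M B \<sigma> \<rho> h K i 0 (\<xi> 0)" for i using dom by blast
  obtain j where lt: "cost M B \<sigma> \<rho> h K j 0 (\<xi>' 0) < cost M B \<sigma> \<rho> h K j 0 (\<xi> 0)" using dom by blast
  define C where "C i = cost M B \<sigma> \<rho> h K i 0 (\<xi> 0)" for i
  define C' where "C' i = cost M B \<sigma> \<rho> h K i 0 (\<xi>' 0)" for i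
  have nn: "0 \<le> C i" "0 \<le> C' i" for i unfolding C_def C'_def cost_def by simp_all
  have "ereal (1 / 2) * (C 1 + C 2) \<noteq> \<infinity>"
    using opt[of 0] fin[of 0] by (simp add: regulator_cost_def C_def)
  then have "C 1 \<noteq> \<infinity>" "C 2 \<noteq> \<infinity>" by auto
  then obtain c1 c2 where c: "C 1 = ereal c1" "C 2 = ereal c2"
    using nn(1)[of 1] nn(1)[of 2] by (metis ereal_cases ereal_infty_less_eq(2) MInfty_neq_ereal(1) zero_ereal_def)
  have le': "C' 1 \<le> C 1" "C' 2 \<le> C 2" using le by (auto simp: C_def C'_def)
  obtain c1' where c1': "C' 1 = ereal c1'" using nn(2)[of 1] le'(1) c(1) by (cases "C' 1") auto
  obtain c2' where c2': "C' 2 = ereal c2'" using nn(2)[of 2] le'(2) c(2) by (cases "C' 2") auto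
  note c' = c1' c2'
  have "C' j < C j" using lt by (simp add: C_def C'_def)
  moreover have "j = 1 \<or> j = 2" using exhaust_2 by blast
  ultimately have "c1' + c2' < c1 + c2" using le' unfolding c c' by (auto simp: c c')
  then have "regulator_cost M B \<sigma> \<rho> h K 0 (\<xi>' 0) < regulator_cost M B \<sigma> \<rho> h K 0 (\<xi> 0)"
    unfolding regulator_cost_def using c c' by (simp add: C_def C'_def)
  also have "\<dots> = regulator_value M F B \<sigma> \<rho> h K 0" by (rule opt)
  also have "\<dots> \<le> regulator_cost M B \<sigma> \<rho> h K 0 (\<xi>' 0)"
    unfolding regulator_value_def by (rule INF_lower[OF adm'])
  finally show False by simp
qed

text \<open>Both parts of the theorem are instances with \<open>k = K 2\<close> as the price of control: with equal prices
  either player may act, with \<open>K 1 > K 2\<close> the second player is the cheaper one.\<close>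

locale two_player_game = resolvent_cost +
  fixes M :: "'a measure" and F :: "real \<Rightarrow> 'a measure" and W :: "real \<Rightarrow> 'a \<Rightarrow> real ^ 'd"
    and \<sigma> :: "real ^ 'd ^ 2" and K :: "2 \<Rightarrow> real"
  assumes W_bm: "brownian_motion M F W" and s_eq: "s = sigma_tilde \<sigma>"
    and K_pos: "\<And>i. 0 < K i" and K_le: "K 2 \<le> K 1"
begin

sublocale M: prob_space M by (rule brownian_motionD[OF W_bm])
sublocale clock: prob_space "clock \<rho>" by (rule prob_space_clock[OF \<rho>_pos])
sublocale pair_prob_space "clock \<rho>" M ..

text \<open>The standard Brownian motion that drives the gap.\<close>

definition w :: "real \<Rightarrow> 'a \<Rightarrow> real" where "w t \<omega> = ((\<sigma> $ 1 - \<sigma> $ 2) /\<^sub>R s) \<bullet> W t \<omega>"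

lemma w_bm: "brownian_motion M F w"
  unfolding w_def[abs_def] using s_pos
  by (intro brownian_projection[OF W_bm]) (simp add: s_eq sigma_tilde_norm)

lemma s_w: "s * w t \<omega> = (\<sigma> $ 1 - \<sigma> $ 2) \<bullet> W t \<omega>"
  using s_pos by (simp add: w_def)

sublocale path: scaled_brownian M F w s z for z
  using w_bm s_pos by (rule scaled_brownian.intro)

definition gap :: "real ^ 2 \<Rightarrow> 'a profile \<Rightarrow> real \<Rightarrow> 'a \<Rightarrow> real" where
  "gap x \<zeta> t \<omega> = (x $ 1 - x $ 2) + s * w (max 0 t) \<omega> + net_control \<zeta> t \<omega>"

lemma state_difference:
  "0 \<le> t \<Longrightarrow> state W \<sigma> x \<zeta> 1 t \<omega> - state W \<sigma> x \<zeta> 2 t \<omega> = gap x \<zeta> t \<omega>"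
  unfolding state_def gap_def net_control_def using s_w[of t \<omega>] by (simp add: inner_diff_left)

abbreviation "Q \<equiv> clock \<rho> \<Otimes>\<^sub>M M"

definition running :: "real ^ 2 \<Rightarrow> 'a profile \<Rightarrow> ennreal" where
  "running x \<zeta> = (\<integral>\<^sup>+p. ennreal (h (gap x \<zeta> (fst p) (snd p)) / \<rho>) \<partial>Q)"

definition effort :: "'a process \<Rightarrow> ennreal" where
  "effort \<xi> = (\<integral>\<^sup>+p. ennreal (\<xi> (fst p) (snd p)) \<partial>Q)"

lemma filtration: "filtration_on M F" using W_bm by (simp add: brownian_motion_def)

lemma h_measurable [measurable]: "h \<in> borel_measurable borel"
  using DERIV_continuous_on[of UNIV h h1] h_deriv by (simp add: borel_measurable_continuous_onI)

lemma admissibleD: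
  assumes "\<zeta> \<in> admissible M F \<rho>"
  shows "admissible_process M F \<rho> (fst (\<zeta> i))" "admissible_process M F \<rho> (snd (\<zeta> i))"
  using assms by (auto simp: admissible_def)

lemma admissible_joint:
  assumes "admissible_process M F \<rho> \<xi>"
  shows "(\<lambda>p. \<xi> (fst p) (snd p)) \<in> borel_measurable (borel \<Otimes>\<^sub>M M)"
  using admissible_process_measurable(1)[OF assms filtration] by (simp add: case_prod_beta')

lemma effort_eq:
  assumes "admissible_process M F \<rho> \<xi>"
  shows "effort \<xi> = (\<integral>\<^sup>+\<omega>. discounted_effort \<rho> \<xi> \<omega> \<partial>M)"
proof -
  have "effort \<xi> = (\<integral>\<^sup>+\<omega>. (\<integral>\<^sup>+t. ennreal (\<xi> t \<omega>) \<partial>clock \<rho>) \<partial>M)"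
    unfolding effort_def using admissible_joint[OF assms]
    by (subst nn_integral_snd[symmetric]) auto
  also have "\<dots> = (\<integral>\<^sup>+\<omega>. discounted_effort \<rho> \<xi> \<omega> \<partial>M)"
    by (rule nn_integral_cong) (simp add: discounted_effort_eq[OF assms _ \<rho>_pos])
  finally show ?thesis .
qed

lemma effort_finite: "admissible_process M F \<rho> \<xi> \<Longrightarrow> effort \<xi> < \<infinity>"
  using effort_eq by (simp add: admissible_process_def)

lemma gap_joint:
  assumes "\<zeta> \<in> admissible M F \<rho>"
  shows "(\<lambda>p. gap x \<zeta> (fst p) (snd p)) \<in> borel_measurable (borel \<Otimes>\<^sub>M M)"
proof -
  note [measurable] = admissible_joint[OF admissibleD(1)[OF assms]] admissible_joint[OF admissibleD(2)[OF assms]]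
  have [measurable]: "(\<lambda>p. w (max 0 (fst p)) (snd p)) \<in> borel_measurable (borel \<Otimes>\<^sub>M M)"
    using brownian_jointly_measurable[OF w_bm] by (simp add: case_prod_beta')
  show ?thesis unfolding gap_def net_control_def by measurable
qed

lemma cost_eq:
  assumes \<zeta>: "\<zeta> \<in> admissible M F \<rho>"
  shows "cost M W \<sigma> \<rho> h K i x \<zeta>
    = enn2ereal (running x \<zeta> + ennreal (K i) * (effort (fst (\<zeta> i)) + effort (snd (\<zeta> i))))"
proof -
  define f where "f p = ennreal (h (gap x \<zeta> (fst p) (snd p)) / \<rho>)" for p
  define g1 where "g1 p = ennreal (fst (\<zeta> i) (fst p) (snd p))" for p
  define g2 where "g2 p = ennreal (snd (\<zeta> i) (fst p) (snd p))" for p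
  note adm = admissibleD[OF \<zeta>, of i]
  have meas [measurable]: "f \<in> borel_measurable (borel \<Otimes>\<^sub>M M)" "g1 \<in> borel_measurable (borel \<Otimes>\<^sub>M M)" "g2 \<in> borel_measurable (borel \<Otimes>\<^sub>M M)"
    unfolding f_def g1_def g2_def using gap_joint[OF \<zeta>] admissible_joint[OF adm(1)] admissible_joint[OF adm(2)]
    by measurable
  have "(\<integral>\<^sup>+ \<omega>. (\<integral>\<^sup>+ t\<in>{0..}. ennreal (exp (- \<rho> * t) * h (state W \<sigma> x \<zeta> 1 t \<omega> - state W \<sigma> x \<zeta> 2 t \<omega>)) \<partial>lborel)
      + ennreal (K i) * discounted_effort \<rho> (fst (\<zeta> i)) \<omega> + ennreal (K i) * discounted_effort \<rho> (snd (\<zeta> i)) \<omega> \<partial>M)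
    = (\<integral>\<^sup>+ \<omega>. (\<integral>\<^sup>+ t. f (t, \<omega>) + ennreal (K i) * (g1 (t, \<omega>) + g2 (t, \<omega>)) \<partial>clock \<rho>) \<partial>M)"
  proof (rule nn_integral_cong)
    fix \<omega> assume \<omega>: "\<omega> \<in> space M"
    note pm = measurable_compose[OF measurable_Pair2'[OF \<omega>]]
    have [measurable]: "(\<lambda>t. f (t, \<omega>)) \<in> borel_measurable borel" "(\<lambda>t. g1 (t, \<omega>)) \<in> borel_measurable borel"
      "(\<lambda>t. g2 (t, \<omega>)) \<in> borel_measurable borel"
      by (rule pm[OF meas(1)] pm[OF meas(2)] pm[OF meas(3)])+
    have "(\<integral>\<^sup>+ t\<in>{0..}. ennreal (exp (- \<rho> * t) * h (state W \<sigma> x \<zeta> 1 t \<omega> - state W \<sigma> x \<zeta> 2 t \<omega>)) \<partial>lborel)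
        = (\<integral>\<^sup>+ t\<in>{0..}. ennreal (\<rho> * exp (- \<rho> * t)) * f (t, \<omega>) \<partial>lborel)"
    proof (rule nn_integral_cong)
      fix t :: real
      have "ennreal (exp (- \<rho> * t) * h (gap x \<zeta> t \<omega>)) = ennreal (\<rho> * exp (- \<rho> * t)) * f (t, \<omega>)"
        unfolding f_def using \<rho>_pos h_nonneg by (simp flip: ennreal_mult)
      then show "ennreal (exp (- \<rho> * t) * h (state W \<sigma> x \<zeta> 1 t \<omega> - state W \<sigma> x \<zeta> 2 t \<omega>)) * indicator {0..} t
          = ennreal (\<rho> * exp (- \<rho> * t)) * f (t, \<omega>) * indicator {0..} t"
        using state_difference[of t x \<zeta> \<omega>] by (simp split: split_indicator)
    qed
    also have "\<dots> = (\<integral>\<^sup>+ t. f (t, \<omega>) \<partial>clock \<rho>)"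
      by (rule nn_integral_clock[OF \<rho>_pos, symmetric]) measurable
    finally show "(\<integral>\<^sup>+ t\<in>{0..}. ennreal (exp (- \<rho> * t) * h (state W \<sigma> x \<zeta> 1 t \<omega> - state W \<sigma> x \<zeta> 2 t \<omega>)) \<partial>lborel)
      + ennreal (K i) * discounted_effort \<rho> (fst (\<zeta> i)) \<omega> + ennreal (K i) * discounted_effort \<rho> (snd (\<zeta> i)) \<omega>
      = (\<integral>\<^sup>+ t. f (t, \<omega>) + ennreal (K i) * (g1 (t, \<omega>) + g2 (t, \<omega>)) \<partial>clock \<rho>)"
      unfolding discounted_effort_eq[OF adm(1) \<omega> \<rho>_pos] discounted_effort_eq[OF adm(2) \<omega> \<rho>_pos]
      by (simp add: nn_integral_add nn_integral_cmult g1_def[symmetric] g2_def[symmetric] distrib_left add.assoc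
          flip: g1_def[of "(_, \<omega>)", simplified] g2_def[of "(_, \<omega>)", simplified])
  qed
  also have "\<dots> = (\<integral>\<^sup>+ p. f p + ennreal (K i) * (g1 p + g2 p) \<partial>Q)"
    by (rule nn_integral_snd) measurable
  also have "\<dots> = running x \<zeta> + ennreal (K i) * (effort (fst (\<zeta> i)) + effort (snd (\<zeta> i)))"
    unfolding running_def effort_def f_def[symmetric] g1_def[symmetric] g2_def[symmetric]
    by (simp add: nn_integral_add nn_integral_cmult)
  finally show ?thesis unfolding cost_def by simp
qed

lemma regulator_cost_eq:
  assumes \<zeta>: "\<zeta> \<in> admissible M F \<rho>"
  shows "regulator_cost M W \<sigma> \<rho> h K x \<zeta> = enn2ereal (running x \<zeta>
    + ennreal (K 1 / 2) * (effort (fst (\<zeta> 1)) + effort (snd (\<zeta> 1)))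
    + ennreal (K 2 / 2) * (effort (fst (\<zeta> 2)) + effort (snd (\<zeta> 2))))"
proof -
  define R where "R = running x \<zeta>"
  define E where "E i = effort (fst (\<zeta> i)) + effort (snd (\<zeta> i))" for i
  have half: "ereal (1 / 2) = enn2ereal (ennreal (1 / 2))" by (rule enn2ereal_ennreal[symmetric]) simp
  have "regulator_cost M W \<sigma> \<rho> h K x \<zeta> = enn2ereal (ennreal (1 / 2) * ((R + ennreal (K 1) * E 1) + (R + ennreal (K 2) * E 2)))"
    unfolding regulator_cost_def cost_eq[OF \<zeta>] R_def E_def half
    by (simp only: times_ennreal.rep_eq plus_ennreal.rep_eq)
  also have "ennreal (1 / 2) * ((R + ennreal (K 1) * E 1) + (R + ennreal (K 2) * E 2))
      = (ennreal (1 / 2) + ennreal (1 / 2)) * R + (ennreal (1 / 2) * ennreal (K 1)) * E 1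
        + (ennreal (1 / 2) * ennreal (K 2)) * E 2"
    by (simp only: distrib_left distrib_right ac_simps)
  also have "\<dots> = R + ennreal (K 1 / 2) * E 1 + ennreal (K 2 / 2) * E 2"
  proof -
    have "ennreal (1 / 2) + ennreal (1 / 2) = 1" by (subst ennreal_plus[symmetric]) auto
    moreover have "ennreal (1 / 2) * ennreal (K i) = ennreal (K i / 2)" for i
      using K_pos[of i] by (subst ennreal_mult[symmetric]) auto
    ultimately show ?thesis by (simp only: mult_1)
  qed
  finally show ?thesis unfolding R_def E_def .
qed

lemma weighted_functional:
  assumes \<zeta>: "\<zeta> \<in> admissible M F \<rho>" and k: "0 < k"
  shows "(\<integral>\<^sup>+p. ennreal (h (gap x \<zeta> (fst p) (snd p)) / \<rho> + k / 2 * total_effort \<zeta> (fst p) (snd p)) \<partial>Q)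
    = running x \<zeta> + ennreal (k / 2) * (effort (fst (\<zeta> 1)) + effort (snd (\<zeta> 1)))
      + ennreal (k / 2) * (effort (fst (\<zeta> 2)) + effort (snd (\<zeta> 2)))"
proof -
  note [measurable] = gap_joint[OF \<zeta>] admissible_joint[OF admissibleD(1)[OF \<zeta>]] admissible_joint[OF admissibleD(2)[OF \<zeta>]]
  have "(\<integral>\<^sup>+p. ennreal (h (gap x \<zeta> (fst p) (snd p)) / \<rho> + k / 2 * total_effort \<zeta> (fst p) (snd p)) \<partial>Q)
    = (\<integral>\<^sup>+p. ennreal (h (gap x \<zeta> (fst p) (snd p)) / \<rho>)
      + ennreal (k / 2) * (ennreal (fst (\<zeta> 1) (fst p) (snd p)) + ennreal (snd (\<zeta> 1) (fst p) (snd p)))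
      + ennreal (k / 2) * (ennreal (fst (\<zeta> 2) (fst p) (snd p)) + ennreal (snd (\<zeta> 2) (fst p) (snd p))) \<partial>Q)"
  proof (rule nn_integral_cong)
    fix p assume "p \<in> space Q"
    then have \<omega>: "snd p \<in> space M" by (auto simp: space_pair_measure)
    have nn: "0 \<le> fst (\<zeta> i) (fst p) (snd p)" "0 \<le> snd (\<zeta> i) (fst p) (snd p)" for i
      using admissible_processD(4)[OF admissibleD(1)[OF \<zeta>] \<omega>] admissible_processD(4)[OF admissibleD(2)[OF \<zeta>] \<omega>] by auto
    show "ennreal (h (gap x \<zeta> (fst p) (snd p)) / \<rho> + k / 2 * total_effort \<zeta> (fst p) (snd p))
      = ennreal (h (gap x \<zeta> (fst p) (snd p)) / \<rho>)
      + ennreal (k / 2) * (ennreal (fst (\<zeta> 1) (fst p) (snd p)) + ennreal (snd (\<zeta> 1) (fst p) (snd p)))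
      + ennreal (k / 2) * (ennreal (fst (\<zeta> 2) (fst p) (snd p)) + ennreal (snd (\<zeta> 2) (fst p) (snd p)))"
      unfolding total_effort_def using nn h_nonneg \<rho>_pos k
      by (simp add: distrib_left ennreal_plus[symmetric] ennreal_mult[symmetric] add.assoc del: ennreal_plus)
  qed
  also have "\<dots> = running x \<zeta> + ennreal (k / 2) * (effort (fst (\<zeta> 1)) + effort (snd (\<zeta> 1)))
      + ennreal (k / 2) * (effort (fst (\<zeta> 2)) + effort (snd (\<zeta> 2)))"
    unfolding running_def effort_def by (simp add: nn_integral_add nn_integral_cmult)
  finally show ?thesis .
qed

lemma controlled_difference_instance:
  assumes bv: "barrier_value \<rho> s k c L B' h V V1 V2" and \<zeta>: "\<zeta> \<in> admissible M F \<rho>"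
  shows "controlled_difference \<rho> s k c L B' h V V1 V2 M F w (net_control \<zeta>) (total_effort \<zeta>)"
proof (intro controlled_difference.intro[OF bv] controlled_difference_axioms.intro)
  note pr = admissible_processD[OF admissibleD(1)[OF \<zeta>]] admissible_processD[OF admissibleD(2)[OF \<zeta>]]
  note [measurable] = admissible_joint[OF admissibleD(1)[OF \<zeta>]] admissible_joint[OF admissibleD(2)[OF \<zeta>]]
  show "brownian_motion M F w" by (rule w_bm)
  show "net_control \<zeta> t \<in> borel_measurable (F t)" if "0 \<le> t" for t
    unfolding net_control_def[abs_def]
    using admissible_process_measurable(2)[OF admissibleD(1)[OF \<zeta>] filtration that]
      admissible_process_measurable(2)[OF admissibleD(2)[OF \<zeta>] filtration that] by measurable
  show "(\<lambda>(t, \<omega>). net_control \<zeta> t \<omega>) \<in> borel_measurable (borel \<Otimes>\<^sub>M M)"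
    unfolding net_control_def case_prod_beta' by measurable
  show "(\<lambda>(t, \<omega>). total_effort \<zeta> t \<omega>) \<in> borel_measurable (borel \<Otimes>\<^sub>M M)"
    unfolding total_effort_def case_prod_beta' by measurable
  show "\<bar>net_control \<zeta> t \<omega> - net_control \<zeta> r \<omega>\<bar> \<le> total_effort \<zeta> t \<omega> - total_effort \<zeta> r \<omega>"
    if "\<omega> \<in> space M" "0 \<le> r" "r \<le> t" for \<omega> r t
    using pr(5)[OF that(1,3), of 1] pr(5)[OF that(1,3), of 2] pr(11)[OF that(1,3), of 1] pr(11)[OF that(1,3), of 2]
    unfolding net_control_def total_effort_def by linarith
  show "\<bar>net_control \<zeta> 0 \<omega>\<bar> \<le> total_effort \<zeta> 0 \<omega>" if "\<omega> \<in> space M" for \<omega>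
    using pr(4)[OF that, of 1 0] pr(4)[OF that, of 2 0] pr(10)[OF that, of 1 0] pr(10)[OF that, of 2 0]
    unfolding net_control_def total_effort_def by linarith
  have "(\<integral>\<^sup>+p. ennreal (total_effort \<zeta> (fst p) (snd p)) \<partial>Q)
      = effort (fst (\<zeta> 1)) + effort (snd (\<zeta> 1)) + (effort (fst (\<zeta> 2)) + effort (snd (\<zeta> 2)))"
  proof -
    have "(\<integral>\<^sup>+p. ennreal (total_effort \<zeta> (fst p) (snd p)) \<partial>Q)
      = (\<integral>\<^sup>+p. (ennreal (fst (\<zeta> 1) (fst p) (snd p)) + ennreal (snd (\<zeta> 1) (fst p) (snd p)))
        + (ennreal (fst (\<zeta> 2) (fst p) (snd p)) + ennreal (snd (\<zeta> 2) (fst p) (snd p))) \<partial>Q)"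
      by (rule nn_integral_cong)
        (auto simp: total_effort_def space_pair_measure pr(4) pr(10) ennreal_plus)
    then show ?thesis unfolding effort_def by (simp add: nn_integral_add)
  qed
  then show "(\<integral>\<^sup>+p. ennreal (total_effort \<zeta> (fst p) (snd p)) \<partial>Q) < \<infinity>"
    using effort_finite[OF admissibleD(1)[OF \<zeta>]] effort_finite[OF admissibleD(2)[OF \<zeta>]] by simp
qed

lemma regulator_cost_lower:
  assumes bv: "barrier_value \<rho> s (K 2) c L B' h V V1 V2" and \<zeta>: "\<zeta> \<in> admissible M F \<rho>"
  shows "ereal (V (x $ 1 - x $ 2)) \<le> regulator_cost M W \<sigma> \<rho> h K x \<zeta>"
proof -
  interpret D: controlled_difference \<rho> s "K 2" c L B' h V V1 V2 M F w "net_control \<zeta>" "total_effort \<zeta>" "x $ 1 - x $ 2"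
    by (rule controlled_difference_instance[OF bv \<zeta>])
  have Z: "D.Z = gap x \<zeta>" by (intro ext) (simp add: D.Z_def gap_def)
  have "ennreal (V (x $ 1 - x $ 2)) \<le> running x \<zeta> + ennreal (K 2 / 2) * (effort (fst (\<zeta> 1)) + effort (snd (\<zeta> 1)))
      + ennreal (K 2 / 2) * (effort (fst (\<zeta> 2)) + effort (snd (\<zeta> 2)))"
    using D.value_lower_bound unfolding Z weighted_functional[OF \<zeta> K_pos] .
  also have "\<dots> \<le> running x \<zeta> + ennreal (K 1 / 2) * (effort (fst (\<zeta> 1)) + effort (snd (\<zeta> 1)))
      + ennreal (K 2 / 2) * (effort (fst (\<zeta> 2)) + effort (snd (\<zeta> 2)))"
    using K_le by (intro add_right_mono add_left_mono mult_right_mono ennreal_leI) auto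
  finally have "enn2ereal (ennreal (V (x $ 1 - x $ 2))) \<le> regulator_cost M W \<sigma> \<rho> h K x \<zeta>"
    unfolding regulator_cost_eq[OF \<zeta>] by (simp add: less_eq_ennreal.rep_eq)
  then show ?thesis using D.V_nonneg by (simp add: enn2ereal_ennreal)
qed

text \<open>The regulator's cost reduces to the one-dimensional functional with price \<open>K 2\<close> when the prices are
  equal or the first player is idle.\<close>

lemma regulator_cost_upper:
  assumes bv: "barrier_value \<rho> s (K 2) c L B' h V V1 V2" and \<zeta>: "\<zeta> \<in> admissible M F \<rho>"
    and \<alpha>\<gamma>: "admissible_process M F \<rho> \<alpha>" "admissible_process M F \<rho> \<gamma>"
    and drives: "drives_reflection M W \<sigma> c x \<alpha> \<gamma>"
    and split: "AE \<omega> in M. \<forall>t\<ge>0. net_control \<zeta> t \<omega> = \<gamma> t \<omega> - \<alpha> t \<omega> \<and> total_effort \<zeta> t \<omega> = \<alpha> t \<omega> + \<gamma> t \<omega>"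
    and cheap: "K 1 = K 2 \<or> (AE \<omega> in M. \<forall>t\<ge>0. fst (\<zeta> 1) t \<omega> = 0 \<and> snd (\<zeta> 1) t \<omega> = 0)"
  shows "regulator_cost M W \<sigma> \<rho> h K x \<zeta> \<le> ereal (V (x $ 1 - x $ 2))"
proof -
  interpret D: controlled_difference \<rho> s "K 2" c L B' h V V1 V2 M F w "net_control \<zeta>" "total_effort \<zeta>" "x $ 1 - x $ 2"
    by (rule controlled_difference_instance[OF bv \<zeta>])
  have Z: "D.Z = gap x \<zeta>" by (intro ext) (simp add: D.Z_def gap_def)
  have refl: "AE \<omega> in M. reflected_path c (\<lambda>u. x $ 1 - x $ 2 + s * w u \<omega>) (\<lambda>t. \<alpha> t \<omega>) (\<lambda>t. \<gamma> t \<omega>) \<and>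
    (\<forall>t\<ge>0. net_control \<zeta> t \<omega> = \<gamma> t \<omega> - \<alpha> t \<omega> \<and> total_effort \<zeta> t \<omega> = \<alpha> t \<omega> + \<gamma> t \<omega>)"
    using drives[unfolded drives_reflection_def] split AE_space
  proof eventually_elim
    fix \<omega> assume sys: "\<forall>t\<ge>0. \<alpha> t \<omega> = running_max0 (\<lambda>u. (x $ 1 - x $ 2) + (\<sigma> $ 1 - \<sigma> $ 2) \<bullet> W u \<omega> + \<gamma> u \<omega> - c) t \<and>
        \<gamma> t \<omega> = running_max0 (\<lambda>u. - (x $ 1 - x $ 2) + (\<sigma> $ 2 - \<sigma> $ 1) \<bullet> W u \<omega> + \<alpha> u \<omega> - c) t"
      and dec: "\<forall>t\<ge>0. net_control \<zeta> t \<omega> = \<gamma> t \<omega> - \<alpha> t \<omega> \<and> total_effort \<zeta> t \<omega> = \<alpha> t \<omega> + \<gamma> t \<omega>"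
      and \<omega>: "\<omega> \<in> space M"
    have flip: "- (x $ 1 - x $ 2) + (\<sigma> $ 2 - \<sigma> $ 1) \<bullet> W u \<omega> = - (x $ 1 - x $ 2 + s * w u \<omega>)" for u
      unfolding s_w by (simp add: inner_diff_left)
    have "reflects c (\<lambda>u. x $ 1 - x $ 2 + s * w u \<omega>) (\<lambda>t. \<alpha> t \<omega>) (\<lambda>t. \<gamma> t \<omega>)"
      using sys unfolding reflects_def flip s_w by simp
    then have "reflected_path c (\<lambda>u. x $ 1 - x $ 2 + s * w u \<omega>) (\<lambda>t. \<alpha> t \<omega>) (\<lambda>t. \<gamma> t \<omega>)"
      using admissible_processD(5)[OF \<alpha>\<gamma>(1) \<omega>] admissible_processD(5)[OF \<alpha>\<gamma>(2) \<omega>] path.path_continuous[OF \<omega>]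
      by (intro reflected_path.intro D.c_pos)
    then show "reflected_path c (\<lambda>u. x $ 1 - x $ 2 + s * w u \<omega>) (\<lambda>t. \<alpha> t \<omega>) (\<lambda>t. \<gamma> t \<omega>) \<and>
      (\<forall>t\<ge>0. net_control \<zeta> t \<omega> = \<gamma> t \<omega> - \<alpha> t \<omega> \<and> total_effort \<zeta> t \<omega> = \<alpha> t \<omega> + \<gamma> t \<omega>)" using dec by blast
  qed
  have weights: "ennreal (K 1 / 2) * (effort (fst (\<zeta> 1)) + effort (snd (\<zeta> 1)))
      = ennreal (K 2 / 2) * (effort (fst (\<zeta> 1)) + effort (snd (\<zeta> 1)))"
  proof (cases "K 1 = K 2")
    case False
    then have idle: "AE \<omega> in M. \<forall>t\<ge>0. fst (\<zeta> 1) t \<omega> = 0 \<and> snd (\<zeta> 1) t \<omega> = 0" using cheap by blast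
    have zero: "effort \<xi> = 0" if adm: "admissible_process M F \<rho> \<xi>" and z: "AE \<omega> in M. \<forall>t\<ge>0. \<xi> t \<omega> = 0" for \<xi>
    proof -
      have "AE \<omega> in M. discounted_effort \<rho> \<xi> \<omega> = 0"
        using z AE_space
      proof eventually_elim
        fix \<omega> assume zz: "\<forall>t\<ge>0. \<xi> t \<omega> = 0" and \<omega>: "\<omega> \<in> space M"
        have "(\<integral>\<^sup>+ t. ennreal (\<xi> t \<omega>) \<partial>clock \<rho>) = (\<integral>\<^sup>+ t. 0 \<partial>clock \<rho>)"
          by (rule nn_integral_cong_AE) (use AE_clock_nonneg in \<open>eventually_elim, simp add: zz\<close>)
        then show "discounted_effort \<rho> \<xi> \<omega> = 0" unfolding discounted_effort_eq[OF adm \<omega> \<rho>_pos] by simp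
      qed
      then have "(\<integral>\<^sup>+\<omega>. discounted_effort \<rho> \<xi> \<omega> \<partial>M) = (\<integral>\<^sup>+\<omega>. 0 \<partial>M)" by (rule nn_integral_cong_AE)
      then show ?thesis unfolding effort_eq[OF adm] by simp
    qed
    have "effort (fst (\<zeta> 1)) = 0" "effort (snd (\<zeta> 1)) = 0"
      using idle by (auto intro!: zero admissibleD[OF \<zeta>] elim: eventually_mono)
    then show ?thesis by simp
  qed simp
  have "running x \<zeta> + ennreal (K 2 / 2) * (effort (fst (\<zeta> 1)) + effort (snd (\<zeta> 1)))
      + ennreal (K 2 / 2) * (effort (fst (\<zeta> 2)) + effort (snd (\<zeta> 2))) \<le> ennreal (V (x $ 1 - x $ 2))"
    using D.reflection_attains_value[OF refl] unfolding Z weighted_functional[OF \<zeta> K_pos] .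
  then have "regulator_cost M W \<sigma> \<rho> h K x \<zeta> \<le> enn2ereal (ennreal (V (x $ 1 - x $ 2)))"
    unfolding regulator_cost_eq[OF \<zeta>] weights by (simp add: less_eq_ennreal.rep_eq)
  then show ?thesis using D.V_nonneg by (simp add: enn2ereal_ennreal)
qed

lemma reflecting_processes_exist:
  assumes c: "0 < c"
  obtains \<alpha> \<gamma> where "\<And>x. admissible_process M F \<rho> (\<alpha> x)" "\<And>x. admissible_process M F \<rho> (\<gamma> x)"
    "\<And>x. drives_reflection M W \<sigma> c x (\<alpha> x) (\<gamma> x)"
proof -
  define \<alpha> where "\<alpha> x t \<omega> = push c (\<lambda>u. (x $ 1 - x $ 2) + s * w u \<omega>) t" for x :: "real ^ 2" and t \<omega>
  define \<gamma> where "\<gamma> x t \<omega> = push c (\<lambda>u. - ((x $ 1 - x $ 2) + s * w u \<omega>)) t" for x :: "real ^ 2" and t \<omega>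
  show ?thesis
  proof (rule that[of \<alpha> \<gamma>])
    fix x :: "real ^ 2"
    show "admissible_process M F \<rho> (\<alpha> x)" "admissible_process M F \<rho> (\<gamma> x)"
      unfolding \<alpha>_def[abs_def] \<gamma>_def[abs_def] by (rule path.push_processes_admissible[OF c \<rho>_pos])+
    show "drives_reflection M W \<sigma> c x (\<alpha> x) (\<gamma> x)"
      unfolding drives_reflection_def
    proof (rule AE_I2)
      fix \<omega> assume \<omega>: "\<omega> \<in> space M"
      have flip: "- (x $ 1 - x $ 2) + (\<sigma> $ 2 - \<sigma> $ 1) \<bullet> W u \<omega> = - (x $ 1 - x $ 2 + s * w u \<omega>)" for u
        unfolding s_w by (simp add: inner_diff_left)
      show "\<forall>t\<ge>0. \<alpha> x t \<omega> = running_max0 (\<lambda>u. (x $ 1 - x $ 2) + (\<sigma> $ 1 - \<sigma> $ 2) \<bullet> W u \<omega> + \<gamma> x u \<omega> - c) t \<and>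
        \<gamma> x t \<omega> = running_max0 (\<lambda>u. - (x $ 1 - x $ 2) + (\<sigma> $ 2 - \<sigma> $ 1) \<bullet> W u \<omega> + \<alpha> x u \<omega> - c) t"
        using push_reflects[OF c path.path_continuous[OF \<omega>], of "x $ 1 - x $ 2"]
        unfolding flip s_w[symmetric] reflects_def \<alpha>_def \<gamma>_def by simp
    qed
  qed
qed

lemma zero_process_admissible: "admissible_process M F \<rho> (\<lambda>t \<omega>. 0)"
  by (rule continuous_process_admissible[OF W_bm]) (use \<rho>_pos in auto)

text \<open>The conclusion shared by the two parts, for an arbitrary predicate \<open>R\<close> that describes the policies:
  \<open>sound\<close> extracts the two pushes of the gap from a policy, \<open>complete\<close> builds a policy from them.\<close>

lemma game_solution:
  assumes c: "boundary_equation s \<rho> P (K 2) c"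
    and sound: "\<And>\<xi> x. R \<xi> \<Longrightarrow> (\<And>x. \<xi> x \<in> admissible M F \<rho>) \<Longrightarrow> \<exists>\<alpha> \<gamma>.
      admissible_process M F \<rho> \<alpha> \<and> admissible_process M F \<rho> \<gamma> \<and> drives_reflection M W \<sigma> c x \<alpha> \<gamma> \<and>
      (AE \<omega> in M. \<forall>t\<ge>0. net_control (\<xi> x) t \<omega> = \<gamma> t \<omega> - \<alpha> t \<omega> \<and> total_effort (\<xi> x) t \<omega> = \<alpha> t \<omega> + \<gamma> t \<omega>) \<and>
      (K 1 = K 2 \<or> (AE \<omega> in M. \<forall>t\<ge>0. fst (\<xi> x 1) t \<omega> = 0 \<and> snd (\<xi> x 1) t \<omega> = 0))"
    and complete: "\<And>\<alpha> \<gamma>. (\<And>x. admissible_process M F \<rho> (\<alpha> x)) \<Longrightarrow> (\<And>x. admissible_process M F \<rho> (\<gamma> x)) \<Longrightarrow>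
      (\<And>x. drives_reflection M W \<sigma> c x (\<alpha> x) (\<gamma> x)) \<Longrightarrow> \<exists>\<xi>. (\<forall>x. \<xi> x \<in> admissible M F \<rho>) \<and> R \<xi>"
  shows "(\<exists>\<xi>. (\<forall>x. \<xi> x \<in> admissible M F \<rho>) \<and> R \<xi>) \<and>
    (\<forall>\<xi>. (\<forall>x. \<xi> x \<in> admissible M F \<rho>) \<and> R \<xi> \<longrightarrow> pareto_optimal M F W \<sigma> \<rho> h K \<xi> \<and>
      (\<forall>x. regulator_cost M W \<sigma> \<rho> h K x (\<xi> x) = regulator_value M F W \<sigma> \<rho> h K x)) \<and>
    value_formula s \<rho> P (K 2) c (regulator_value M F W \<sigma> \<rho> h K)"
proof -
  interpret barrier_problem \<rho> s a b h h1 h2 B P P1 P2 P3 "K 2" c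
    by unfold_locales (use c K_pos in auto)
  obtain V V1 V2 L where bv: "barrier_value \<rho> s (K 2) c L B h V V1 V2"
    and V_in: "\<And>z. \<bar>z\<bar> \<le> c \<Longrightarrow> V z = P z - amplitude * cosh (\<beta> * z)"
    by (rule barrier_value_exists) (rule that)
  interpret V: barrier_value \<rho> s "K 2" c L B h V V1 V2 by (rule bv)
  define v where "v = regulator_value M F W \<sigma> \<rho> h K"
  have opt: "regulator_cost M W \<sigma> \<rho> h K x (\<xi> x) = ereal (V (x $ 1 - x $ 2))"
    if "\<And>x. \<xi> x \<in> admissible M F \<rho>" "R \<xi>" for \<xi> x
  proof (rule antisym)
    show "ereal (V (x $ 1 - x $ 2)) \<le> regulator_cost M W \<sigma> \<rho> h K x (\<xi> x)"
      by (rule regulator_cost_lower[OF bv that(1)])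
    show "regulator_cost M W \<sigma> \<rho> h K x (\<xi> x) \<le> ereal (V (x $ 1 - x $ 2))"
      using sound[OF that(2,1), of x] regulator_cost_upper[OF bv that(1)] by blast
  qed
  obtain \<alpha> \<gamma>' where "\<And>x. admissible_process M F \<rho> (\<alpha> x)" "\<And>x. admissible_process M F \<rho> (\<gamma>' x)"
    "\<And>x. drives_reflection M W \<sigma> c x (\<alpha> x) (\<gamma>' x)"
    using reflecting_processes_exist[OF c_pos] by blast
  from complete[OF this] obtain \<xi>0 where \<xi>0: "\<And>x. \<xi>0 x \<in> admissible M F \<rho>" "R \<xi>0" by blast
  have v_eq: "v x = ereal (V (x $ 1 - x $ 2))" for x
  proof (rule antisym)
    show "v x \<le> ereal (V (x $ 1 - x $ 2))"
      unfolding v_def regulator_value_def opt[OF \<xi>0, symmetric] by (rule INF_lower[OF \<xi>0(1)])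
    show "ereal (V (x $ 1 - x $ 2)) \<le> v x"
      unfolding v_def regulator_value_def by (rule INF_greatest) (rule regulator_cost_lower[OF bv])
  qed
  have "pareto_optimal M F W \<sigma> \<rho> h K \<xi> \<and> (\<forall>x. regulator_cost M W \<sigma> \<rho> h K x (\<xi> x) = v x)"
    if "\<forall>x. \<xi> x \<in> admissible M F \<rho>" "R \<xi>" for \<xi>
    using that opt[of \<xi>] v_eq
    by (auto intro!: pareto_optimal_of_regulator_optimal simp: v_def)
  moreover have "value_formula s \<rho> P (K 2) c v"
    unfolding value_formula_def
  proof (intro allI conjI impI)
    fix x1 x2 :: real
    have dP: "deriv P = P1" using P_deriv by (intro ext DERIV_imp_deriv) auto
    have dP1: "deriv P1 = P2" using P1_deriv by (intro ext DERIV_imp_deriv) auto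
    show "v (vector [x1, x2]) = ereal (- (s\<^sup>2 * deriv (deriv P) c * cosh ((x1 - x2) * (sqrt (2 * \<rho>) / s)))
        / (2 * \<rho> * cosh (c * (sqrt (2 * \<rho>) / s))) + P (x1 - x2))" if "0 \<le> x1 - x2 \<and> x1 - x2 \<le> c"
    proof -
      have "V (x1 - x2) = P (x1 - x2) - amplitude * cosh (\<beta> * (x1 - x2))" using that by (intro V_in) auto
      moreover have "amplitude = s\<^sup>2 * P2 c / (2 * \<rho> * cosh (\<beta> * c))"
        unfolding amplitude_def s2_\<beta>2[symmetric] using s_pos by simp
      ultimately show ?thesis
        unfolding v_eq dP dP1 \<beta>_def[symmetric] by (simp add: vector_2 mult.commute)
    qed
    show "v (vector [x1, x2]) = v (vector [x2 + c, x2]) + ereal (K 2 / 2 * (x1 - x2 - c))" if "c \<le> x1 - x2"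
      using V.V_right[OF that] by (simp add: v_eq vector_2)
    show "v (vector [x1, x2]) = v (vector [- x1, - x2])" if "x1 - x2 < 0"
      using V.V_even[of "x1 - x2"] by (simp add: v_eq vector_2)
  qed
  ultimately show ?thesis using \<xi>0 unfolding v_def by blast
qed

end

theorem proposition16:
  fixes M :: "'a measure" and F :: "real \<Rightarrow> 'a measure"
    and B :: "real \<Rightarrow> 'a \<Rightarrow> real ^ 'd" and \<sigma> :: "real ^ 'd ^ 2"
    and N :: "'w measure" and W :: "real \<Rightarrow> 'w \<Rightarrow> real"
    and \<rho> \<kappa> :: real and h :: "real \<Rightarrow> real" and K :: "2 \<Rightarrow> real"
  assumes "brownian_motion M F B"
    and "brownian_motion N (natural_filtration N W) W"
    and "\<rho> > 0"
    and "\<kappa> > 0" and "\<forall>y. y \<bullet> ((\<sigma> ** transpose \<sigma>) *v y) \<ge> \<kappa> * (y \<bullet> y)"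
    and "\<forall>n<3. (deriv ^^ n) h differentiable_on UNIV" and "continuous_on UNIV ((deriv ^^ 3) h)"
    and "\<forall>y. h y \<ge> 0" and "\<forall>y. h (- y) = h y"
    and "\<exists>a b. 0 < a \<and> a < b \<and> (\<forall>y. a < deriv (deriv h) y \<and> deriv (deriv h) y < b)"
    and "mono_on {0..} (deriv (deriv h))"
    and "\<forall>i. K i > 0"
  shows
    "let s = sigma_tilde \<sigma>;
         p\<^sub>1 = discounted_running_cost N W \<rho> h s;
         v = regulator_value M F B \<sigma> \<rho> h K
     in
     (K 1 = K 2 \<longrightarrow>
       (\<exists>!c. boundary_equation s \<rho> p\<^sub>1 (K 1) c) \<and>
       (\<forall>c. boundary_equation s \<rho> p\<^sub>1 (K 1) c \<longrightarrow>
          (\<exists>\<xi>. (\<forall>x. \<xi> x \<in> admissible M F \<rho>) \<and> both_reflect M B \<sigma> c \<xi>) \<and>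
          (\<forall>\<xi>. (\<forall>x. \<xi> x \<in> admissible M F \<rho>) \<and> both_reflect M B \<sigma> c \<xi> \<longrightarrow>
             pareto_optimal M F B \<sigma> \<rho> h K \<xi> \<and>
             (\<forall>x. regulator_cost M B \<sigma> \<rho> h K x (\<xi> x) = v x)) \<and>
          value_formula s \<rho> p\<^sub>1 (K 1) c v)) \<and>
     (K 1 > K 2 \<longrightarrow>
       (\<exists>!c. boundary_equation s \<rho> p\<^sub>1 (K 2) c) \<and>
       (\<forall>c. boundary_equation s \<rho> p\<^sub>1 (K 2) c \<longrightarrow>
          (\<exists>\<xi>. (\<forall>x. \<xi> x \<in> admissible M F \<rho>) \<and> second_reflects M B \<sigma> c \<xi>) \<and>
          (\<forall>\<xi>. (\<forall>x. \<xi> x \<in> admissible M F \<rho>) \<and> second_reflects M B \<sigma> c \<xi> \<longrightarrow>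
             pareto_optimal M F B \<sigma> \<rho> h K \<xi> \<and>
             (\<forall>x. regulator_cost M B \<sigma> \<rho> h K x (\<xi> x) = v x)) \<and>
          value_formula s \<rho> p\<^sub>1 (K 2) c v))"
proof -
  define s where "s = sigma_tilde \<sigma>"
  have s: "0 < s" unfolding s_def by (rule sigma_tilde_pos[OF assms(4,5)])
  obtain a b where ab: "0 < a" "\<And>y. a \<le> deriv (deriv h) y" "\<And>y. deriv (deriv h) y \<le> b"
    using assms(10) by (meson less_imp_le)
  have diff: "((deriv ^^ n) h has_real_derivative (deriv ^^ Suc n) h x) (at x)" if "n < 3" for n x
    using assms(6) that by (simp add: differentiable_on_def DERIV_deriv_iff_real_differentiable)
  have d0: "(h has_real_derivative deriv h x) (at x)" for x using diff[of 0] by simp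
  have d1: "(deriv h has_real_derivative deriv (deriv h) x) (at x)" for x using diff[of 1] by simp
  have d2: "continuous_on UNIV (deriv (deriv h))"
    using assms(6)[rule_format, of 2] by (simp add: differentiable_imp_continuous_on numeral_2_eq_2)
  interpret convex_cost \<rho> s a b h "deriv h" "deriv (deriv h)"
    by unfold_locales (use assms(3,8,9) s ab d0 d1 d2 in auto)
  obtain C P P1 P2 P3 where "resolvent_cost \<rho> s a b h (deriv h) (deriv (deriv h)) C P P1 P2 P3"
    by (rule resolvent_exists) (rule that)
  then interpret resolvent_cost \<rho> s a b h "deriv h" "deriv (deriv h)" C P P1 P2 P3 .
  have p1: "discounted_running_cost N W \<rho> h s = P"
    by (intro ext discounted_running_cost_eq[OF assms(2)])
  have unique: "\<exists>!c. boundary_equation s \<rho> P (K i) c" for i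
    by (rule boundary_equation_unique_solution) (use assms(12) in auto)
  have game: "two_player_game \<rho> s a b h (deriv h) (deriv (deriv h)) C P P1 P2 P3 M F B \<sigma> K" if "K 2 \<le> K 1"
    by unfold_locales (use assms(1,12) s_def that in auto)
  define claims where "claims R c \<longleftrightarrow> (\<exists>\<xi>. (\<forall>x. \<xi> x \<in> admissible M F \<rho>) \<and> R \<xi>) \<and>
    (\<forall>\<xi>. (\<forall>x. \<xi> x \<in> admissible M F \<rho>) \<and> R \<xi> \<longrightarrow> pareto_optimal M F B \<sigma> \<rho> h K \<xi> \<and>
      (\<forall>x. regulator_cost M B \<sigma> \<rho> h K x (\<xi> x) = regulator_value M F B \<sigma> \<rho> h K x)) \<and>
    value_formula s \<rho> P (K 2) c (regulator_value M F B \<sigma> \<rho> h K)" for R c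
  have case1: "claims (both_reflect M B \<sigma> c) c"
    if K: "K 1 = K 2" and c: "boundary_equation s \<rho> P (K 2) c" for c
  proof -
    interpret two_player_game \<rho> s a b h "deriv h" "deriv (deriv h)" C P P1 P2 P3 M F B \<sigma> K
      by (rule game) (use K in simp)
    show ?thesis
      unfolding claims_def
    proof (rule game_solution[OF c])
      fix \<xi> :: "'a policy" and x :: "real ^ 2"
      assume br: "both_reflect M B \<sigma> c \<xi>" and adm: "\<And>x. \<xi> x \<in> admissible M F \<rho>"
      show "\<exists>\<alpha> \<gamma>. admissible_process M F \<rho> \<alpha> \<and> admissible_process M F \<rho> \<gamma> \<and> drives_reflection M B \<sigma> c x \<alpha> \<gamma> \<and>
        (AE \<omega> in M. \<forall>t\<ge>0. net_control (\<xi> x) t \<omega> = \<gamma> t \<omega> - \<alpha> t \<omega> \<and> total_effort (\<xi> x) t \<omega> = \<alpha> t \<omega> + \<gamma> t \<omega>) \<and>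
        (K 1 = K 2 \<or> (AE \<omega> in M. \<forall>t\<ge>0. fst (\<xi> x 1) t \<omega> = 0 \<and> snd (\<xi> x 1) t \<omega> = 0))"
      proof (intro exI conjI)
        note sys = br[unfolded both_reflect_def, rule_format, of x]
        show "admissible_process M F \<rho> (snd (\<xi> x 1))" "admissible_process M F \<rho> (snd (\<xi> x 2))"
          using admissibleD[OF adm[of x]] by auto
        show "drives_reflection M B \<sigma> c x (snd (\<xi> x 1)) (snd (\<xi> x 2))"
          unfolding drives_reflection_def using sys by eventually_elim auto
        show "AE \<omega> in M. \<forall>t\<ge>0. net_control (\<xi> x) t \<omega> = snd (\<xi> x 2) t \<omega> - snd (\<xi> x 1) t \<omega> \<and>
            total_effort (\<xi> x) t \<omega> = snd (\<xi> x 1) t \<omega> + snd (\<xi> x 2) t \<omega>"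
          using sys unfolding net_control_def total_effort_def by eventually_elim simp
      qed (use K in simp)
    next
      fix \<alpha> \<gamma> :: "real ^ 2 \<Rightarrow> 'a process"
      assume adm: "\<And>x. admissible_process M F \<rho> (\<alpha> x)" "\<And>x. admissible_process M F \<rho> (\<gamma> x)"
        and dr: "\<And>x. drives_reflection M B \<sigma> c x (\<alpha> x) (\<gamma> x)"
      show "\<exists>\<xi>. (\<forall>x. \<xi> x \<in> admissible M F \<rho>) \<and> both_reflect M B \<sigma> c \<xi>"
        using adm dr zero_process_admissible
        by (intro exI[of _ "\<lambda>x i. if i = 1 then ((\<lambda>t \<omega>. 0), \<alpha> x) else ((\<lambda>t \<omega>. 0), \<gamma> x)"])
          (auto simp: admissible_def both_reflect_def drives_reflection_def)
    qed
  qed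
  have case2: "claims (second_reflects M B \<sigma> c) c"
    if K: "K 2 < K 1" and c: "boundary_equation s \<rho> P (K 2) c" for c
  proof -
    interpret two_player_game \<rho> s a b h "deriv h" "deriv (deriv h)" C P P1 P2 P3 M F B \<sigma> K
      by (rule game) (use K in simp)
    show ?thesis
      unfolding claims_def
    proof (rule game_solution[OF c])
      fix \<xi> :: "'a policy" and x :: "real ^ 2"
      assume sr: "second_reflects M B \<sigma> c \<xi>" and adm: "\<And>x. \<xi> x \<in> admissible M F \<rho>"
      show "\<exists>\<alpha> \<gamma>. admissible_process M F \<rho> \<alpha> \<and> admissible_process M F \<rho> \<gamma> \<and> drives_reflection M B \<sigma> c x \<alpha> \<gamma> \<and>
        (AE \<omega> in M. \<forall>t\<ge>0. net_control (\<xi> x) t \<omega> = \<gamma> t \<omega> - \<alpha> t \<omega> \<and> total_effort (\<xi> x) t \<omega> = \<alpha> t \<omega> + \<gamma> t \<omega>) \<and>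
        (K 1 = K 2 \<or> (AE \<omega> in M. \<forall>t\<ge>0. fst (\<xi> x 1) t \<omega> = 0 \<and> snd (\<xi> x 1) t \<omega> = 0))"
      proof (intro exI conjI disjI2)
        note sys = sr[unfolded second_reflects_def, rule_format, of x]
        show "admissible_process M F \<rho> (fst (\<xi> x 2))" "admissible_process M F \<rho> (snd (\<xi> x 2))"
          using admissibleD[OF adm[of x]] by auto
        show "drives_reflection M B \<sigma> c x (fst (\<xi> x 2)) (snd (\<xi> x 2))"
          unfolding drives_reflection_def using sys by eventually_elim auto
        show "AE \<omega> in M. \<forall>t\<ge>0. net_control (\<xi> x) t \<omega> = snd (\<xi> x 2) t \<omega> - fst (\<xi> x 2) t \<omega> \<and>
            total_effort (\<xi> x) t \<omega> = fst (\<xi> x 2) t \<omega> + snd (\<xi> x 2) t \<omega>"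
          using sys unfolding net_control_def total_effort_def by eventually_elim simp
        show "AE \<omega> in M. \<forall>t\<ge>0. fst (\<xi> x 1) t \<omega> = 0 \<and> snd (\<xi> x 1) t \<omega> = 0"
          using sys by eventually_elim simp
      qed
    next
      fix \<alpha> \<gamma> :: "real ^ 2 \<Rightarrow> 'a process"
      assume adm: "\<And>x. admissible_process M F \<rho> (\<alpha> x)" "\<And>x. admissible_process M F \<rho> (\<gamma> x)"
        and dr: "\<And>x. drives_reflection M B \<sigma> c x (\<alpha> x) (\<gamma> x)"
      show "\<exists>\<xi>. (\<forall>x. \<xi> x \<in> admissible M F \<rho>) \<and> second_reflects M B \<sigma> c \<xi>"
      proof (intro exI conjI allI)
        let ?\<xi> = "\<lambda>(x :: real ^ 2) (i :: 2). if i = 1 then ((\<lambda>t \<omega>. 0), (\<lambda>t \<omega>. 0)) else (\<alpha> x, \<gamma> x)"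
        show "?\<xi> x \<in> admissible M F \<rho>" for x
          using adm zero_process_admissible by (auto simp: admissible_def)
        show "second_reflects M B \<sigma> c ?\<xi>"
          unfolding second_reflects_def
        proof
          fix x show "AE \<omega> in M. \<forall>t\<ge>0. fst (?\<xi> x 1) t \<omega> = 0 \<and> snd (?\<xi> x 1) t \<omega> = 0 \<and>
              snd (?\<xi> x 2) t \<omega> = running_max0 (\<lambda>u. - (x $ 1 - x $ 2) + (\<sigma> $ 2 - \<sigma> $ 1) \<bullet> B u \<omega> + fst (?\<xi> x 2) u \<omega> - c) t \<and>
              fst (?\<xi> x 2) t \<omega> = running_max0 (\<lambda>u. (x $ 1 - x $ 2) + (\<sigma> $ 1 - \<sigma> $ 2) \<bullet> B u \<omega> + snd (?\<xi> x 2) u \<omega> - c) t"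
            using dr[of x] unfolding drives_reflection_def by eventually_elim auto
        qed
      qed
    qed
  qed
  show ?thesis
    unfolding Let_def s_def[symmetric] p1 using unique case1 case2 by (auto simp: claims_def)
qed

end
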